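(* Let $K$ be a field, $N\ge1$, and assume that $\mathrm{char}\,K=0$ or $N<\mathrm{char}\,K$. Let $R$ be (the R-matrix of) a universal power series solution over $K$ on the $N$-dimensional formal polydisk, with linear part $R_1(x,y)=(cx+dy,\ ax+by)$, $a,b,c,d\in \mathrm{Mat}_N(K)$. If the eigenvalues of $b$ are resonance free, then $R$ is isomorphic to its linear part $R_1$.
   Context: Formal mappings. $D^N$ denotes the formal $N$-dimensional polydisk over $K$. A formal mapping $D^N\to D^M$ is a vector $\phi=(\phi_1,\dots,\phi_M)$ of power series $\phi_i\in K[[x_1,\dots,x_N]]$ with zero constant term; formal mappings are composed by substitution. If $I$ is a commutative (non-unital) $K$-algebra all of whose elements are nilpotent (a nilpotent commutative algebra), a formal mapping $D^N\to D^M$ induces a map $I^N\to I^M$. Symmetric sets. For a set $X$ and a bijection $S=(S_1,S_2):X^2\to X^2$: $(X,S)$ is nondegenerate if for all fixed $y,z\in X$ the maps $x\mapsto S_2(x,y)$, $x\mapsto S_1(z,x)$ are bijections; braided if $S^{12}S^{23}S^{12}=S^{23}S^{12}S^{23}$ on $X^3$; involutive if $S^2=\mathrm{id}$; symmetric if braided and involutive. Power series solutions. A formal mapping $S:D^N\times D^N\to D^N\times D^N$ is a universal power series solution over $K$ if for every nilpotent commutative $K$-algebra $I$, $S$ induces on $X=I^N$ the structure of a nondegenerate symmetric set. The corresponding R-matrix is $R=\sigma\circ S$, with $\sigma(x,y)=(y,x)$. The linear part $R_1$ of $R$ is the collection of all linear terms of $R$; it is again (the R-matrix of) a solution. Two solutions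 $S,S'$ are isomorphic if there is an invertible formal mapping $\phi:D^N\to D^N$ with $S'=(\phi\times\phi)S(\phi^{-1}\times\phi^{-1})$ (equivalently $R'=(\phi\times\phi)R(\phi^{-1}\times\phi^{-1})$). Resonance free. A collection $\lambda_1,\dots,\lambda_N$ of elements of the algebraic closure $\bar K$ (here the eigenvalues of $b$) is resonance free if the equation $\lambda_i=\lambda_{i_1}\cdots\lambda_{i_m}$ is not satisfied for any $m\ge2$ and $1\le i,i_1,\dots,i_m\le N$. *)

theory Defs
  imports
    "HOL-Library.Multiset"
    "HOL-Algebra.Algebraic_Closure_Type"
    "HOL-Algebra.Module"
    "HOL-Analysis.Finite_Cartesian_Product"
begin

unbundle no fps_syntax

section \<open>Power series in several variables\<close>

text \<open>
  The monomials in variables indexed by \<open>'v\<close> are the finite multisets over \<open>'v\<close>: the multiset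
  \<open>{#i, i, j#}\<close> stands for $x_i^2 x_j$, and \<open>size\<close> is the total degree.
\<close>

typedef ('k, 'v) mfps = "UNIV :: ('v multiset \<Rightarrow> 'k) set"
  morphisms mcoeff Abs_mfps ..

setup_lifting type_definition_mfps

lemma mfps_eqI: "(\<And>M. mcoeff f M = mcoeff g M) \<Longrightarrow> f = g"
  by (simp add: mcoeff_inject [symmetric] fun_eq_iff)

lemma finite_submultisets: "finite {A. A \<subseteq># (M :: 'v multiset)}"
proof (rule finite_subset)
  show "{A. A \<subseteq># M} \<subseteq> (\<Union>n\<le>size M. multisets_of_size (set_mset M) n)"
    by (auto simp: multisets_of_size_def size_mset_mono dest: mset_subset_eqD)
qed auto

lemma finite_splittings: "finite {(A, B). A + B = (M :: 'v multiset)}"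
  by (rule finite_subset [of _ "{A. A \<subseteq># M} \<times> {B. B \<subseteq># M}"])
    (auto simp: finite_submultisets)

instantiation mfps :: (comm_ring_1, type) comm_ring_1
begin

lift_definition zero_mfps :: "('a, 'b) mfps" is "\<lambda>_. 0" .
lift_definition one_mfps :: "('a, 'b) mfps" is "\<lambda>M. if M = {#} then 1 else 0" .
lift_definition plus_mfps :: "('a, 'b) mfps \<Rightarrow> ('a, 'b) mfps \<Rightarrow> ('a, 'b) mfps"
  is "\<lambda>f g M. f M + g M" .
lift_definition minus_mfps :: "('a, 'b) mfps \<Rightarrow> ('a, 'b) mfps \<Rightarrow> ('a, 'b) mfps"
  is "\<lambda>f g M. f M - g M" .
lift_definition uminus_mfps :: "('a, 'b) mfps \<Rightarrow> ('a, 'b) mfps"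
  is "\<lambda>f M. - f M" .
lift_definition times_mfps :: "('a, 'b) mfps \<Rightarrow> ('a, 'b) mfps \<Rightarrow> ('a, 'b) mfps"
  is "\<lambda>f g M. \<Sum>(A, B) | A + B = M. f A * g B" .

instance
proof
  fix f g h :: "('a, 'b) mfps"
  show "f * g * h = f * (g * h)"
  proof (rule mfps_eqI)
    fix M
    let ?P = "\<lambda>M. {(A, B). A + B = (M :: 'b multiset)}"
    have "mcoeff (f * g * h) M =
        (\<Sum>(D, C)\<in>?P M. \<Sum>(A, B)\<in>?P D. mcoeff f A * mcoeff g B * mcoeff h C)"
      by (simp add: times_mfps.rep_eq sum_distrib_right case_prod_beta)
    also have "\<dots> = (\<Sum>((D, C), (A, B)) \<in> (SIGMA p : ?P M. ?P (fst p)).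
        mcoeff f A * mcoeff g B * mcoeff h C)"
      by (subst sum.Sigma [symmetric]) (auto simp: finite_splittings case_prod_beta)
    also have "\<dots> = (\<Sum>((A, E), (B, C)) \<in> (SIGMA p : ?P M. ?P (snd p)).
        mcoeff f A * (mcoeff g B * mcoeff h C))"
      by (rule sum.reindex_bij_witness
          [where i = "\<lambda>((A, E), (B, C)). ((A + B, C), (A, B))"
             and j = "\<lambda>((D, C), (A, B)). ((A, B + C), (B, C))"])
        (auto simp: mult.assoc add.assoc)
    also have "\<dots> =
        (\<Sum>(A, E)\<in>?P M. \<Sum>(B, C)\<in>?P E. mcoeff f A * (mcoeff g B * mcoeff h C))"
      by (subst sum.Sigma [symmetric]) (auto simp: finite_splittings case_prod_beta)
    also have "\<dots> = mcoeff (f * (g * h)) M"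
      by (simp add: times_mfps.rep_eq sum_distrib_left case_prod_beta)
    finally show "mcoeff (f * g * h) M = mcoeff (f * (g * h)) M" .
  qed
  show "f * g = g * f"
  proof (rule mfps_eqI)
    fix M
    show "mcoeff (f * g) M = mcoeff (g * f) M"
      unfolding times_mfps.rep_eq
      by (rule sum.reindex_bij_witness [where i = prod.swap and j = prod.swap])
        (auto simp: mult.commute add.commute)
  qed
  show "1 * f = f"
  proof (rule mfps_eqI)
    fix M
    have "mcoeff (1 * f) M =
        (\<Sum>(A, B)\<in>{({#} :: 'b multiset, M)}. (if A = {#} then 1 else 0) * mcoeff f B)"
      unfolding times_mfps.rep_eq one_mfps.rep_eq
      by (rule sum.mono_neutral_right) (use finite_splittings [of M] in \<open>auto split: if_splits\<close>)
    then show "mcoeff (1 * f) M = mcoeff f M"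
      by simp
  qed
  show "(f + g) * h = f * h + g * h"
    by (rule mfps_eqI)
      (simp add: times_mfps.rep_eq plus_mfps.rep_eq distrib_right sum.distrib case_prod_beta)
  show "(0 :: ('a, 'b) mfps) \<noteq> 1"
    by transfer (metis zero_neq_one)
qed (auto intro!: mfps_eqI simp: zero_mfps.rep_eq plus_mfps.rep_eq minus_mfps.rep_eq
      uminus_mfps.rep_eq)

end

lift_definition mfps_const :: "'k::comm_ring_1 \<Rightarrow> ('k, 'v) mfps"
  is "\<lambda>a M. if M = {#} then a else 0" .

lift_definition mfps_var :: "'v \<Rightarrow> ('k::comm_ring_1, 'v) mfps"
  is "\<lambda>i M. if M = {#i#} then 1 else 0" .

text \<open>
  Substitution $f(\phi_1, \phi_2, \dots)$ into a series in finitely many variables.  It is meant for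
  \<open>\<phi>\<close> with zero constant terms; then a monomial of degree larger than \<open>size T\<close> does not
  contribute to the coefficient at \<open>T\<close>, so the truncated sum below is the full one.
\<close>

lift_definition mfps_subst ::
  "('k::comm_ring_1, 'w::finite) mfps \<Rightarrow> ('w \<Rightarrow> ('k, 'v) mfps) \<Rightarrow> ('k, 'v) mfps"
  is "\<lambda>f \<phi> T. \<Sum>M | size M \<le> size T. f M * mcoeff (\<Prod>i\<in>#M. \<phi> i) T" .


section \<open>Formal mappings\<close>

text \<open>
  A formal mapping $D^N \to D^M$ is a family, indexed by a type with $M$ elements, of series in
  variables indexed by a type with $N$ elements.  If \<open>'n\<close> has $N$ elements,
  then \<open>'n + 'n\<close> indexes the coordinates of $D^N \times D^N$, \<open>Inl\<close> those of the first factor.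
\<close>

type_synonym ('k, 'v, 'w) formal_map = "'w \<Rightarrow> ('k, 'v) mfps"

definition formal_mapping :: "('k::comm_ring_1, 'v, 'w) formal_map \<Rightarrow> bool" where
  "formal_mapping \<phi> \<longleftrightarrow> (\<forall>j. mcoeff (\<phi> j) {#} = 0)"

definition fm_id :: "('k::comm_ring_1, 'v, 'v) formal_map" where
  "fm_id = mfps_var"

definition fm_comp ::
  "('k::comm_ring_1, 'v::finite, 'w) formal_map \<Rightarrow> ('k, 'u, 'v) formal_map \<Rightarrow> ('k, 'u, 'w) formal_map"
  (infixl "\<circ>\<^sub>f" 55)
  where "\<phi> \<circ>\<^sub>f \<psi> = (\<lambda>j. mfps_subst (\<phi> j) \<psi>)"

definition fm_prod ::
  "('k::comm_ring_1, 'v::finite, 'w) formal_map \<Rightarrow> ('k, 'v'::finite, 'w') formal_map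
    \<Rightarrow> ('k, 'v + 'v', 'w + 'w') formal_map"
  where "fm_prod \<phi> \<psi> = case_sum
    (\<lambda>j. mfps_subst (\<phi> j) (\<lambda>i. mfps_var (Inl i)))
    (\<lambda>j. mfps_subst (\<psi> j) (\<lambda>i. mfps_var (Inr i)))"

definition fm_flip :: "('k::comm_ring_1, 'n + 'n, 'n + 'n) formal_map" where
  "fm_flip = case_sum (\<lambda>i. mfps_var (Inr i)) (\<lambda>i. mfps_var (Inl i))"

definition linear_part ::
  "('k::comm_ring_1, 'v, 'w) formal_map \<Rightarrow> ('k, 'v, 'w) formal_map" where
  "linear_part \<phi> = (\<lambda>j. Abs_mfps (\<lambda>M. if size M = 1 then mcoeff (\<phi> j) M else 0))"

definition linear_R ::
  "'k::comm_ring_1^'n^'n \<Rightarrow> 'k^'n^'n \<Rightarrow> 'k^'n^'n \<Rightarrow> 'k^'n^'n \<Rightarrow> ('k, 'n + 'n, 'n + 'n) formal_map"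
  \<comment> \<open>$(x, y) \mapsto (c x + d y, a x + b y)$\<close>
  where "linear_R a b c d = case_sum
    (\<lambda>i. (\<Sum>j\<in>UNIV. mfps_const (c $ i $ j) * mfps_var (Inl j))
       + (\<Sum>j\<in>UNIV. mfps_const (d $ i $ j) * mfps_var (Inr j)))
    (\<lambda>i. (\<Sum>j\<in>UNIV. mfps_const (a $ i $ j) * mfps_var (Inl j))
       + (\<Sum>j\<in>UNIV. mfps_const (b $ i $ j) * mfps_var (Inr j)))"


section \<open>Evaluation on nilpotent commutative algebras\<close>

text \<open>Product of a nonempty list, not referring to a unit element.\<close>

fun prod_nonempty :: "('i, 'm) monoid_scheme \<Rightarrow> 'i list \<Rightarrow> 'i" where
  "prod_nonempty A [x] = x"
| "prod_nonempty A (x # y # ys) = x \<otimes>\<^bsub>A\<^esub> prod_nonempty A (y # ys)"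

text \<open>
  The underlying record has a field for a unit, but nothing is assumed about it and it is
  never used.
\<close>

locale nilpotent_algebra =
  Module.module ring_of_type_algebra A
  for A :: "('k::field, 'i) module" (structure) +
  assumes mult_closed: "\<lbrakk>x \<in> carrier A; y \<in> carrier A\<rbrakk> \<Longrightarrow> x \<otimes> y \<in> carrier A"
    and mult_assoc: "\<lbrakk>x \<in> carrier A; y \<in> carrier A; z \<in> carrier A\<rbrakk>
      \<Longrightarrow> (x \<otimes> y) \<otimes> z = x \<otimes> (y \<otimes> z)"
    and mult_comm: "\<lbrakk>x \<in> carrier A; y \<in> carrier A\<rbrakk> \<Longrightarrow> x \<otimes> y = y \<otimes> x"
    and mult_add: "\<lbrakk>x \<in> carrier A; y \<in> carrier A; z \<in> carrier A\<rbrakk>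
      \<Longrightarrow> (x \<oplus> y) \<otimes> z = x \<otimes> z \<oplus> y \<otimes> z"
    and mult_smult: "\<lbrakk>x \<in> carrier A; y \<in> carrier A\<rbrakk> \<Longrightarrow> (a \<odot> x) \<otimes> y = a \<odot> (x \<otimes> y)"
    and nilpotent: "x \<in> carrier A \<Longrightarrow> \<exists>n>0. prod_nonempty A (replicate n x) = \<zero>"

text \<open>
  The value of a nonempty monomial: by commutativity, all orderings of the factors give the same
  product.
\<close>

definition monomial_value :: "('k, 'i) module \<Rightarrow> ('v \<Rightarrow> 'i) \<Rightarrow> 'v multiset \<Rightarrow> 'i" where
  "monomial_value A x M = (THE r. \<exists>l. mset l = M \<and> r = prod_nonempty A (map x l))"

text \<open>
  The value of a series with zero constant term at a point of $I^N$.  As the finitely many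
  coordinates of the point are nilpotent, only finitely many monomials have nonzero value.
\<close>

definition mfps_value :: "('k::field, 'i) module \<Rightarrow> ('k, 'v) mfps \<Rightarrow> ('v \<Rightarrow> 'i) \<Rightarrow> 'i" where
  "mfps_value A f x =
    (\<Oplus>\<^bsub>A\<^esub> M \<in> {M. M \<noteq> {#} \<and> mcoeff f M \<noteq> 0 \<and> monomial_value A x M \<noteq> \<zero>\<^bsub>A\<^esub>}.
      mcoeff f M \<odot>\<^bsub>A\<^esub> monomial_value A x M)"

definition points :: "('k, 'i) module \<Rightarrow> ('v \<Rightarrow> 'i) set" where
  "points A = {x. \<forall>i. x i \<in> carrier A}"

text \<open>The map $I^N \times I^N \to I^N \times I^N$ induced by $S$.\<close>

definition induced_map ::
  "('k::field, 'i) module \<Rightarrow> ('k, 'n + 'n, 'n + 'n) formal_map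
    \<Rightarrow> ('n \<Rightarrow> 'i) \<times> ('n \<Rightarrow> 'i) \<Rightarrow> ('n \<Rightarrow> 'i) \<times> ('n \<Rightarrow> 'i)" where
  "induced_map A S = (\<lambda>(x, y).
    (\<lambda>i. mfps_value A (S (Inl i)) (case_sum x y),
     \<lambda>i. mfps_value A (S (Inr i)) (case_sum x y)))"


section \<open>Symmetric sets\<close>

definition S12 :: "('x \<times> 'x \<Rightarrow> 'x \<times> 'x) \<Rightarrow> 'x \<times> 'x \<times> 'x \<Rightarrow> 'x \<times> 'x \<times> 'x" where
  "S12 S = (\<lambda>(x, y, z). (fst (S (x, y)), snd (S (x, y)), z))"

definition S23 :: "('x \<times> 'x \<Rightarrow> 'x \<times> 'x) \<Rightarrow> 'x \<times> 'x \<times> 'x \<Rightarrow> 'x \<times> 'x \<times> 'x" where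
  "S23 S = (\<lambda>(x, y, z). (x, S (y, z)))"

definition nondegenerate :: "'x set \<Rightarrow> ('x \<times> 'x \<Rightarrow> 'x \<times> 'x) \<Rightarrow> bool" where
  "nondegenerate V S \<longleftrightarrow>
    (\<forall>y\<in>V. bij_betw (\<lambda>x. snd (S (x, y))) V V) \<and>
    (\<forall>z\<in>V. bij_betw (\<lambda>x. fst (S (z, x))) V V)"

definition braided :: "'x set \<Rightarrow> ('x \<times> 'x \<Rightarrow> 'x \<times> 'x) \<Rightarrow> bool" where
  "braided V S \<longleftrightarrow>
    (\<forall>t \<in> V \<times> V \<times> V. S12 S (S23 S (S12 S t)) = S23 S (S12 S (S23 S t)))"

definition involutive :: "'x set \<Rightarrow> ('x \<times> 'x \<Rightarrow> 'x \<times> 'x) \<Rightarrow> bool" where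
  "involutive V S \<longleftrightarrow> (\<forall>p \<in> V \<times> V. S (S p) = p)"

definition nondegenerate_symmetric_set :: "'x set \<Rightarrow> ('x \<times> 'x \<Rightarrow> 'x \<times> 'x) \<Rightarrow> bool" where
  "nondegenerate_symmetric_set V S \<longleftrightarrow>
    bij_betw S (V \<times> V) (V \<times> V) \<and> nondegenerate V S \<and> braided V S \<and> involutive V S"


section \<open>Universal power series solutions\<close>

definition solution_on ::
  "'i itself \<Rightarrow> ('k::field, 'n::finite + 'n, 'n + 'n) formal_map \<Rightarrow> bool" where
  "solution_on TYPE('i) S \<longleftrightarrow>
    (\<forall>A :: ('k, 'i) module. nilpotent_algebra A \<longrightarrow>
      nondegenerate_symmetric_set (points A) (induced_map A S))"

text \<open>
  HOL cannot quantify over all algebras inside a formula, so the carriers are taken to be subsets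
  of the type \<open>nat \<Rightarrow> 'k\<close>.  Every algebra of at most countable dimension has a copy there, and that
  suffices: the lemma \<open>universal_solution_imp_solution_on\<close> below shows that the
  property then holds for algebras with carriers in an arbitrary type.
\<close>

definition universal_solution ::
  "('k::field, 'n::finite + 'n, 'n + 'n) formal_map \<Rightarrow> bool" where
  "universal_solution S \<longleftrightarrow> formal_mapping S \<and> solution_on TYPE(nat \<Rightarrow> 'k) S"

definition R_matrix ::
  "('k::field, 'n::finite + 'n, 'n + 'n) formal_map \<Rightarrow> ('k, 'n + 'n, 'n + 'n) formal_map" where
  "R_matrix S = fm_flip \<circ>\<^sub>f S"

definition isomorphic_solutions ::
  "('k::field, 'n::finite + 'n, 'n + 'n) formal_map \<Rightarrow> ('k, 'n + 'n, 'n + 'n) formal_map \<Rightarrow> bool"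
  where
  "isomorphic_solutions R R' \<longleftrightarrow>
    (\<exists>\<phi> \<phi>' :: ('k, 'n, 'n) formal_map.
      formal_mapping \<phi> \<and> formal_mapping \<phi>' \<and> \<phi> \<circ>\<^sub>f \<phi>' = fm_id \<and> \<phi>' \<circ>\<^sub>f \<phi> = fm_id \<and>
      R' = fm_prod \<phi> \<phi> \<circ>\<^sub>f R \<circ>\<^sub>f fm_prod \<phi>' \<phi>')"


section \<open>Eigenvalues and resonance\<close>

definition eigenvalues :: "'k::field^'n^'n \<Rightarrow> 'k alg_closure set" where
  "eigenvalues b = {e. \<exists>v. v \<noteq> 0 \<and> (\<chi> i j. to_ac (b $ i $ j)) *v v = e *s v}"

text \<open>
  Repetitions in the collection do not matter for this condition, so collections are sets.
\<close>

definition resonance_free :: "'l::comm_monoid_mult set \<Rightarrow> bool" where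
  "resonance_free E \<longleftrightarrow>
    \<not> (\<exists>e\<in>E. \<exists>es. length es \<ge> 2 \<and> set es \<subseteq> E \<and> e = prod_list es)"


section \<open>Independence of the carrier type\<close>

lemma ring_of_type_algebra_simps [simp]:
  "carrier ring_of_type_algebra = UNIV"
  "x \<oplus>\<^bsub>ring_of_type_algebra\<^esub> y = x + y"
  "x \<otimes>\<^bsub>ring_of_type_algebra\<^esub> y = x * y"
  "\<one>\<^bsub>ring_of_type_algebra\<^esub> = 1"
  by (simp_all add: ring_of_type_algebra_def)

context nilpotent_algebra
begin

lemma add_smult_closed:
  "x \<in> carrier A \<Longrightarrow> y \<in> carrier A \<Longrightarrow> x \<oplus> y \<in> carrier A"
  "x \<in> carrier A \<Longrightarrow> a \<odot> x \<in> carrier A"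
  using M.add.m_closed smult_closed [of a x] by auto

lemma prod_nonempty_Cons: "xs \<noteq> [] \<Longrightarrow> prod_nonempty A (x # xs) = x \<otimes> prod_nonempty A xs"
  by (cases xs) auto

lemma prod_nonempty_closed:
  "xs \<noteq> [] \<Longrightarrow> set xs \<subseteq> carrier A \<Longrightarrow> prod_nonempty A xs \<in> carrier A"
  by (induction xs rule: list_nonempty_induct) (auto simp: mult_closed prod_nonempty_Cons)

lemma prod_nonempty_insert:
  assumes "xs @ ys \<noteq> []" "y \<in> carrier A" "set xs \<subseteq> carrier A" "set ys \<subseteq> carrier A"
  shows "prod_nonempty A (xs @ y # ys) = y \<otimes> prod_nonempty A (xs @ ys)"
  using assms
proof (induction xs)
  case Nil
  then show ?case by (simp add: prod_nonempty_Cons)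
next
  case (Cons x xs)
  show ?case
  proof (cases "xs @ ys = []")
    case True
    with Cons.prems show ?thesis by (simp add: mult_comm)
  next
    case False
    with Cons have "prod_nonempty A ((x # xs) @ y # ys) = x \<otimes> (y \<otimes> prod_nonempty A (xs @ ys))"
      by (simp add: prod_nonempty_Cons)
    also have "\<dots> = y \<otimes> (x \<otimes> prod_nonempty A (xs @ ys))"
      using Cons.prems False prod_nonempty_closed [of "xs @ ys"]
      by (metis (no_types, lifting) insert_subset list.simps(15) mult_assoc mult_comm set_append
          Un_least)
    finally show ?thesis using False by (simp add: prod_nonempty_Cons)
  qed
qed

lemma prod_nonempty_mset_eq:
  "mset xs = mset ys \<Longrightarrow> set xs \<subseteq> carrier A \<Longrightarrow> prod_nonempty A xs = prod_nonempty A ys"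
proof (induction xs arbitrary: ys)
  case (Cons x xs)
  have "x \<in> set ys" using Cons.prems(1) by (metis list.set_intros(1) set_mset_mset)
  then obtain us vs where ys: "ys = us @ x # vs" by (meson split_list)
  with Cons.prems have m: "mset xs = mset (us @ vs)" by simp
  have s: "set us \<union> set vs \<subseteq> carrier A"
    using Cons.prems(2) mset_eq_setD [OF m] by auto
  show ?case
  proof (cases "xs = []")
    case True
    with m have "us @ vs = []" by simp
    then show ?thesis using True ys by simp
  next
    case False
    with m have "us @ vs \<noteq> []" by auto
    with False s Cons.prems Cons.IH [OF m] show ?thesis
      by (simp add: ys prod_nonempty_Cons prod_nonempty_insert)
  qed
qed simp

lemma monomial_value_mset:
  assumes "range x \<subseteq> carrier A"
  shows "monomial_value A x (mset l) = prod_nonempty A (map x l)"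
  unfolding monomial_value_def
proof (rule the_equality)
  fix r assume "\<exists>l'. mset l' = mset l \<and> r = prod_nonempty A (map x l')"
  then obtain l' where "mset l' = mset l" "r = prod_nonempty A (map x l')" by blast
  with assms show "r = prod_nonempty A (map x l)"
    using prod_nonempty_mset_eq [of "map x l'" "map x l"] by auto
qed auto

lemma monomial_value_closed:
  assumes "range x \<subseteq> carrier A" "M \<noteq> {#}"
  shows "monomial_value A x M \<in> carrier A"
proof -
  obtain l where "M = mset l" using ex_mset by metis
  with assms show ?thesis
    using prod_nonempty_closed [of "map x l"] by (auto simp: monomial_value_mset)
qed

lemma mfps_value_closed:
  assumes "range x \<subseteq> carrier A"
  shows "mfps_value A f x \<in> carrier A"
  unfolding mfps_value_def
  by (rule M.finsum_closed) (auto intro!: add_smult_closed monomial_value_closed assms)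

lemma induced_map_closed:
  assumes "p \<in> points A \<times> points A"
  shows "induced_map A S p \<in> points A \<times> points A"
proof -
  have "range (case_sum (fst p) (snd p)) \<subseteq> carrier A"
    using assms by (auto simp: points_def split: sum.splits)
  then show ?thesis
    by (auto simp: induced_map_def points_def split_beta intro!: mfps_value_closed)
qed

end

text \<open>Embeddings of nilpotent algebras commute with all the constructions.\<close>

locale nilpotent_algebra_embedding =
  B: nilpotent_algebra B + A: nilpotent_algebra A
  for B :: "('k::field, 'j) module" and A :: "('k, 'i) module" +
  fixes F :: "'j \<Rightarrow> 'i"
  assumes closed: "u \<in> carrier B \<Longrightarrow> F u \<in> carrier A"
    and inj: "inj_on F (carrier B)"
    and zero: "F \<zero>\<^bsub>B\<^esub> = \<zero>\<^bsub>A\<^esub>"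
    and add: "\<lbrakk>u \<in> carrier B; v \<in> carrier B\<rbrakk> \<Longrightarrow> F (u \<oplus>\<^bsub>B\<^esub> v) = F u \<oplus>\<^bsub>A\<^esub> F v"
    and mult: "\<lbrakk>u \<in> carrier B; v \<in> carrier B\<rbrakk> \<Longrightarrow> F (u \<otimes>\<^bsub>B\<^esub> v) = F u \<otimes>\<^bsub>A\<^esub> F v"
    and smult: "u \<in> carrier B \<Longrightarrow> F (a \<odot>\<^bsub>B\<^esub> u) = a \<odot>\<^bsub>A\<^esub> F u"
begin

lemma F_prod_nonempty:
  "l \<noteq> [] \<Longrightarrow> set l \<subseteq> carrier B \<Longrightarrow> F (prod_nonempty B l) = prod_nonempty A (map F l)"
  by (induction l rule: list_nonempty_induct)
    (auto simp: mult B.prod_nonempty_closed B.prod_nonempty_Cons A.prod_nonempty_Cons)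

lemma F_monomial_value:
  assumes "range x \<subseteq> carrier B" "M \<noteq> {#}"
  shows "F (monomial_value B x M) = monomial_value A (F \<circ> x) M"
proof -
  obtain l where l: "M = mset l" using ex_mset by metis
  have "range (F \<circ> x) \<subseteq> carrier A" using assms closed by auto
  moreover have "F (prod_nonempty B (map x l)) = prod_nonempty A (map F (map x l))"
    using assms l by (intro F_prod_nonempty) auto
  ultimately show ?thesis
    using assms l by (simp add: B.monomial_value_mset A.monomial_value_mset)
qed

lemma F_finsum:
  assumes "f \<in> J \<rightarrow> carrier B"
  shows "F (finsum B f J) = finsum A (\<lambda>i. F (f i)) J"
  using assms
proof (induction J rule: infinite_finite_induct)
  case (insert j J)
  then show ?case
    by (subst B.M.finsum_insert, simp_all, subst A.M.finsum_insert)
      (auto simp: Pi_def closed add B.M.finsum_closed)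
qed (simp_all add: zero B.M.finsum_infinite A.M.finsum_infinite)

lemma F_mfps_value:
  assumes "range x \<subseteq> carrier B"
  shows "F (mfps_value B f x) = mfps_value A f (F \<circ> x)"
proof -
  let ?J = "\<lambda>A x. {M. M \<noteq> {#} \<and> mcoeff f M \<noteq> 0 \<and> monomial_value A x M \<noteq> \<zero>\<^bsub>A\<^esub>}"
  have "(monomial_value A (F \<circ> x) M = \<zero>\<^bsub>A\<^esub>) = (monomial_value B x M = \<zero>\<^bsub>B\<^esub>)" if "M \<noteq> {#}" for M
    using that assms F_monomial_value [OF assms that] B.monomial_value_closed inj
    by (metis B.M.zero_closed inj_on_eq_iff zero)
  then have J: "?J B x = ?J A (F \<circ> x)" by blast
  have "F (mfps_value B f x) =
      finsum A (\<lambda>M. F (mcoeff f M \<odot>\<^bsub>B\<^esub> monomial_value B x M)) (?J B x)"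
    unfolding mfps_value_def
    by (rule F_finsum) (auto intro!: B.add_smult_closed B.monomial_value_closed assms)
  moreover have rF: "range (F \<circ> x) \<subseteq> carrier A"
    using assms closed by auto
  have "finsum A (\<lambda>M. F (mcoeff f M \<odot>\<^bsub>B\<^esub> monomial_value B x M)) (?J B x) =
      finsum A (\<lambda>M. mcoeff f M \<odot>\<^bsub>A\<^esub> monomial_value A (F \<circ> x) M) (?J B x)"
    by (rule A.M.finsum_cong')
      (auto intro!: A.add_smult_closed A.monomial_value_closed [OF rF]
        simp: smult B.monomial_value_closed F_monomial_value assms)
  ultimately show ?thesis by (simp add: J mfps_value_def)
qed

definition lift :: "('n \<Rightarrow> 'j) \<times> ('n \<Rightarrow> 'j) \<Rightarrow> ('n \<Rightarrow> 'i) \<times> ('n \<Rightarrow> 'i)" where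
  "lift = map_prod ((\<circ>) F) ((\<circ>) F)"

lemma lift_induced_map:
  assumes "p \<in> points B \<times> points B"
  shows "induced_map A S (lift p) = lift (induced_map B S p)"
proof -
  have r: "range (case_sum (fst p) (snd p)) \<subseteq> carrier B"
    using assms by (auto simp: points_def split: sum.splits)
  have "case_sum (F \<circ> fst p) (F \<circ> snd p) = F \<circ> case_sum (fst p) (snd p)"
    by (auto simp: fun_eq_iff split: sum.splits)
  with r show ?thesis
    by (simp add: induced_map_def lift_def split_beta map_prod_def F_mfps_value comp_def)
qed

lemma inj_points: "inj_on ((\<circ>) F) (points B)"
proof (rule inj_onI)
  fix x y assume "x \<in> points B" "y \<in> points B" "F \<circ> x = F \<circ> y"
  then show "x = y"
    using inj by (auto simp: points_def fun_eq_iff inj_on_def)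
qed

end

text \<open>
  Terms describing the elements of a countably generated algebra: the scalars occurring in a term
  are themselves represented by variables.
\<close>

datatype 's algebra_term =
    Zero | Gen nat
  | Add "'s algebra_term" "'s algebra_term"
  | Mult "'s algebra_term" "'s algebra_term"
  | Scale 's "'s algebra_term"

instance algebra_term :: (countable) countable
  by countable_datatype

context nilpotent_algebra
begin

fun term_value :: "(nat \<Rightarrow> 'i) \<Rightarrow> ('s \<Rightarrow> 'k) \<Rightarrow> 's algebra_term \<Rightarrow> 'i" where
  "term_value g e Zero = \<zero>"
| "term_value g e (Gen n) = g n"
| "term_value g e (Add s t) = term_value g e s \<oplus> term_value g e t"
| "term_value g e (Mult s t) = term_value g e s \<otimes> term_value g e t"
| "term_value g e (Scale a t) = e a \<odot> term_value g e t"

lemma term_value_closed: "range g \<subseteq> carrier A \<Longrightarrow> term_value g e t \<in> carrier A"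
  by (induction t) (auto simp: add_smult_closed mult_closed)

lemma term_value_map: "term_value g e (map_algebra_term r t) = term_value g (e \<circ> r) t"
  by (induction t) auto

text \<open>The subalgebra generated by a sequence, as the image of a type.\<close>

definition generated :: "(nat \<Rightarrow> 'i) \<Rightarrow> (nat \<Rightarrow> 'k) \<Rightarrow> 'i" where
  "generated g f = term_value g (\<lambda>n. f (2 * n + 1)) (from_nat (LEAST n. f (2 * n) \<noteq> 0))"

lemma range_generated: "range (generated g) = (\<Union>e. range (term_value g (e :: nat \<Rightarrow> 'k)))"
proof
  show "(\<Union>e. range (term_value g (e :: nat \<Rightarrow> 'k))) \<subseteq> range (generated g)"
  proof safe
    fix e :: "nat \<Rightarrow> 'k" and t :: "nat algebra_term"
    define f where
      "f n = (if even n then if n = 2 * to_nat t then 1 else 0 else e (n div 2))" for n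
    have "(LEAST n. f (2 * n) \<noteq> 0) = to_nat t"
      by (rule Least_equality) (auto simp: f_def split: if_splits)
    moreover have "(\<lambda>n. f (2 * n + 1)) = e" by (auto simp: f_def)
    ultimately have "generated g f = term_value g e t" by (simp add: generated_def)
    then show "term_value g e t \<in> range (generated g)" by (metis rangeI)
  qed
qed (auto simp: generated_def)

lemma generated_two:
  assumes "x \<in> range (generated g)" "y \<in> range (generated g)"
  obtains e :: "nat \<Rightarrow> 'k" and s t where "x = term_value g e s" "y = term_value g e t"
proof -
  obtain e1 e2 :: "nat \<Rightarrow> 'k" and s t where st: "x = term_value g e1 s" "y = term_value g e2 t"
    using assms unfolding range_generated by blast
  define e where "e n = (if even n then e1 (n div 2) else e2 (n div 2))" for n
  have "e \<circ> (\<lambda>n. 2 * n) = e1" "e \<circ> (\<lambda>n. 2 * n + 1) = e2" by (auto simp: e_def)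
  then show ?thesis
    by (intro that [of e "map_algebra_term (\<lambda>n. 2 * n) s" "map_algebra_term (\<lambda>n. 2 * n + 1) t"])
      (simp_all only: term_value_map st)
qed

lemma generated_zero: "\<zero> \<in> range (generated g)"
  unfolding range_generated by (metis UN_I UNIV_I rangeI term_value.simps(1))

lemma generated_gen: "g n \<in> range (generated g)"
  unfolding range_generated by (metis UN_I UNIV_I rangeI term_value.simps(2))

lemma generated_closed:
  assumes "x \<in> range (generated g)" "y \<in> range (generated g)"
  shows "x \<oplus> y \<in> range (generated g)" "x \<otimes> y \<in> range (generated g)" "a \<odot> x \<in> range (generated g)"
proof -
  obtain e :: "nat \<Rightarrow> 'k" and s t where st: "x = term_value g e s" "y = term_value g e t"
    using generated_two assms by blast
  have "x \<oplus> y = term_value g e (Add s t)" "x \<otimes> y = term_value g e (Mult s t)"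
    by (simp_all add: st)
  moreover have "a \<odot> x = term_value g (case_nat a e) (Scale 0 (map_algebra_term Suc s))"
    by (simp add: st term_value_map comp_def)
  ultimately show "x \<oplus> y \<in> range (generated g)" "x \<otimes> y \<in> range (generated g)"
    "a \<odot> x \<in> range (generated g)"
    unfolding range_generated by blast+
qed

lemma exists_embedding:
  fixes g :: "nat \<Rightarrow> 'i"
  assumes g: "range g \<subseteq> carrier A"
  obtains B :: "('k, nat \<Rightarrow> 'k) module" and F
  where "nilpotent_algebra_embedding B A F" "range g \<subseteq> F ` carrier B"
proof -
  define R where "R = range (generated g)"
  define F where "F = generated g"
  define h where "h = inv_into UNIV F"
  have RA: "x \<in> carrier A" if "x \<in> R" for x
    using that g term_value_closed by (auto simp: R_def generated_def)
  have Fh [simp]: "F (h x) = x" if "x \<in> R" for x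
    using that unfolding h_def R_def F_def by (rule f_inv_into_f)
  have RF: "F u \<in> R" for u by (auto simp: R_def F_def)
  have cl [simp]: "\<zero> \<in> R" "x \<in> R \<Longrightarrow> y \<in> R \<Longrightarrow> x \<oplus> y \<in> R" "x \<in> R \<Longrightarrow> y \<in> R \<Longrightarrow> x \<otimes> y \<in> R"
    "x \<in> R \<Longrightarrow> a \<odot> x \<in> R" for x y a
    unfolding R_def by (auto intro: generated_zero generated_closed simp del: image_iff)
  define B :: "('k, nat \<Rightarrow> 'k) module" where
    "B = \<lparr>carrier = h ` R, monoid.mult = (\<lambda>u v. h (F u \<otimes> F v)), one = undefined,
      ring.zero = h \<zero>, ring.add = (\<lambda>u v. h (F u \<oplus> F v)), module.smult = (\<lambda>a u. h (a \<odot> F u))\<rparr>"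
  have Bs: "carrier B = h ` R" "u \<otimes>\<^bsub>B\<^esub> v = h (F u \<otimes> F v)" "\<zero>\<^bsub>B\<^esub> = h \<zero>"
    "u \<oplus>\<^bsub>B\<^esub> v = h (F u \<oplus> F v)" "a \<odot>\<^bsub>B\<^esub> u = h (a \<odot> F u)" for u v a
    by (simp_all add: B_def)
  have ab: "abelian_group B"
  proof (rule abelian_groupI)
    fix u assume "u \<in> carrier B"
    then obtain x where x: "x \<in> R" "u = h x" by (auto simp: Bs)
    have "(- 1) \<odot> x \<oplus> x = (- 1) \<odot> x \<oplus> 1 \<odot> x"
      using x RA smult_one by simp
    also have "\<dots> = (- 1 + 1) \<odot> x"
      using smult_l_distr [of "- 1" 1 x] x RA by simp
    also have "\<dots> = \<zero>"
    proof -
      have "0 \<odot> x \<oplus> 0 \<odot> x = 0 \<odot> x"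
        using smult_l_distr [of 0 0 x] x RA by simp
      then show ?thesis using x RA add_smult_closed(2) [of x 0] by simp
    qed
    finally have "(- 1) \<odot> x \<oplus> x = \<zero>" .
    then show "\<exists>v\<in>carrier B. v \<oplus>\<^bsub>B\<^esub> u = \<zero>\<^bsub>B\<^esub>"
      using x by (intro bexI [of _ "h ((- 1) \<odot> x)"]) (auto simp: Bs)
  qed (auto simp: Bs RA M.add.m_ac)
  have md: "Module.module ring_of_type_algebra B"
  proof (rule Module.moduleI)
    fix a b :: 'k and u assume "u \<in> carrier B"
    then obtain x where x: "x \<in> R" "u = h x" by (auto simp: Bs)
    show "(a \<oplus>\<^bsub>ring_of_type_algebra\<^esub> b) \<odot>\<^bsub>B\<^esub> u = a \<odot>\<^bsub>B\<^esub> u \<oplus>\<^bsub>B\<^esub> b \<odot>\<^bsub>B\<^esub> u"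
      using x smult_l_distr [of a b x] by (simp add: Bs RA)
    show "(a \<otimes>\<^bsub>ring_of_type_algebra\<^esub> b) \<odot>\<^bsub>B\<^esub> u = a \<odot>\<^bsub>B\<^esub> (b \<odot>\<^bsub>B\<^esub> u)"
      using x smult_assoc1 [of a b x] by (simp add: Bs RA)
    show "\<one>\<^bsub>ring_of_type_algebra\<^esub> \<odot>\<^bsub>B\<^esub> u = u"
      using x smult_one [of x] by (simp add: Bs RA)
  next
    fix a :: 'k and u v assume "u \<in> carrier B" "v \<in> carrier B"
    then obtain x y where "x \<in> R" "u = h x" "y \<in> R" "v = h y" by (auto simp: Bs)
    then show "a \<odot>\<^bsub>B\<^esub> (u \<oplus>\<^bsub>B\<^esub> v) = a \<odot>\<^bsub>B\<^esub> u \<oplus>\<^bsub>B\<^esub> a \<odot>\<^bsub>B\<^esub> v"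
      using smult_r_distr [of a x y] by (simp add: Bs RA)
  qed (auto simp: Bs ab R.is_cring)
  have pr: "l \<noteq> [] \<Longrightarrow> set l \<subseteq> R \<Longrightarrow>
      prod_nonempty A l \<in> R \<and> prod_nonempty B (map h l) = h (prod_nonempty A l)" for l
  proof (induction l rule: list_nonempty_induct)
    case (cons x xs)
    then show ?case
      by (cases xs) (auto simp: Bs)
  qed simp
  interpret B: nilpotent_algebra B
  proof (intro nilpotent_algebra.intro md nilpotent_algebra_axioms.intro)
    fix u assume "u \<in> carrier B"
    then obtain x where x: "x \<in> R" "u = h x" by (auto simp: Bs)
    then obtain n where n: "n > 0" "prod_nonempty A (replicate n x) = \<zero>"
      using nilpotent RA by blast
    have "prod_nonempty B (map h (replicate n x)) = h \<zero>"
      using pr [of "replicate n x"] n x by auto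
    then show "\<exists>n>0. prod_nonempty B (replicate n u) = \<zero>\<^bsub>B\<^esub>"
      using n x by (auto simp: Bs)
  next
    fix u v assume "u \<in> carrier B" "v \<in> carrier B"
    then show "u \<otimes>\<^bsub>B\<^esub> v = v \<otimes>\<^bsub>B\<^esub> u"
      by (auto simp: Bs RA mult_comm)
  qed (auto simp: Bs RA mult_assoc mult_add mult_smult)
  have "nilpotent_algebra_embedding B A F"
    by unfold_locales (auto simp: Bs RA inj_on_def)
  moreover have "range g \<subseteq> F ` carrier B"
    by (auto simp: Bs image_image R_def [symmetric])
      (use generated_gen Fh in \<open>force simp: R_def\<close>)
  ultimately show ?thesis by (rule that)
qed

lemma exists_points:
  fixes x y z :: "'n::finite \<Rightarrow> 'i"
  assumes "x \<in> points A" "y \<in> points A" "z \<in> points A"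
  obtains B :: "('k, nat \<Rightarrow> 'k) module" and F x' y' z'
  where "nilpotent_algebra_embedding B A F"
    "x' \<in> points B" "y' \<in> points B" "z' \<in> points B" "F \<circ> x' = x" "F \<circ> y' = y" "F \<circ> z' = z"
proof -
  let ?G = "range x \<union> range y \<union> range z"
  have "range (from_nat_into ?G) = ?G"
    by (rule range_from_nat_into) (auto intro: countable_finite)
  moreover have "?G \<subseteq> carrier A" using assms by (auto simp: points_def)
  ultimately obtain B :: "('k, nat \<Rightarrow> 'k) module" and F
    where BF: "nilpotent_algebra_embedding B A F" "?G \<subseteq> F ` carrier B"
    using exists_embedding [of "from_nat_into ?G"] by metis
  have "\<exists>w'\<in>points B. F \<circ> w' = w" if "range w \<subseteq> F ` carrier B" for w :: "'n \<Rightarrow> 'i"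
  proof -
    have "\<exists>u. u \<in> carrier B \<and> F u = w i" for i
      using that by (metis imageE rangeI subset_iff)
    then obtain w' where "\<And>i. w' i \<in> carrier B \<and> F (w' i) = w i" by metis
    then show ?thesis by (intro bexI [of _ w']) (auto simp: points_def)
  qed
  with BF that show ?thesis by (metis (no_types, lifting) Un_subset_iff)
qed

end

lemma universal_solution_imp_solution_on:
  fixes S :: "('k::field, 'n::finite + 'n, 'n + 'n) formal_map"
  assumes "universal_solution S"
  shows "solution_on TYPE('i) S"
  unfolding solution_on_def
proof (intro allI impI)
  fix A :: "('k, 'i) module"
  assume "nilpotent_algebra A"
  then interpret A: nilpotent_algebra A .
  let ?X = "points A :: ('n \<Rightarrow> 'i) set" and ?S = "induced_map A S"
  have S: "nondegenerate_symmetric_set (points B) (induced_map B S)"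
    if "nilpotent_algebra_embedding B A F" for B :: "('k, nat \<Rightarrow> 'k) module" and F
    using assms that
    by (auto simp: universal_solution_def solution_on_def nilpotent_algebra_embedding_def)
  have cl: "?S (x, y) \<in> ?X \<times> ?X" if "x \<in> ?X" "y \<in> ?X" for x y
    using that by (intro A.induced_map_closed) auto
  have inv: "?S (?S (x, y)) = (x, y)" if xy: "x \<in> ?X" "y \<in> ?X" for x y
  proof -
    obtain B :: "('k, nat \<Rightarrow> 'k) module" and F x' y' where
      E: "nilpotent_algebra_embedding B A F" and
      p: "x' \<in> points B" "y' \<in> points B" "F \<circ> x' = x" "F \<circ> y' = y"
      using A.exists_points [OF xy(1) xy(2) xy(1)] by metis
    interpret E: nilpotent_algebra_embedding B A F by (rule E)
    have l: "(x, y) = E.lift (x', y')" using p by (simp add: E.lift_def)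
    have c: "induced_map B S (x', y') \<in> points B \<times> points B"
      using p by (intro E.B.induced_map_closed) auto
    show ?thesis
      unfolding l using S [OF E] p c
      by (simp add: E.lift_induced_map nondegenerate_symmetric_set_def involutive_def)
  qed
  have "involutive ?X ?S" by (auto simp: involutive_def inv)
  moreover have "bij_betw ?S (?X \<times> ?X) (?X \<times> ?X)"
  proof (rule bij_betw_byWitness [where f' = ?S])
    show "?S ` (?X \<times> ?X) \<subseteq> ?X \<times> ?X" "?S ` (?X \<times> ?X) \<subseteq> ?X \<times> ?X"
      by (rule image_subsetI, use cl in force)+
  qed (auto simp: inv)
  moreover have "braided ?X ?S"
    unfolding braided_def
  proof safe
    fix x y z assume xyz: "x \<in> ?X" "y \<in> ?X" "z \<in> ?X"
    obtain B :: "('k, nat \<Rightarrow> 'k) module" and F x' y' z' where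
      E: "nilpotent_algebra_embedding B A F" and
      p: "x' \<in> points B" "y' \<in> points B" "z' \<in> points B"
        "F \<circ> x' = x" "F \<circ> y' = y" "F \<circ> z' = z"
      using A.exists_points [OF xyz] by metis
    interpret E: nilpotent_algebra_embedding B A F by (rule E)
    let ?T = "induced_map B S"
    let ?P = "points B \<times> points B \<times> points B :: (('n \<Rightarrow> nat \<Rightarrow> 'k) \<times> ('n \<Rightarrow> nat \<Rightarrow> 'k) \<times> _) set"
    define L where "L = map_prod (\<lambda>u :: 'n \<Rightarrow> _. F \<circ> u) (E.lift :: ('n \<Rightarrow> nat \<Rightarrow> 'k) \<times> _ \<Rightarrow> _)"
    have c: "?T q \<in> points B \<times> points B" if "q \<in> points B \<times> points B" for q
      using that by (rule E.B.induced_map_closed)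
    have T: "S12 ?T t \<in> ?P" "S23 ?T t \<in> ?P"
      "S12 ?S (L t) = L (S12 ?T t)" "S23 ?S (L t) = L (S23 ?T t)" if t: "t \<in> ?P" for t
    proof -
      obtain u v w where [simp]: "t = (u, v, w)" by (cases t)
      have uvw: "(u, v) \<in> points B \<times> points B" "(v, w) \<in> points B \<times> points B" using t by auto
      have l: "L t = (F \<circ> u, E.lift (v, w))" "L t = (F \<circ> u, F \<circ> v, F \<circ> w)"
        "(F \<circ> u, F \<circ> v) = E.lift (u, v)"
        by (simp_all add: L_def E.lift_def)
      show "S12 ?T t \<in> ?P" "S23 ?T t \<in> ?P"
        using c [OF uvw(1)] c [OF uvw(2)] t by (auto simp: S12_def S23_def mem_Times_iff)
      have "S23 ?S (L t) = (F \<circ> u, ?S (E.lift (v, w)))"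
        unfolding l(1) by (simp add: S23_def E.lift_def)
      also have "\<dots> = L (S23 ?T t)"
        unfolding E.lift_induced_map [OF uvw(2)] by (simp add: L_def S23_def)
      finally show "S23 ?S (L t) = L (S23 ?T t)" .
      have "S12 ?S (L t) = (fst (?S (E.lift (u, v))), snd (?S (E.lift (u, v))), F \<circ> w)"
        unfolding l(2) l(3) [symmetric] by (simp add: S12_def)
      also have "\<dots> = L (S12 ?T t)"
        unfolding E.lift_induced_map [OF uvw(1)] by (simp add: L_def S12_def E.lift_def)
      finally show "S12 ?S (L t) = L (S12 ?T t)" .
    qed
    have l: "(x, y, z) = L (x', y', z')" using p by (simp add: L_def E.lift_def)
    have q: "(x', y', z') \<in> ?P" using p by simp
    have "S12 ?T (S23 ?T (S12 ?T (x', y', z'))) = S23 ?T (S12 ?T (S23 ?T (x', y', z')))"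
      using S [OF E] q unfolding nondegenerate_symmetric_set_def braided_def by blast
    then show "S12 ?S (S23 ?S (S12 ?S (x, y, z))) = S23 ?S (S12 ?S (S23 ?S (x, y, z)))"
      unfolding l using q T by simp
  qed
  moreover have "nondegenerate ?X ?S"
    unfolding nondegenerate_def
  proof (intro conjI ballI)
    fix y assume y: "y \<in> ?X"
    show "bij_betw (\<lambda>x. snd (?S (x, y))) ?X ?X"
      unfolding bij_betw_def
    proof (intro conjI inj_onI subset_antisym subsetI)
      fix x z assume x: "x \<in> ?X" "z \<in> ?X" and eq: "snd (?S (x, y)) = snd (?S (z, y))"
      obtain B :: "('k, nat \<Rightarrow> 'k) module" and F x' y' z' where
        E: "nilpotent_algebra_embedding B A F" and
        p: "x' \<in> points B" "y' \<in> points B" "z' \<in> points B"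
          "F \<circ> x' = x" "F \<circ> y' = y" "F \<circ> z' = z"
        using A.exists_points [OF x(1) y x(2)] by metis
      interpret E: nilpotent_algebra_embedding B A F by (rule E)
      have c: "induced_map B S q \<in> points B \<times> points B" if "q \<in> points B \<times> points B" for q
        using that by (rule E.B.induced_map_closed)
      have l: "(x, y) = E.lift (x', y')" "(z, y) = E.lift (z', y')"
        using p by (auto simp: E.lift_def)
      have "F \<circ> snd (induced_map B S (x', y')) = F \<circ> snd (induced_map B S (z', y'))"
        using eq p unfolding l by (simp add: E.lift_induced_map) (simp add: E.lift_def)
      then have "snd (induced_map B S (x', y')) = snd (induced_map B S (z', y'))"
        using E.inj_points c [of "(x', y')"] c [of "(z', y')"] p
        by (auto simp: inj_on_def mem_Times_iff)
      moreover have "inj_on (\<lambda>x. snd (induced_map B S (x, y'))) (points B)"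
        using S [OF E] p unfolding nondegenerate_symmetric_set_def nondegenerate_def bij_betw_def
        by blast
      ultimately have "x' = z'" using p by (auto dest: inj_onD)
      then show "x = z" using p by blast
    next
      fix z assume z: "z \<in> ?X"
      obtain B :: "('k, nat \<Rightarrow> 'k) module" and F y' z' where
        E: "nilpotent_algebra_embedding B A F" and
        p: "y' \<in> points B" "z' \<in> points B" "F \<circ> y' = y" "F \<circ> z' = z"
        using A.exists_points [OF y z z] by metis
      interpret E: nilpotent_algebra_embedding B A F by (rule E)
      have "z' \<in> (\<lambda>x. snd (induced_map B S (x, y'))) ` points B"
        using S [OF E] p unfolding nondegenerate_symmetric_set_def nondegenerate_def bij_betw_def
        by blast
      then obtain x' where x': "x' \<in> points B" "snd (induced_map B S (x', y')) = z'" by auto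
      have "?S (E.lift (x', y')) = E.lift (induced_map B S (x', y'))"
        using x' p by (intro E.lift_induced_map) auto
      then have "snd (?S (F \<circ> x', y)) = z" using x' p by (simp add: E.lift_def)
      moreover have "F \<circ> x' \<in> ?X" using x' E.closed by (auto simp: points_def)
      ultimately show "z \<in> (\<lambda>x. snd (?S (x, y))) ` ?X" by blast
    qed (use cl y in \<open>auto simp: mem_Times_iff\<close>)
  next
    fix y assume y: "y \<in> ?X"
    show "bij_betw (\<lambda>x. fst (?S (y, x))) ?X ?X"
      unfolding bij_betw_def
    proof (intro conjI inj_onI subset_antisym subsetI)
      fix x z assume x: "x \<in> ?X" "z \<in> ?X" and eq: "fst (?S (y, x)) = fst (?S (y, z))"
      obtain B :: "('k, nat \<Rightarrow> 'k) module" and F x' y' z' where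
        E: "nilpotent_algebra_embedding B A F" and
        p: "x' \<in> points B" "y' \<in> points B" "z' \<in> points B"
          "F \<circ> x' = x" "F \<circ> y' = y" "F \<circ> z' = z"
        using A.exists_points [OF x(1) y x(2)] by metis
      interpret E: nilpotent_algebra_embedding B A F by (rule E)
      have c: "induced_map B S q \<in> points B \<times> points B" if "q \<in> points B \<times> points B" for q
        using that by (rule E.B.induced_map_closed)
      have l: "(y, x) = E.lift (y', x')" "(y, z) = E.lift (y', z')"
        using p by (auto simp: E.lift_def)
      have "F \<circ> fst (induced_map B S (y', x')) = F \<circ> fst (induced_map B S (y', z'))"
        using eq p unfolding l by (simp add: E.lift_induced_map) (simp add: E.lift_def)
      then have "fst (induced_map B S (y', x')) = fst (induced_map B S (y', z'))"
        using E.inj_points c [of "(y', x')"] c [of "(y', z')"] p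
        by (auto simp: inj_on_def mem_Times_iff)
      moreover have "inj_on (\<lambda>x. fst (induced_map B S (y', x))) (points B)"
        using S [OF E] p unfolding nondegenerate_symmetric_set_def nondegenerate_def bij_betw_def
        by blast
      ultimately have "x' = z'" using p by (auto dest: inj_onD)
      then show "x = z" using p by blast
    next
      fix z assume z: "z \<in> ?X"
      obtain B :: "('k, nat \<Rightarrow> 'k) module" and F y' z' where
        E: "nilpotent_algebra_embedding B A F" and
        p: "y' \<in> points B" "z' \<in> points B" "F \<circ> y' = y" "F \<circ> z' = z"
        using A.exists_points [OF y z z] by metis
      interpret E: nilpotent_algebra_embedding B A F by (rule E)
      have "z' \<in> (\<lambda>x. fst (induced_map B S (y', x))) ` points B"
        using S [OF E] p unfolding nondegenerate_symmetric_set_def nondegenerate_def bij_betw_def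
        by blast
      then obtain x' where x': "x' \<in> points B" "fst (induced_map B S (y', x')) = z'" by auto
      have "?S (E.lift (y', x')) = E.lift (induced_map B S (y', x'))"
        using x' p by (intro E.lift_induced_map) auto
      then have "fst (?S (y, F \<circ> x')) = z" using x' p by (simp add: E.lift_def)
      moreover have "F \<circ> x' \<in> ?X" using x' E.closed by (auto simp: points_def)
      ultimately show "z \<in> (\<lambda>x. fst (?S (y, x))) ` ?X" by blast
    qed (use cl y in \<open>auto simp: mem_Times_iff\<close>)
  qed
  ultimately show "nondegenerate_symmetric_set ?X ?S"
    by (simp add: nondegenerate_symmetric_set_def)
qed

hide_const (open) Zero Gen Add Mult Scale

end

theory Submission
  imports
    Defs
    "HOL-Analysis.Cartesian_Space"
    "HOL-Library.Function_Algebras"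
begin

unbundle no fps_syntax

text \<open>
  Write \<open>S = (G, H)\<close>, where \<open>G\<close> has linear part \<open>a x + b y\<close> and \<open>H\<close> has linear part \<open>c x + d y\<close>.
  Evaluation at the generic points of algebras of truncated polynomials turns the axioms of a symmetric
  set into identities of power series.  Three of them are used: the first component of the braid
  relation at \<open>(0, x, y)\<close>,
  \<open>G(0, G(x, y)) = G(u(x), G(h(x), y))\<close> with \<open>u(x) = G(0, x)\<close> and \<open>h(x) = H(0, x)\<close>;
  involutivity \<open>G(G, H) = x\<close>; and its special case \<open>G(u(x), h(x)) = 0\<close>.
  Nondegeneracy makes \<open>b\<close> invertible, and the linear terms of the identities give
  \<open>b\<^sup>-\<^sup>1 a = a b\<^sup>-\<^sup>1 (1 + a)\<close> and \<open>d = - b\<^sup>-\<^sup>1 a b\<close>.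

  The relation between \<open>a\<close> and \<open>b\<close> implies that with \<open>\<mu>\<close> also \<open>\<mu> / (1 + \<mu>)\<close> is an eigenvalue of \<open>a\<close>.
  As the characteristic is zero or larger than \<open>N\<close>, a nonzero eigenvalue would produce more than \<open>N\<close>
  different ones, so \<open>a\<close> is nilpotent.  Moreover \<open>a\<close> and \<open>b\<close> are simultaneously triangular over the
  algebraic closure, \<open>a\<close> strictly so (\<open>simultaneous_triangular\<close>).

  In the absence of resonances there is a formal map \<open>\<psi>\<close>, tangent to the identity, with
  \<open>\<psi>(u(x)) = b \<psi>(x)\<close> (\<open>poincare_linearisation\<close>).  The claim is that this \<open>\<psi>\<close> linearises all of \<open>S\<close>.
  Put \<open>D(x, y) = \<psi>(G(x, y)) - a \<psi>(x) - b \<psi>(y)\<close>.  Then \<open>D(0, y) = 0\<close>, and the identities above combine to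
  \<open>b D(x, y) = D(u(x), G(h(x), y)) + b D(h(x), y) - b a b\<^sup>-\<^sup>1 D(u(x), h(x))\<close>,
  an equation that is linear in \<open>D\<close>.  To lowest order, \<open>u\<close> is \<open>b x\<close>, \<open>G(h(x), y)\<close> is \<open>b y\<close> up to
  a nilpotent term, and \<open>h\<close> and \<open>b a b\<^sup>-\<^sup>1\<close> are nilpotent.  So up to nilpotent terms, which triangularity
  controls, the lowest terms of \<open>D\<close> satisfy \<open>b D(x, y) = D(b x, b y)\<close>, and a nonzero coefficient would
  exhibit a resonance among the eigenvalues of \<open>b\<close>.  Hence \<open>D = 0\<close> (\<open>no_resonance_uniqueness\<close>).
  Involutivity then gives \<open>\<psi>(H(x, y)) = c \<psi>(x) + d \<psi>(y)\<close>, and conjugation by \<open>\<psi>\<close> carries \<open>R\<close> to its linear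
  part.
\<close>

section \<open>Order of vanishing and substitution of power series\<close>

lemmas mcoeff_simps [simp] = zero_mfps.rep_eq plus_mfps.rep_eq minus_mfps.rep_eq
  uminus_mfps.rep_eq Abs_mfps_inverse [OF UNIV_I]

lemma mcoeff_one: "mcoeff 1 M = (if M = {#} then 1 else 0)"
  by (simp add: one_mfps.rep_eq)

lemma mcoeff_var: "mcoeff (mfps_var v) M = (if M = {#v#} then 1 else 0)"
  by (simp add: mfps_var.rep_eq)

lemma mcoeff_const: "mcoeff (mfps_const c) M = (if M = {#} then c else 0)"
  by (simp add: mfps_const.rep_eq)

lemma mcoeff_mult: "mcoeff (f * g) M = (\<Sum>(A, B) | A + B = M. mcoeff f A * mcoeff g B)"
  by (simp add: times_mfps.rep_eq)

lemma mcoeff_sum [simp]: "mcoeff (\<Sum>i\<in>I. f i) M = (\<Sum>i\<in>I. mcoeff (f i) M)"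
  by (induction I rule: infinite_finite_induct) auto

lemma mcoeff_const_mult [simp]: "mcoeff (mfps_const c * f) M = c * mcoeff f M"
proof -
  have "mcoeff (mfps_const c * f) M = (\<Sum>(A, B)\<in>{({#} :: 'b multiset, M)}. mcoeff (mfps_const c) A * mcoeff f B)"
    unfolding mcoeff_mult
    by (rule sum.mono_neutral_right)
      (use finite_splittings [of M] in \<open>auto simp: mcoeff_const split: if_splits\<close>)
  then show ?thesis by (simp add: mcoeff_const)
qed

lemma mcoeff_mult_empty: "mcoeff (f * g) {#} = mcoeff f {#} * mcoeff g {#}"
proof -
  have "{(A, B). A + B = ({#} :: 'b multiset)} = {({#}, {#})}" by auto
  then show ?thesis by (simp add: mcoeff_mult)
qed

lemma mfps_const_hom:
  "mfps_const (a + b) = mfps_const a + mfps_const b" "mfps_const (a * b) = mfps_const a * mfps_const b"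
  "mfps_const 0 = 0" "mfps_const 1 = 1"
  by (auto intro!: mfps_eqI simp: mcoeff_const mcoeff_one)

lemma finite_size_le [simp]: "finite {M :: 'v::finite multiset. size M \<le> n}"
proof (rule finite_subset)
  show "{M :: 'v multiset. size M \<le> n} \<subseteq> (\<Union>k\<le>n. multisets_of_size UNIV k)"
    by (auto simp: multisets_of_size_def)
qed auto

lemma finite_size_less [simp]: "finite {M :: 'v::finite multiset. size M < n}"
  by (rule finite_subset [OF _ finite_size_le [of n]]) auto

lemma finite_size_eq [simp]: "finite {M :: 'v::finite multiset. size M = n}"
  by (rule finite_subset [OF _ finite_size_le [of n]]) auto

definition order_ge :: "nat \<Rightarrow> ('k::comm_ring_1, 'v) mfps \<Rightarrow> bool" where
  "order_ge m f \<longleftrightarrow> (\<forall>T. size T < m \<longrightarrow> mcoeff f T = 0)"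

lemma order_geD: "order_ge m f \<Longrightarrow> size T < m \<Longrightarrow> mcoeff f T = 0"
  by (simp add: order_ge_def)

lemma order_ge_1 [simp]: "order_ge (Suc 0) f \<longleftrightarrow> mcoeff f {#} = 0"
  by (simp add: order_ge_def)

lemma order_ge_mult:
  assumes "order_ge m f" "order_ge n g"
  shows "order_ge (m + n) (f * g)"
  unfolding order_ge_def mcoeff_mult
proof (intro allI impI sum.neutral ballI, clarify)
  fix A B :: "'b multiset"
  assume "size (A + B) < m + n"
  then have "size A < m \<or> size B < n" by auto
  then show "mcoeff f A * mcoeff g B = 0" using assms by (auto dest: order_geD)
qed

lemma formal_mapping_order: "formal_mapping \<phi> \<longleftrightarrow> (\<forall>i. order_ge 1 (\<phi> i))"
  by (simp add: formal_mapping_def order_ge_def)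

lemma order_ge_prod_mset:
  assumes "formal_mapping \<phi>"
  shows "order_ge (size M) (\<Prod>i\<in>#M. \<phi> i)"
proof (induction M)
  case (add x M)
  with assms have "order_ge (1 + size M) (\<phi> x * (\<Prod>i\<in>#M. \<phi> i))"
    unfolding formal_mapping_order by (blast intro: order_ge_mult)
  then show ?case by simp
qed (simp add: order_ge_def)

definition agree_upto :: "nat \<Rightarrow> ('k::comm_ring_1, 'v) mfps \<Rightarrow> ('k, 'v) mfps \<Rightarrow> bool" where
  "agree_upto n f g \<longleftrightarrow> (\<forall>T. size T \<le> n \<longrightarrow> mcoeff f T = mcoeff g T)"

lemma agree_uptoD: "agree_upto n f g \<Longrightarrow> size T \<le> n \<Longrightarrow> mcoeff f T = mcoeff g T"
  by (simp add: agree_upto_def)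

lemma agree_refl [simp]: "agree_upto n f f" by (simp add: agree_upto_def)

lemma agree_sym: "agree_upto n f g \<Longrightarrow> agree_upto n g f" by (simp add: agree_upto_def)

lemma agree_trans: "agree_upto n f g \<Longrightarrow> agree_upto n g h \<Longrightarrow> agree_upto n f h" by (simp add: agree_upto_def)

lemma agree_order_ge: "agree_upto n f g \<Longrightarrow> order_ge 1 f \<Longrightarrow> order_ge 1 g"
  by (auto simp: agree_upto_def order_ge_def)

lemma agree_mult:
  assumes "agree_upto (n + m) f f'" "agree_upto (n + p) g g'"
    "order_ge m f" "order_ge m f'" "order_ge p g" "order_ge p g'"
  shows "agree_upto (n + m + p) (f * g) (f' * g')"
  unfolding agree_upto_def mcoeff_mult
proof (intro allI impI sum.cong refl, clarify)
  fix A B :: "'b multiset"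
  assume s: "size (A + B) \<le> n + m + p"
  show "mcoeff f A * mcoeff g B = mcoeff f' A * mcoeff g' B"
  proof (cases "size A < m \<or> size B < p")
    case True
    then show ?thesis
      using order_geD [OF assms(3)] order_geD [OF assms(4)] order_geD [OF assms(5)] order_geD [OF assms(6)]
      by auto
  next
    case False
    with s have "size A \<le> n + m" "size B \<le> n + p" by auto
    then show ?thesis by (simp add: agree_uptoD [OF assms(1)] agree_uptoD [OF assms(2)])
  qed
qed

text \<open>
  Each factor has zero constant term, so a monomial of the product of degree \<open>n + size M\<close> takes at
  most degree \<open>n + 1\<close> from any single factor.  For \<open>n = 0\<close>: the terms of lowest degree of the product
  depend on the linear parts only.
\<close>

lemma agree_prod_mset:
  assumes "\<And>i. agree_upto (n + 1) (\<phi> i) (\<theta> i)" "formal_mapping \<phi>"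
  shows "agree_upto (n + size M) (\<Prod>i\<in>#M. \<phi> i) (\<Prod>i\<in>#M. \<theta> i)"
proof -
  have "formal_mapping \<theta>"
    using assms agree_order_ge unfolding formal_mapping_order by blast
  then show ?thesis
  proof (induction M)
    case (add x M)
    with assms have "agree_upto (n + 1 + size M) (\<phi> x * (\<Prod>i\<in>#M. \<phi> i)) (\<theta> x * (\<Prod>i\<in>#M. \<theta> i))"
      by (intro agree_mult order_ge_prod_mset) (auto simp: formal_mapping_order)
    then show ?case by simp
  qed simp
qed

lemma mcoeff_subst: "mcoeff (mfps_subst f \<phi>) T =
    (\<Sum>M | size M \<le> size T. mcoeff f M * mcoeff (\<Prod>i\<in>#M. \<phi> i) T)"
  by (simp add: mfps_subst.rep_eq)

lemma mcoeff_subst_le: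
  assumes "formal_mapping \<phi>" "size T \<le> n"
  shows "mcoeff (mfps_subst f \<phi>) T = (\<Sum>M | size M \<le> n. mcoeff f M * mcoeff (\<Prod>i\<in>#M. \<phi> i) T)"
  unfolding mcoeff_subst
proof (rule sum.mono_neutral_left)
  show "\<forall>M\<in>{M. size M \<le> n} - {M. size M \<le> size T}. mcoeff f M * mcoeff (\<Prod>i\<in>#M. \<phi> i) T = 0"
    using order_ge_prod_mset [OF assms(1)] by (auto simp: order_ge_def)
qed (use assms in auto)

lemma agree_subst:
  fixes \<phi> :: "'w::finite \<Rightarrow> ('k::comm_ring_1, 'v) mfps"
  assumes "order_ge m f" "m > 0" "\<And>i. agree_upto (n + 1) (\<phi> i) (\<theta> i)" "formal_mapping \<phi>"
  shows "agree_upto (n + m) (mfps_subst f \<phi>) (mfps_subst f \<theta>)"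
  unfolding agree_upto_def mcoeff_subst
proof (intro allI impI sum.cong refl)
  fix T :: "'v multiset" and M :: "'w multiset" assume s: "size T \<le> n + m"
  show "mcoeff f M * mcoeff (\<Prod>i\<in>#M. \<phi> i) T = mcoeff f M * mcoeff (\<Prod>i\<in>#M. \<theta> i) T"
  proof (cases "size M < m")
    case True
    then show ?thesis using assms by (auto dest: order_geD)
  next
    case False
    with s show ?thesis using agree_prod_mset [OF assms(3,4), of M] by (auto simp: agree_upto_def)
  qed
qed

lemma order_ge_subst:
  fixes \<phi> :: "'w::finite \<Rightarrow> ('k::comm_ring_1, 'v) mfps"
  assumes "order_ge m f"
  shows "order_ge m (mfps_subst f \<phi>)"
  unfolding order_ge_def mcoeff_subst
proof (intro allI impI sum.neutral ballI)
  fix T :: "'v multiset" and M :: "'w multiset" assume "size T < m" "M \<in> {M. size M \<le> size T}"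
  then show "mcoeff f M * mcoeff (\<Prod>i\<in>#M. \<phi> i) T = 0"
    using assms by (auto simp: order_ge_def)
qed

lemma subst_add: "mfps_subst (f + g) \<phi> = mfps_subst f \<phi> + mfps_subst g \<phi>"
  by (rule mfps_eqI) (simp add: mcoeff_subst distrib_right sum.distrib)

lemma subst_diff: "mfps_subst (f - g) \<phi> = mfps_subst f \<phi> - mfps_subst g \<phi>"
  by (rule mfps_eqI) (simp add: mcoeff_subst left_diff_distrib sum_subtractf)

lemma subst_0 [simp]: "mfps_subst 0 \<phi> = 0"
  by (rule mfps_eqI) (simp add: mcoeff_subst)

lemma subst_sum: "mfps_subst (\<Sum>i\<in>I. f i) \<phi> = (\<Sum>i\<in>I. mfps_subst (f i) \<phi>)"
  by (induction I rule: infinite_finite_induct) (simp_all add: subst_add)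

lemma subst_scale: "mfps_subst (mfps_const c * f) \<phi> = mfps_const c * mfps_subst f \<phi>"
  by (rule mfps_eqI) (simp add: mcoeff_subst sum_distrib_left mult.assoc)

lemma subst_monomial:
  fixes \<phi> :: "'w::finite \<Rightarrow> ('k::comm_ring_1, 'v) mfps"
  assumes "formal_mapping \<phi>" "\<And>M. mcoeff f M = (if M = N then c else 0)"
  shows "mfps_subst f \<phi> = mfps_const c * (\<Prod>i\<in>#N. \<phi> i)"
proof (rule mfps_eqI)
  fix T :: "'v multiset"
  have "mcoeff (mfps_subst f \<phi>) T =
      (\<Sum>M | size M \<le> size T + size N. if M = N then c * mcoeff (\<Prod>i\<in>#M. \<phi> i) T else 0)"
    unfolding mcoeff_subst_le [OF assms(1), of T "size T + size N", simplified]
    by (rule sum.cong) (auto simp: assms(2))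
  then show "mcoeff (mfps_subst f \<phi>) T = mcoeff (mfps_const c * (\<Prod>i\<in>#N. \<phi> i)) T"
    by (simp add: sum.delta)
qed

lemma subst_var:
  assumes "formal_mapping \<phi>"
  shows "mfps_subst (mfps_var v) \<phi> = \<phi> v"
  by (subst subst_monomial [where N = "{#v#}" and c = 1])
    (auto simp: assms mcoeff_var mfps_const_hom)

lemma subst_1:
  assumes "formal_mapping \<phi>"
  shows "mfps_subst 1 \<phi> = 1"
  by (subst subst_monomial [where N = "{#}" and c = 1])
    (auto simp: assms mcoeff_one mfps_const_hom)

lemma subst_mult:
  fixes \<phi> :: "'w::finite \<Rightarrow> ('k::comm_ring_1, 'v) mfps"
  assumes "formal_mapping \<phi>"
  shows "mfps_subst (f * g) \<phi> = mfps_subst f \<phi> * mfps_subst g \<phi>"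
proof (rule mfps_eqI)
  fix T :: "'v multiset"
  let ?n = "size T"
  let ?p = "\<lambda>M. \<Prod>i\<in>#M. \<phi> i"
  let ?S = "{M :: 'w multiset. size M \<le> ?n}"
  have "mcoeff (mfps_subst f \<phi> * mfps_subst g \<phi>) T =
      (\<Sum>(A, B) | A + B = T. (\<Sum>M\<in>?S. mcoeff f M * mcoeff (?p M) A) * (\<Sum>N\<in>?S. mcoeff g N * mcoeff (?p N) B))"
    unfolding mcoeff_mult
    by (intro sum.cong refl) (auto simp: mcoeff_subst_le [where n = ?n] assms)
  also have "\<dots> = (\<Sum>(A, B) | A + B = T. \<Sum>M\<in>?S. \<Sum>N\<in>?S.
      mcoeff f M * mcoeff g N * (mcoeff (?p M) A * mcoeff (?p N) B))"
    by (simp add: sum_product mult_ac)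
  also have "\<dots> = (\<Sum>M\<in>?S. \<Sum>N\<in>?S. \<Sum>(A, B) | A + B = T.
      mcoeff f M * mcoeff g N * (mcoeff (?p M) A * mcoeff (?p N) B))"
    unfolding case_prod_beta by (subst sum.swap, rule sum.cong [OF refl], rule sum.swap)
  also have "\<dots> = (\<Sum>(M, N)\<in>?S \<times> ?S. mcoeff f M * mcoeff g N * mcoeff (?p (M + N)) T)"
    unfolding sum.cartesian_product [symmetric]
    by (simp add: mcoeff_mult sum_distrib_left case_prod_beta)
  also have "\<dots> = (\<Sum>(M, N) | size (M + N) \<le> ?n. mcoeff f M * mcoeff g N * mcoeff (?p (M + N)) T)"
  proof (rule sum.mono_neutral_right)
    have "mcoeff (?p (M + N)) T = 0" if "\<not> size (M + N) \<le> ?n" for M N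
      using that order_geD [OF order_ge_prod_mset [OF assms, of "M + N"], of T] by simp
    then show "\<forall>q\<in>?S \<times> ?S - {(M, N). size (M + N) \<le> ?n}.
        (case q of (M, N) \<Rightarrow> mcoeff f M * mcoeff g N * mcoeff (?p (M + N)) T) = 0"
      by (auto simp del: image_mset_union size_union intro: ccontr)
  qed auto
  also have "\<dots> = (\<Sum>(P, (M, N))\<in>(SIGMA P : ?S. {(M, N). M + N = P}).
      mcoeff f M * mcoeff g N * mcoeff (?p P) T)"
    by (rule sum.reindex_bij_witness [where i = snd and j = "\<lambda>(M, N). (M + N, (M, N))"]) auto
  also have "\<dots> = (\<Sum>P\<in>?S. mcoeff (f * g) P * mcoeff (?p P) T)"
    by (subst sum.Sigma [symmetric])
      (auto simp: finite_splittings mcoeff_mult sum_distrib_right case_prod_beta)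
  finally show "mcoeff (mfps_subst (f * g) \<phi>) T = mcoeff (mfps_subst f \<phi> * mfps_subst g \<phi>) T"
    by (simp add: mcoeff_subst)
qed

lemma subst_prod_mset:
  assumes "formal_mapping \<phi>"
  shows "mfps_subst (\<Prod>i\<in>#M. f i) \<phi> = (\<Prod>i\<in>#M. mfps_subst (f i) \<phi>)"
  by (induction M) (simp_all add: subst_1 subst_mult assms)

text \<open>
  By linearity it is enough to treat a monomial, and substitution is multiplicative.
\<close>

lemma subst_subst:
  fixes \<phi> :: "'w::finite \<Rightarrow> ('k::comm_ring_1, 'v::finite) mfps" and \<psi> :: "'v \<Rightarrow> ('k, 'u) mfps"
  assumes "formal_mapping \<phi>" "formal_mapping \<psi>"
  shows "mfps_subst (mfps_subst f \<phi>) \<psi> = mfps_subst f (\<lambda>i. mfps_subst (\<phi> i) \<psi>)"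
proof (rule mfps_eqI)
  fix T :: "'u multiset"
  let ?p = "\<lambda>M. \<Prod>i\<in>#M. \<phi> i" and ?q = "\<lambda>N. \<Prod>i\<in>#N. \<psi> i"
  have "mcoeff (mfps_subst (mfps_subst f \<phi>) \<psi>) T =
      (\<Sum>N | size N \<le> size T. (\<Sum>M | size M \<le> size T. mcoeff f M * mcoeff (?p M) N) * mcoeff (?q N) T)"
    unfolding mcoeff_subst [of "mfps_subst f \<phi>"]
    by (intro sum.cong refl) (auto simp: mcoeff_subst_le [where n = "size T"] assms)
  also have "\<dots> = (\<Sum>M | size M \<le> size T. mcoeff f M * mcoeff (mfps_subst (?p M) \<psi>) T)"
    unfolding sum_distrib_right mcoeff_subst sum_distrib_left
    by (subst sum.swap) (simp add: mult.assoc)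
  finally show "mcoeff (mfps_subst (mfps_subst f \<phi>) \<psi>) T = mcoeff (mfps_subst f (\<lambda>i. mfps_subst (\<phi> i) \<psi>)) T"
    by (simp add: mcoeff_subst subst_prod_mset assms)
qed

lemma prod_mset_vars:
  "mcoeff (\<Prod>i\<in>#M. mfps_var i) T = (if T = M then 1 else (0 :: 'k::comm_ring_1))"
proof (induction M arbitrary: T)
  case (add x M)
  have IH: "mcoeff (\<Prod>i\<in>#M. mfps_var i) T = (if T = M then 1 else (0 :: 'k))" for T
    by (rule add)
  have "mcoeff (mfps_var x * (\<Prod>i\<in>#M. mfps_var i)) T =
      (\<Sum>q\<in>{(A, B). A + B = T}. if q = ({#x#}, M) then 1 else (0 :: 'k))"
    unfolding mcoeff_mult
    by (intro sum.cong refl) (auto simp: IH mcoeff_var split: if_splits)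
  then show ?case by (auto simp: sum.delta [OF finite_splittings])
qed (simp add: mcoeff_one)

lemma subst_vars [simp]: "mfps_subst f mfps_var = f"
  by (rule mfps_eqI) (simp add: mcoeff_subst prod_mset_vars if_distrib cong: if_cong)

lemma mcoeff_subst_linear:
  fixes \<phi> :: "'w::finite \<Rightarrow> ('k::comm_ring_1, 'v) mfps"
  assumes "size T = 1"
  shows "mcoeff (mfps_subst f \<phi>) T = mcoeff f {#} * mcoeff 1 T + (\<Sum>v\<in>UNIV. mcoeff f {#v#} * mcoeff (\<phi> v) T)"
proof -
  have "M \<in> insert {#} ((\<lambda>v. {#v#}) ` UNIV)" if "size M \<le> 1" for M :: "'w multiset"
  proof -
    from that have "size M = 0 \<or> size M = 1" by linarith
    then show ?thesis by (metis insertCI rangeI size_1_singleton_mset size_eq_0_iff_empty)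
  qed
  then have "{M :: 'w multiset. size M \<le> 1} = insert {#} ((\<lambda>v. {#v#}) ` UNIV)" by auto
  then show ?thesis
    unfolding mcoeff_subst assms by (subst \<open>_ = insert _ _\<close>, subst sum.insert) (auto simp: sum.reindex inj_on_def)
qed

section \<open>Nilpotent algebras of truncated series\<close>

text \<open>
  The constant term is dropped as well: a truncated series is then nilpotent modulo high degrees.
\<close>

definition truncation :: "nat \<Rightarrow> ('k::comm_ring_1, 'v) mfps \<Rightarrow> ('k, 'v) mfps" where
  "truncation m f = Abs_mfps (\<lambda>T. if T \<noteq> {#} \<and> size T \<le> m then mcoeff f T else 0)"

lemma mcoeff_truncation [simp]:
  "mcoeff (truncation m f) T = (if T \<noteq> {#} \<and> size T \<le> m then mcoeff f T else 0)"
  by (simp add: truncation_def)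

lemma order_ge_truncation: "order_ge 1 (truncation m f)"
  by (simp add: order_ge_def)

lemma agree_truncation:
  "order_ge 1 f \<Longrightarrow> agree_upto m (truncation m f) f"
  by (auto simp: agree_upto_def order_ge_def)

lemma truncation_eq_iff:
  assumes "order_ge 1 f" "order_ge 1 g"
  shows "truncation m f = truncation m g \<longleftrightarrow> agree_upto m f g"
proof
  assume "truncation m f = truncation m g"
  then show "agree_upto m f g"
    using assms agree_truncation agree_sym agree_trans by metis
next
  assume "agree_upto m f g"
  then show "truncation m f = truncation m g"
    by (auto intro!: mfps_eqI simp: agree_upto_def)
qed

lemma truncation_truncation [simp]: "truncation m (truncation m f) = truncation m f"
  by (rule mfps_eqI) simp

lemma truncation_mult_left:
  assumes "order_ge 1 f" "order_ge 1 g"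
  shows "truncation m (truncation m f * g) = truncation m (f * g)"
proof (subst truncation_eq_iff)
  show "order_ge 1 (truncation m f * g)" "order_ge 1 (f * g)"
    using assms by (auto simp: order_ge_1 mcoeff_mult_empty)
  show "agree_upto m (truncation m f * g) (f * g)"
    using agree_mult [of m 0 "truncation m f" f 0 g g] agree_truncation [OF assms(1), of m]
    by (simp add: order_ge_def)
qed

text \<open>
  The ideal of series without constant term, modulo the series of order greater than \<open>m\<close>, with
  truncated series as representatives.  It serves as a test algebra: its points are families of
  truncated series, and evaluation at such a point is truncated substitution, so an equation between
  induced maps for all \<open>m\<close> is an equation between power series.
\<close>

definition truncated_algebra :: "nat \<Rightarrow> ('k::field, ('k, 'v) mfps) module" where
  "truncated_algebra m = \<lparr>carrier = range (truncation m), monoid.mult = (\<lambda>f g. truncation m (f * g)),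
    one = 1, ring.zero = 0, ring.add = (+), module.smult = (\<lambda>c f. mfps_const c * f)\<rparr>"

lemma truncated_algebra_simps:
  "carrier (truncated_algebra m) = range (truncation m)"
  "f \<otimes>\<^bsub>truncated_algebra m\<^esub> g = truncation m (f * g)"
  "\<zero>\<^bsub>truncated_algebra m\<^esub> = 0"
  "f \<oplus>\<^bsub>truncated_algebra m\<^esub> g = f + g"
  "c \<odot>\<^bsub>truncated_algebra m\<^esub> f = mfps_const c * f"
  by (simp_all add: truncated_algebra_def)

lemma zero_in_truncation [simp]: "0 \<in> range (truncation m)"
  by (rule range_eqI [of _ _ 0]) (auto intro!: mfps_eqI)

lemma truncation_hom:
  "truncation m f + truncation m g = truncation m (f + g)"
  "mfps_const c * truncation m f = truncation m (mfps_const c * f)"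
  "truncation m 0 = 0"
  by (auto intro!: mfps_eqI)

lemma prod_nonempty_truncated:
  "xs \<noteq> [] \<Longrightarrow> set xs \<subseteq> range (truncation m) \<Longrightarrow>
    prod_nonempty (truncated_algebra m) xs = truncation m (prod_list xs) \<and> order_ge 1 (prod_list xs)"
proof (induction xs rule: list_nonempty_induct)
  case (single x)
  then show ?case by auto
next
  case (cons x xs)
  have x: "order_ge 1 x" "truncation m x = x" using cons.prems by auto
  have "prod_nonempty (truncated_algebra m) (x # xs) = truncation m (x * truncation m (prod_list xs))"
    using cons by (cases xs) (auto simp: truncated_algebra_simps)
  also have "\<dots> = truncation m (x * prod_list xs)"
    using truncation_mult_left [of "prod_list xs" x m] cons x by (simp add: mult.commute)
  finally show ?case using x by (simp add: order_ge_1 mcoeff_mult_empty)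
qed

lemma nilpotent_truncated_algebra:
  "nilpotent_algebra (truncated_algebra m :: ('k::field, ('k, 'v) mfps) module)"
proof -
  let ?A = "truncated_algebra m :: ('k, ('k, 'v) mfps) module"
  have "abelian_group ?A"
  proof (rule abelian_groupI)
    fix f assume "f \<in> carrier ?A"
    then obtain g where "f = truncation m g" by (auto simp: truncated_algebra_simps)
    then show "\<exists>h\<in>carrier ?A. h \<oplus>\<^bsub>?A\<^esub> f = \<zero>\<^bsub>?A\<^esub>"
      by (intro bexI [of _ "truncation m (- g)"])
        (auto simp: truncated_algebra_simps truncation_hom)
  qed (auto simp: truncated_algebra_simps truncation_hom add_ac)
  then have "Module.module ring_of_type_algebra ?A"
    by (intro Module.moduleI cring_from_type_algebra)
      (auto simp: truncated_algebra_simps truncation_hom mfps_const_hom algebra_simps)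
  moreover have "nilpotent_algebra_axioms ?A"
  proof
    fix f g h assume f: "f \<in> carrier ?A" and g: "g \<in> carrier ?A" and h: "h \<in> carrier ?A"
    have o: "order_ge 1 f" "order_ge 1 g" "order_ge 1 h" "truncation m f = f"
      using f g h by (auto simp: truncated_algebra_simps)
    then have p: "order_ge 1 (f * g)" "order_ge 1 (g * h)" by (auto simp: order_ge_1 mcoeff_mult_empty)
    show "(f \<otimes>\<^bsub>?A\<^esub> g) \<otimes>\<^bsub>?A\<^esub> h = f \<otimes>\<^bsub>?A\<^esub> (g \<otimes>\<^bsub>?A\<^esub> h)"
      using truncation_mult_left [OF p(1) o(3), of m] truncation_mult_left [OF p(2) o(1), of m]
      by (simp add: truncated_algebra_simps mult_ac)
    show "(f \<oplus>\<^bsub>?A\<^esub> g) \<otimes>\<^bsub>?A\<^esub> h = (f \<otimes>\<^bsub>?A\<^esub> h) \<oplus>\<^bsub>?A\<^esub> (g \<otimes>\<^bsub>?A\<^esub> h)"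
      by (simp add: truncated_algebra_simps truncation_hom distrib_right)
    show "(c \<odot>\<^bsub>?A\<^esub> f) \<otimes>\<^bsub>?A\<^esub> g = c \<odot>\<^bsub>?A\<^esub> (f \<otimes>\<^bsub>?A\<^esub> g)" for c
      by (simp add: truncated_algebra_simps truncation_hom mult.assoc)
  next
    fix f assume f: "f \<in> carrier ?A"
    then have o: "order_ge 1 f" by (auto simp: truncated_algebra_simps)
    have "order_ge n (f ^ n)" for n
    proof (induction n)
      case (Suc n)
      show ?case using order_ge_mult [OF o Suc] by simp
    qed (simp add: order_ge_def)
    then have "truncation m (f ^ Suc m) = 0"
      by (intro mfps_eqI) (simp add: order_ge_def del: power_Suc)
    then show "\<exists>n>0. prod_nonempty ?A (replicate n f) = \<zero>\<^bsub>?A\<^esub>"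
      using f prod_nonempty_truncated [of "replicate (Suc m) f" m]
      by (intro exI [of _ "Suc m"]) (auto simp: truncated_algebra_simps prod_list_replicate simp del: replicate_Suc power_Suc)
  qed (auto simp: truncated_algebra_simps truncation_hom(2) mult.commute)
  ultimately show ?thesis by (rule nilpotent_algebra.intro)
qed

lemma finsum_truncated:
  assumes "\<And>M. M \<in> J \<Longrightarrow> h M \<in> carrier (truncated_algebra m :: ('k::field, ('k, 'v) mfps) module)" "finite J"
  shows "finsum (truncated_algebra m) h J = sum h J"
proof -
  interpret A: nilpotent_algebra "truncated_algebra m :: ('k, ('k, 'v) mfps) module"
    by (rule nilpotent_truncated_algebra)
  show ?thesis
    using assms(2,1)
  proof (induction J rule: finite_induct)
    case (insert M J)
    then show ?case
      by (subst A.M.finsum_insert) (auto simp: Pi_def truncated_algebra_simps)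
  qed (simp add: truncated_algebra_simps)
qed

text \<open>
  A monomial of degree larger than \<open>m\<close> has value zero, so the finite sum that defines the value runs
  over the same monomials as the one that defines the substitution.
\<close>

lemma mfps_value_truncated:
  fixes f :: "('k::field, 'w::finite) mfps" and \<phi> :: "'w \<Rightarrow> ('k, 'v) mfps"
  assumes \<phi>: "\<And>i. \<phi> i \<in> range (truncation m)" and f: "order_ge 1 f"
  shows "mfps_value (truncated_algebra m) f \<phi> = truncation m (mfps_subst f \<phi>)"
proof -
  let ?A = "truncated_algebra m :: ('k, ('k, 'v) mfps) module"
  interpret A: nilpotent_algebra ?A by (rule nilpotent_truncated_algebra)
  have fm: "formal_mapping \<phi>"
    using \<phi> order_ge_truncation unfolding formal_mapping_order by (metis rangeE)
  let ?p = "\<lambda>M. \<Prod>i\<in>#M. \<phi> i"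
  have mv: "monomial_value ?A \<phi> M = truncation m (?p M)" if "M \<noteq> {#}" for M
  proof -
    obtain l where l: "M = mset l" using ex_mset by metis
    have "prod_nonempty ?A (map \<phi> l) = truncation m (prod_list (map \<phi> l))"
      using prod_nonempty_truncated [of "map \<phi> l" m] l that \<phi> by auto
    moreover have "prod_list (map \<phi> l) = ?p M"
      by (simp add: l flip: prod_mset_prod_list)
    ultimately show ?thesis
      using A.monomial_value_mset [of \<phi> l] \<phi> l by (auto simp: truncated_algebra_simps)
  qed
  have p0: "truncation m (?p M) = 0" if "size M > m" for M
    using order_ge_prod_mset [OF fm, of M] that by (intro mfps_eqI) (simp add: order_ge_def)
  define J where "J = {M. M \<noteq> {#} \<and> mcoeff f M \<noteq> 0 \<and> monomial_value ?A \<phi> M \<noteq> 0}"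
  let ?h = "\<lambda>M. mfps_const (mcoeff f M) * truncation m (?p M)"
  have J: "J \<subseteq> {M. size M \<le> m}" using mv p0 by (force simp: J_def not_le [symmetric])
  have J1: "M \<noteq> {#}" if "M \<in> J" for M using that by (simp add: J_def)
  have "mfps_value ?A f \<phi> = finsum ?A (\<lambda>M. mcoeff f M \<odot>\<^bsub>?A\<^esub> monomial_value ?A \<phi> M) J"
    by (simp add: mfps_value_def J_def truncated_algebra_simps)
  also have "\<dots> = (\<Sum>M\<in>J. mcoeff f M \<odot>\<^bsub>?A\<^esub> monomial_value ?A \<phi> M)"
    using finite_subset [OF J] J1
    by (intro finsum_truncated) (auto simp: mv truncated_algebra_simps truncation_hom)
  also have "\<dots> = (\<Sum>M\<in>J. ?h M)"
    by (intro sum.cong refl) (simp add: truncated_algebra_simps mv J1)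
  also have "\<dots> = (\<Sum>M | size M \<le> m. ?h M)"
  proof (rule sum.mono_neutral_left [OF _ J])
    show "\<forall>M\<in>{M. size M \<le> m} - J. ?h M = 0"
    proof
      fix M assume M: "M \<in> {M. size M \<le> m} - J"
      then have "M = {#} \<or> mcoeff f M = 0 \<or> truncation m (?p M) = 0"
        by (auto simp: J_def mv)
      then show "?h M = 0"
        using f by (auto simp: mfps_const_hom)
    qed
  qed simp
  also have "\<dots> = truncation m (mfps_subst f \<phi>)"
    by (rule mfps_eqI) (simp add: mcoeff_subst_le [OF fm, of _ m])
  finally show ?thesis .
qed

text \<open>
  Truncating the arguments does not matter, since the terms that are discarded have too high a degree
  to contribute.  This allows induced maps to be iterated.
\<close>

lemma truncation_subst:
  assumes "order_ge 1 f" "formal_mapping \<phi>"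
  shows "truncation m (mfps_subst f (\<lambda>i. truncation m (\<phi> i))) = truncation m (mfps_subst f \<phi>)"
proof (cases m)
  case (Suc n)
  have t: "formal_mapping (\<lambda>i. truncation m (\<phi> i))" by (simp add: formal_mapping_def)
  have "agree_upto (n + 1) (mfps_subst f (\<lambda>i. truncation m (\<phi> i))) (mfps_subst f \<phi>)"
    using assms Suc agree_truncation [of "\<phi> _" m]
    by (intro agree_subst t) (auto simp: formal_mapping_order)
  then show ?thesis using Suc
    using order_ge_subst [OF assms(1)] by (subst truncation_eq_iff) auto
qed (auto intro!: mfps_eqI)

section \<open>Calculus of formal mappings\<close>

lemma formal_mapping_0 [simp]: "formal_mapping 0"
  by (simp add: formal_mapping_def)

lemma formal_mapping_vars [simp]: "formal_mapping fm_id" "formal_mapping (\<lambda>i. mfps_var (g i))"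
  by (simp_all add: formal_mapping_def fm_id_def mcoeff_var)

lemma formal_mapping_comp [simp]: "formal_mapping \<phi> \<Longrightarrow> formal_mapping (\<phi> \<circ>\<^sub>f \<psi>)"
  unfolding formal_mapping_order fm_comp_def by (blast intro: order_ge_subst)

lemma formal_mapping_case_sum [simp]:
  "formal_mapping (case_sum u v) \<longleftrightarrow> formal_mapping u \<and> formal_mapping v"
  by (auto simp: formal_mapping_def split: sum.splits)

lemma fm_comp_assoc:
  "formal_mapping \<phi> \<Longrightarrow> formal_mapping \<psi> \<Longrightarrow> f \<circ>\<^sub>f \<phi> \<circ>\<^sub>f \<psi> = f \<circ>\<^sub>f (\<phi> \<circ>\<^sub>f \<psi>)"
  by (simp add: fm_comp_def subst_subst)

lemma fm_comp_id [simp]: "f \<circ>\<^sub>f fm_id = f"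
  by (simp add: fm_comp_def fm_id_def)

lemma fm_id_comp [simp]: "formal_mapping \<phi> \<Longrightarrow> fm_id \<circ>\<^sub>f \<phi> = \<phi>"
  by (simp add: fm_comp_def fm_id_def subst_var)

lemma vars_comp [simp]: "formal_mapping \<phi> \<Longrightarrow> (\<lambda>i. mfps_var (g i)) \<circ>\<^sub>f \<phi> = (\<lambda>i. \<phi> (g i))"
  by (simp add: fm_comp_def subst_var)

lemma case_sum_comp: "case_sum u v \<circ>\<^sub>f \<phi> = case_sum (u \<circ>\<^sub>f \<phi>) (v \<circ>\<^sub>f \<phi>)"
  by (auto simp: fm_comp_def fun_eq_iff split: sum.splits)

lemma fm_comp_add: "(f + g) \<circ>\<^sub>f \<phi> = (f \<circ>\<^sub>f \<phi>) + (g \<circ>\<^sub>f \<phi>)"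
  by (simp add: fm_comp_def fun_eq_iff subst_add)

lemma fm_comp_diff: "(f - g) \<circ>\<^sub>f \<phi> = (f \<circ>\<^sub>f \<phi>) - (g \<circ>\<^sub>f \<phi>)"
  by (simp add: fm_comp_def fun_eq_iff subst_diff)

lemma fm_comp_0 [simp]: "0 \<circ>\<^sub>f \<phi> = 0"
  by (simp add: fm_comp_def fun_eq_iff)

lemma comp_0 [simp]: "formal_mapping f \<Longrightarrow> f \<circ>\<^sub>f 0 = 0"
proof (rule ext, rule mfps_eqI)
  fix i T assume f: "formal_mapping f"
  have "mcoeff (f i) M * mcoeff (\<Prod>i\<in>#M. 0) T = 0" for M
    using f by (cases M) (auto simp: formal_mapping_def)
  then show "mcoeff ((f \<circ>\<^sub>f 0) i) T = mcoeff (0 i) T"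
    by (simp add: fm_comp_def mcoeff_subst)
qed

definition matrix_act :: "'k::comm_ring_1^'n^'m \<Rightarrow> ('k, 'v, 'n) formal_map \<Rightarrow> ('k, 'v, 'm) formal_map"
    (infixr "\<cdot>" 75)
  where "e \<cdot> f = (\<lambda>i. \<Sum>j\<in>UNIV. mfps_const (e $ i $ j) * f j)"

lemma mcoeff_act: "mcoeff ((e \<cdot> f) i) T = (\<Sum>j\<in>UNIV. e $ i $ j * mcoeff (f j) T)"
  by (simp add: matrix_act_def)

lemma formal_mapping_act [simp]: "formal_mapping f \<Longrightarrow> formal_mapping (e \<cdot> f)"
  by (simp add: formal_mapping_def mcoeff_act)

lemma formal_mapping_add [simp]: "formal_mapping f \<Longrightarrow> formal_mapping g \<Longrightarrow> formal_mapping (f + g)"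
  by (simp add: formal_mapping_def)

lemma act_comp: "(e \<cdot> f) \<circ>\<^sub>f \<phi> = e \<cdot> (f \<circ>\<^sub>f \<phi>)"
  by (simp add: fm_comp_def matrix_act_def subst_sum subst_scale)

lemma act_add: "e \<cdot> (f + g) = e \<cdot> f + e \<cdot> g"
  by (simp add: matrix_act_def fun_eq_iff distrib_left sum.distrib)

lemma act_0 [simp]: "e \<cdot> 0 = 0" "0 \<cdot> f = 0"
  by (simp_all add: matrix_act_def fun_eq_iff mfps_const_hom)

lemma add_act: "(e + e') \<cdot> f = e \<cdot> f + e' \<cdot> f"
  by (simp add: matrix_act_def fun_eq_iff mfps_const_hom distrib_right sum.distrib)

lemma act_act: "e \<cdot> e' \<cdot> f = (e ** e') \<cdot> f"
proof (rule ext, rule mfps_eqI)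
  fix i T
  have "mcoeff ((e \<cdot> e' \<cdot> f) i) T = (\<Sum>j\<in>UNIV. \<Sum>k\<in>UNIV. e $ i $ j * e' $ j $ k * mcoeff (f k) T)"
    by (simp add: mcoeff_act sum_distrib_left mult.assoc)
  also have "\<dots> = mcoeff (((e ** e') \<cdot> f) i) T"
    by (subst sum.swap) (simp add: mcoeff_act matrix_matrix_mult_def sum_distrib_right)
  finally show "mcoeff ((e \<cdot> e' \<cdot> f) i) T = mcoeff (((e ** e') \<cdot> f) i) T" .
qed

lemma one_act [simp]: "mat 1 \<cdot> f = f"
  by (auto intro!: mfps_eqI simp: fun_eq_iff mcoeff_act mat_def if_distrib if_distribR cong: if_cong)

lemma formal_map_eqI:
  fixes f g :: "('k::comm_ring_1, 'v, 'n) formal_map"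
  assumes "formal_mapping f" "formal_mapping g"
    and "\<And>m. (\<lambda>i. truncation m (f i)) = (\<lambda>i. truncation m (g i))"
  shows "f = g"
proof (rule ext, rule mfps_eqI)
  fix i and T :: "'v multiset"
  have "agree_upto (size T) (f i) (g i)"
    using assms truncation_eq_iff by (metis formal_mapping_order)
  then show "mcoeff (f i) T = mcoeff (g i) T" by (simp add: agree_upto_def)
qed

section \<open>From symmetric sets to identities of power series\<close>

lemma induced_map_truncated:
  fixes G H :: "('k::field, 'n::finite + 'n, 'n) formal_map" and u v :: "('k, 'v, 'n) formal_map"
  assumes "formal_mapping G" "formal_mapping H" "formal_mapping u" "formal_mapping v"
  shows "induced_map (truncated_algebra m) (case_sum G H)
      ((\<lambda>i. truncation m (u i)), (\<lambda>i. truncation m (v i))) =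
    ((\<lambda>i. truncation m ((G \<circ>\<^sub>f case_sum u v) i)), (\<lambda>i. truncation m ((H \<circ>\<^sub>f case_sum u v) i)))"
proof -
  have t: "case_sum (\<lambda>i. truncation m (u i)) (\<lambda>i. truncation m (v i)) = (\<lambda>i. truncation m (case_sum u v i))"
    by (auto simp: fun_eq_iff split: sum.splits)
  have "mfps_value (truncated_algebra m) f (\<lambda>i. truncation m (case_sum u v i)) =
      truncation m (mfps_subst f (case_sum u v))" if "order_ge 1 f" for f
    using assms that by (simp add: mfps_value_truncated truncation_subst)
  then show ?thesis
    using assms by (simp add: induced_map_def t fm_comp_def formal_mapping_order)
qed

lemma solution_on_truncated:
  assumes "universal_solution S"
  shows "nondegenerate_symmetric_set (points (truncated_algebra m)) (induced_map (truncated_algebra m) S)"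
  using universal_solution_imp_solution_on [OF assms] nilpotent_truncated_algebra
  unfolding solution_on_def by blast

lemma truncation_points: "(\<lambda>i. truncation m (u i)) \<in> points (truncated_algebra m)"
  by (simp add: points_def truncated_algebra_simps)

lemma universal_involutive:
  fixes u v :: "('k::field, 'v, 'n::finite) formal_map"
  assumes S: "universal_solution (case_sum G H)" and uv: "formal_mapping u" "formal_mapping v"
  shows "G \<circ>\<^sub>f case_sum (G \<circ>\<^sub>f case_sum u v) (H \<circ>\<^sub>f case_sum u v) = u"
proof -
  have GH: "formal_mapping G" "formal_mapping H" using S by (auto simp: universal_solution_def)
  show ?thesis
  proof (rule formal_map_eqI)
    fix m
    let ?S = "induced_map (truncated_algebra m :: ('k, ('k, 'v) mfps) module) (case_sum G H)"
    let ?t = "\<lambda>u :: ('k, 'v, 'n) formal_map. \<lambda>i. truncation m (u i)"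
    have "?S (?S (?t u, ?t v)) = (?t u, ?t v)"
      using solution_on_truncated [OF S, of m] truncation_points [of m u] truncation_points [of m v]
      unfolding nondegenerate_symmetric_set_def involutive_def by blast
    then show "?t (G \<circ>\<^sub>f case_sum (G \<circ>\<^sub>f case_sum u v) (H \<circ>\<^sub>f case_sum u v)) = ?t u"
      using uv GH by (simp add: induced_map_truncated)
  qed (use uv GH in auto)
qed

lemma universal_braided:
  fixes u v w :: "('k::field, 'v, 'n::finite) formal_map"
  assumes S: "universal_solution (case_sum G H)"
    and uvw: "formal_mapping u" "formal_mapping v" "formal_mapping w"
  shows "G \<circ>\<^sub>f case_sum (G \<circ>\<^sub>f case_sum u v) (G \<circ>\<^sub>f case_sum (H \<circ>\<^sub>f case_sum u v) w) =
    G \<circ>\<^sub>f case_sum u (G \<circ>\<^sub>f case_sum v w)"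
proof -
  have GH: "formal_mapping G" "formal_mapping H" using S by (auto simp: universal_solution_def)
  show ?thesis
  proof (rule formal_map_eqI)
    fix m
    let ?S = "induced_map (truncated_algebra m :: ('k, ('k, 'v) mfps) module) (case_sum G H)"
    let ?t = "\<lambda>u :: ('k, 'v, 'n) formal_map. \<lambda>i. truncation m (u i)"
    have "S12 ?S (S23 ?S (S12 ?S (?t u, ?t v, ?t w))) = S23 ?S (S12 ?S (S23 ?S (?t u, ?t v, ?t w)))"
      using solution_on_truncated [OF S, of m]
        truncation_points [of m u] truncation_points [of m v] truncation_points [of m w]
      unfolding nondegenerate_symmetric_set_def braided_def by blast
    then show "?t (G \<circ>\<^sub>f case_sum (G \<circ>\<^sub>f case_sum u v) (G \<circ>\<^sub>f case_sum (H \<circ>\<^sub>f case_sum u v) w)) =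
        ?t (G \<circ>\<^sub>f case_sum u (G \<circ>\<^sub>f case_sum v w))"
      using uvw GH by (simp add: S12_def S23_def induced_map_truncated)
  qed (use uvw GH in auto)
qed

lemma mcoeff_comp_linear:
  fixes G :: "('k::field, 'n::finite + 'n, 'n) formal_map"
  assumes "formal_mapping G" "\<And>i j. mcoeff (G i) {#Inl j#} = a $ i $ j" "\<And>i j. mcoeff (G i) {#Inr j#} = b $ i $ j"
    and "size T = 1"
  shows "mcoeff ((G \<circ>\<^sub>f case_sum u v) i) T = mcoeff ((a \<cdot> u + b \<cdot> v) i) T"
  using assms by (simp add: fm_comp_def mcoeff_subst_linear formal_mapping_def mcoeff_act
      UNIV_Plus_UNIV [symmetric] sum.Plus del: UNIV_Plus_UNIV)

text \<open>
  For \<open>m = 1\<close> all products in the test algebra vanish, so that the map \<open>x \<mapsto> G(0, x)\<close> acts through the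
  matrix \<open>b\<close>.  Nondegeneracy provides a preimage of the generic point; its coefficients form a right
  inverse of \<open>b\<close>.
\<close>

lemma universal_invertible:
  fixes G :: "('k::field, 'n::finite + 'n, 'n) formal_map"
  assumes S: "universal_solution (case_sum G H)" and b: "\<And>i j. mcoeff (G i) {#Inr j#} = b $ i $ j"
  obtains b' where "b ** b' = mat 1" "b' ** b = mat 1"
proof -
  have GH: "formal_mapping G" "formal_mapping H" using S by (auto simp: universal_solution_def)
  let ?A = "truncated_algebra 1 :: ('k, ('k, 'n) mfps) module"
  have "(\<lambda>x. fst (induced_map ?A (case_sum G H) (\<lambda>i. truncation 1 (0 i), x))) ` points ?A = points ?A"
    using solution_on_truncated [OF S, of 1] truncation_points [of 1 "0 :: ('k, 'n, 'n) formal_map"]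
    unfolding nondegenerate_symmetric_set_def nondegenerate_def bij_betw_def by blast
  moreover have "(\<lambda>i. truncation 1 (fm_id i)) \<in> points ?A"
    by (rule truncation_points)
  ultimately obtain x where x: "x \<in> points ?A"
    "fst (induced_map ?A (case_sum G H) (\<lambda>i. truncation 1 (0 i), x)) = (\<lambda>i. truncation 1 (fm_id i))"
    by (metis (no_types, lifting) imageE)
  from x(1) have "truncation 1 (x i) = x i" for i
    unfolding points_def truncated_algebra_simps by (metis (mono_tags) mem_Collect_eq rangeE truncation_truncation)
  then have x': "x = (\<lambda>i. truncation 1 (x i))" "formal_mapping x"
    using order_ge_truncation [of 1 "x _"] by (auto simp: formal_mapping_order)
  define b' where "b' = (\<chi> i j. mcoeff (x i) {#j#})"
  have "(\<lambda>i. truncation 1 ((G \<circ>\<^sub>f case_sum 0 x) i)) = (\<lambda>i. truncation 1 (fm_id i))"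
    using x(2) x' GH induced_map_truncated [OF GH, of 0 x 1] by simp
  then have "mcoeff (truncation 1 ((G \<circ>\<^sub>f case_sum 0 x) i)) {#j#} = mcoeff (truncation 1 (fm_id i)) {#j#}" for i j
    by metis
  then have "mcoeff ((b \<cdot> x) i) {#j#} = mcoeff (fm_id i) {#j#}" for i j
    using mcoeff_comp_linear [OF GH(1), of "\<chi> i j. mcoeff (G i) {#Inl j#}" b "{#j#}" 0 x i] b
    by simp
  then have "b ** b' = mat 1"
    by (simp add: vec_eq_iff matrix_matrix_mult_def mcoeff_act b'_def fm_id_def mcoeff_var mat_def)
  then show ?thesis using that matrix_left_right_inverse by blast
qed

section \<open>Simultaneous triangularisation of the linear part\<close>

lemmas subspace_closed = vec.subspace_add vec.subspace_diff vec.subspace_scale vec.subspace_0 vec.subspace_sum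

lemma matrix_vector_linear:
  fixes f :: "'k::field^'n^'n"
  shows "f *v (x + y) = f *v x + f *v y" "f *v (x - y) = f *v x - f *v y"
    "f *v (c *s x) = c *s (f *v x)" "f *v 0 = 0"
  by (simp_all add: vec.add vec.diff vec.scale)

lemma subspace_scale_iff:
  fixes x :: "'k::field^'n"
  assumes "vec.subspace U" "c \<noteq> 0"
  shows "c *s x \<in> U \<longleftrightarrow> x \<in> U"
proof
  assume "c *s x \<in> U"
  then have "inverse c *s (c *s x) \<in> U" by (rule vec.subspace_scale [OF assms(1)])
  then show "x \<in> U" using assms(2) by (simp add: vector_smult_assoc)
qed (rule vec.subspace_scale [OF assms(1)])

text \<open>
  Stated for a family instead of a set, so that a repeated vector is also a dependency.
\<close>

lemma vectors_dependent:
  fixes v :: "nat \<Rightarrow> 'k::field^'n"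
  obtains c where "\<exists>i\<le>CARD('n). c i \<noteq> 0" "(\<Sum>i\<le>CARD('n). c i *s v i) = 0"
proof (cases "inj_on v {..CARD('n)}")
  case True
  then have "card (v ` {..CARD('n)}) > CARD('n)" by (simp add: card_image)
  then have "vec.dependent (v ` {..CARD('n)})"
    using vec.independent_card_le_dim [of "v ` {..CARD('n)}" UNIV] unfolding vec_dim_card by force
  then obtain u where u: "\<exists>x\<in>v ` {..CARD('n)}. u x \<noteq> 0" "(\<Sum>x\<in>v ` {..CARD('n)}. u x *s x) = 0"
    by (auto simp: vec.dependent_finite)
  then show ?thesis
    using True by (intro that [of "u \<circ> v"]) (auto simp: sum.reindex)
next
  case False
  then obtain i j where ij: "i \<le> CARD('n)" "j \<le> CARD('n)" "i \<noteq> j" "v i = v j"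
    by (auto simp: inj_on_def)
  let ?c = "\<lambda>l. (if l = i then 1 else 0) - (if l = j then 1 else (0 :: 'k))"
  have "(\<Sum>l\<le>CARD('n). ?c l *s v l) = (\<Sum>l\<le>CARD('n). (if l = i then v l else 0) - (if l = j then v l else 0))"
    by (intro sum.cong) auto
  also have "\<dots> = 0" using ij by (simp add: sum_subtractf)
  finally show ?thesis using ij by (intro that [of ?c]) auto
qed

definition poly_act :: "'k::field^'n^'n \<Rightarrow> 'k poly \<Rightarrow> 'k^'n \<Rightarrow> 'k^'n" where
  "poly_act f p v = (\<Sum>i\<le>degree p. coeff p i *s (((*v) f ^^ i) v))"

lemma poly_act_le:
  "degree p \<le> n \<Longrightarrow> poly_act f p v = (\<Sum>i\<le>n. coeff p i *s (((*v) f ^^ i) v))"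
  unfolding poly_act_def by (rule sum.mono_neutral_left) (auto simp: coeff_eq_0)

text \<open>
  This is how a root of a polynomial is turned into an eigenvalue.
\<close>

lemma poly_act_linear_factor:
  "poly_act f ([:- \<mu>, 1:] * q) v = f *v (poly_act f q v) - \<mu> *s poly_act f q v"
proof -
  let ?n = "degree q" and ?w = "\<lambda>i. ((*v) f ^^ i) v"
  have c: "coeff ([:- \<mu>, 1:] * q) i = (case i of 0 \<Rightarrow> 0 | Suc j \<Rightarrow> coeff q j) - \<mu> * coeff q i" for i
    by (simp add: coeff_pCons split: nat.splits)
  have "degree ([:- \<mu>, 1:] * q) \<le> Suc ?n"
    using degree_mult_le [of "[:- \<mu>, 1:]" q] by simp
  then have "poly_act f ([:- \<mu>, 1:] * q) v =
      (\<Sum>i\<le>Suc ?n. (case i of 0 \<Rightarrow> 0 | Suc j \<Rightarrow> coeff q j) *s ?w i) - (\<Sum>i\<le>Suc ?n. (\<mu> * coeff q i) *s ?w i)"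
    by (simp only: poly_act_le c vec.scale_left_diff_distrib sum_subtractf)
  also have "(\<Sum>i\<le>Suc ?n. (case i of 0 \<Rightarrow> 0 | Suc j \<Rightarrow> coeff q j) *s ?w i) = f *v (poly_act f q v)"
    unfolding sum.atMost_Suc_shift poly_act_def by (simp add: vec.sum vec.scale)
  also have "(\<Sum>i\<le>Suc ?n. (\<mu> * coeff q i) *s ?w i) = \<mu> *s poly_act f q v"
    unfolding poly_act_le [of q "Suc ?n" f, OF le_SucI [OF order_refl]]
    by (simp only: vec.scale_sum_right vec.scale_scale)
  finally show ?thesis .
qed

text \<open>
  Some nonzero polynomial in \<open>f\<close> annihilates \<open>w\<close>.  Among the polynomials that carry \<open>w\<close> into \<open>U\<close>, one
  of least degree has a root \<open>\<mu>\<close>, and the complementary factor carries \<open>w\<close> to the vector \<open>v\<close>.  Working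
  modulo a subspace takes the place of passing to a quotient space.
\<close>

lemma eigenvector_modulo:
  fixes f :: "'k::alg_closed_field^'n^'n"
  assumes U: "vec.subspace U" and W: "vec.subspace W" "\<And>x. x \<in> W \<Longrightarrow> f *v x \<in> W"
    and w: "w \<in> W" "w \<notin> U"
  obtains v \<mu> where "v \<in> W" "v \<notin> U" "f *v v - \<mu> *s v \<in> U"
proof -
  have iter: "((*v) f ^^ i) w \<in> W" for i by (induction i) (auto simp: w W)
  have act: "poly_act f p w \<in> W" for p
    unfolding poly_act_def by (intro vec.subspace_sum vec.subspace_scale W iter)
  obtain c where c: "\<exists>i\<le>CARD('n). c i \<noteq> 0" "(\<Sum>i\<le>CARD('n). c i *s (((*v) f ^^ i) w)) = 0"
    by (rule vectors_dependent)
  define p0 where "p0 = (\<Sum>i\<le>CARD('n). monom (c i) i)"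
  have p0: "coeff p0 i = (if i \<le> CARD('n) then c i else 0)" for i
    by (simp add: p0_def coeff_sum coeff_monom)
  have "degree p0 \<le> CARD('n)" by (rule degree_le) (simp add: p0)
  then have "poly_act f p0 w = 0"
    using c(2) by (simp add: poly_act_le [of p0 "CARD('n)"] p0)
  moreover have "p0 \<noteq> 0" using c(1) p0 by (metis coeff_0)
  moreover have "\<exists>v \<mu>. v \<in> W \<and> v \<notin> U \<and> f *v v - \<mu> *s v \<in> U" if "p \<noteq> 0" "poly_act f p w \<in> U" for p
    using that
  proof (induction "degree p" arbitrary: p rule: less_induct)
    case less
    show ?case
    proof (cases "degree p = 0")
      case True
      then have "poly_act f p w = coeff p 0 *s w" "coeff p 0 \<noteq> 0"
        using less.prems(1) by (auto simp: poly_act_def dest: leading_coeff_neq_0)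
      with less.prems(2) subspace_scale_iff [OF U] w show ?thesis by auto
    next
      case False
      then obtain \<mu> where "poly p \<mu> = 0" using alg_closed_imp_poly_has_root [of p] by auto
      then obtain q where q: "p = [:- \<mu>, 1:] * q" by (auto simp: poly_eq_0_iff_dvd)
      with less.prems(1) have q0: "q \<noteq> 0" by auto
      then have d: "degree p = Suc (degree q)"
        unfolding q by (subst degree_mult_eq) auto
      show ?thesis
      proof (cases "poly_act f q w \<in> U")
        case True
        with less.hyps [of q] q0 d show ?thesis by simp
      next
        case False
        with less.prems(2) act show ?thesis
          unfolding q poly_act_linear_factor by blast
      qed
    qed
  qed
  ultimately show ?thesis using that vec.subspace_0 [OF U] by metis
qed

text \<open>
  The classical argument: apply \<open>f - \<mu> l\<close> to a relation to remove one vector, and use induction.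
\<close>

lemma eigenvectors_modulo_independent:
  fixes f :: "'k::field^'n^'n"
  assumes U: "vec.subspace U" "\<And>x. x \<in> U \<Longrightarrow> f *v x \<in> U"
    and "finite K" "inj_on \<mu> K"
    and "\<And>k. k \<in> K \<Longrightarrow> v k \<notin> U" "\<And>k. k \<in> K \<Longrightarrow> f *v v k - \<mu> k *s v k \<in> U"
    and "(\<Sum>k\<in>K. c k *s v k) \<in> U" "k \<in> K"
  shows "c k = 0"
  using assms(3-)
proof (induction K arbitrary: c k rule: finite_induct)
  case (insert l K)
  let ?x = "\<Sum>k\<in>insert l K. c k *s v k"
  have "f *v ?x - \<mu> l *s ?x - (\<Sum>k\<in>insert l K. c k *s (f *v v k - \<mu> k *s v k)) \<in> U"
  proof -
    have "?x \<in> U" by (rule insert.prems)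
    moreover have "(\<Sum>k\<in>insert l K. c k *s (f *v v k - \<mu> k *s v k)) \<in> U"
      using insert.prems by (intro vec.subspace_sum vec.subspace_scale U(1)) auto
    ultimately show ?thesis by (intro vec.subspace_diff vec.subspace_scale U)
  qed
  also have "f *v ?x - \<mu> l *s ?x - (\<Sum>k\<in>insert l K. c k *s (f *v v k - \<mu> k *s v k)) =
      (\<Sum>k\<in>insert l K. (c k * (\<mu> k - \<mu> l)) *s v k)"
    by (simp add: vec.sum vec.scale vec.scale_sum_right sum_subtractf [symmetric] vec.scale_right_diff_distrib
        algebra_simps vec.scale_left_diff_distrib del: sum.insert)
  also have "\<dots> = (\<Sum>k\<in>K. (c k * (\<mu> k - \<mu> l)) *s v k)"
    using insert.hyps by simp
  finally have "c k * (\<mu> k - \<mu> l) = 0" if "k \<in> K" for k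
    using insert.IH [of "\<lambda>k. c k * (\<mu> k - \<mu> l)" k] insert.prems that by (auto simp: inj_on_def)
  then have z: "c k = 0" if "k \<in> K" for k
    using that insert.prems(1) insert.hyps by (auto simp: inj_on_def)
  then have "c l *s v l \<in> U" using insert.prems(4) insert.hyps by simp
  then have "c l = 0" using subspace_scale_iff [OF U(1), of "c l"] insert.prems(2) by auto
  with z insert.prems(5) show ?case by auto
qed simp

lemma of_nat_inj_below_char:
  assumes "CHAR('k::field) = 0 \<or> N < CHAR('k)" "i \<le> N" "j \<le> N" "of_nat i = (of_nat j :: 'k)"
  shows "i = j"
proof -
  have "i = j" if "i \<le> j" "j \<le> N" "of_nat i = (of_nat j :: 'k)" for i j
  proof -
    from that have "of_nat (j - i) = (0 :: 'k)" by (simp add: of_nat_diff)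
    then have "CHAR('k) dvd j - i" by (simp add: of_nat_eq_0_iff_char_dvd)
    with assms(1) that show ?thesis by (auto dest: dvd_imp_le)
  qed
  from this [of i j] this [of j i] assms show ?thesis by (cases "i \<le> j") auto
qed

text \<open>
  The relation forces \<open>b'\<close> to carry an eigenvector of \<open>a\<close> modulo \<open>U\<close> for \<open>\<mu>\<close> to one for
  \<open>\<mu> / (1 + \<mu>)\<close>; in other words, the inverse of the eigenvalue increases by one.  A nonzero eigenvalue would
  therefore come with a chain \<open>1/\<mu>, 1/\<mu> + 1, \<dots>, 1/\<mu> + N\<close> of inverse eigenvalues.  They are distinct by
  the hypothesis on the characteristic, and there are too many of them for dimension \<open>N\<close>.
\<close>

lemma no_nonzero_eigenvalue_modulo:
  fixes a b b' :: "'k::field^'n^'n"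
  assumes char: "CHAR('k) = 0 \<or> CARD('n) < CHAR('k)"
    and rel: "b' ** a = a ** b' + a ** b' ** a" and inv: "b ** b' = mat 1"
    and U: "vec.subspace U" "\<And>x. x \<in> U \<Longrightarrow> a *v x \<in> U" "\<And>x. x \<in> U \<Longrightarrow> b *v x \<in> U" "\<And>x. x \<in> U \<Longrightarrow> b' *v x \<in> U"
    and v: "v \<notin> U" "a *v v - \<mu> *s v \<in> U"
  shows "\<mu> = 0"
proof (rule ccontr)
  assume \<mu>: "\<mu> \<noteq> 0"
  have rel': "b' *v (a *v x) = a *v (b' *v x) + a *v (b' *v (a *v x))" for x
    using rel by (metis matrix_vector_mul_assoc matrix_vector_mult_add_rdistrib)
  have inv': "b *v (b' *v x) = x" for x
    using inv by (simp add: matrix_vector_mul_assoc)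
  have notin: "b' *v x \<notin> U" if "x \<notin> U" for x
    using that U(3) [of "b' *v x"] inv' by auto
  define w where "w k = ((*v) b' ^^ k) v" for k
  have chain: "1 + of_nat k * \<mu> \<noteq> 0 \<and> w k \<notin> U \<and> a *v w k - (\<mu> / (1 + of_nat k * \<mu>)) *s w k \<in> U" for k
  proof (induction k)
    case 0
    then show ?case using v by (simp add: w_def)
  next
    case (Suc k)
    define \<nu> where "\<nu> = \<mu> / (1 + of_nat k * \<mu>)"
    let ?u = "a *v w k - \<nu> *s w k"
    have u: "?u \<in> U" "w k \<notin> U" "1 + of_nat k * \<mu> \<noteq> 0" using Suc by (auto simp: \<nu>_def)
    have wS: "w (Suc k) = b' *v w k" by (simp add: w_def)
    \<comment> \<open>Modulo \<open>U\<close>, the relation multiplies the vector \<open>a b' w\<close> by \<open>1 + \<nu>\<close> and gives \<open>\<nu> b' w\<close>.\<close>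
    have "(1 + \<nu>) *s (a *v w (Suc k)) - \<nu> *s w (Suc k) = b' *v ?u - a *v (b' *v ?u)"
      unfolding wS using rel' [of "w k"]
      by (simp add: matrix_vector_linear vec.scale_left_distrib) (metis add_diff_cancel_right')
    also have "\<dots> \<in> U" using U u by (intro subspace_closed) auto
    finally have e: "(1 + \<nu>) *s (a *v w (Suc k)) - \<nu> *s w (Suc k) \<in> U" .
    have wU: "w (Suc k) \<notin> U" unfolding wS by (rule notin) (rule u)
    have \<nu>0: "\<nu> \<noteq> 0" using \<mu> u by (simp add: \<nu>_def)
    have "1 + \<nu> \<noteq> 0"
    proof
      assume "1 + \<nu> = 0"
      with e have "(- \<nu>) *s w (Suc k) \<in> U" by simp
      with subspace_scale_iff [OF U(1), of "- \<nu>"] \<nu>0 wU show False by simp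
    qed
    moreover have "1 + \<nu> = (1 + of_nat (Suc k) * \<mu>) / (1 + of_nat k * \<mu>)"
      using u(3) by (simp add: \<nu>_def field_simps)
    ultimately have n: "1 + of_nat (Suc k) * \<mu> \<noteq> 0" by auto
    have "inverse (1 + \<nu>) *s ((1 + \<nu>) *s (a *v w (Suc k)) - \<nu> *s w (Suc k)) \<in> U"
      by (rule vec.subspace_scale [OF U(1) e])
    moreover have "\<nu> / (1 + \<nu>) = \<mu> / (1 + of_nat (Suc k) * \<mu>)"
      using \<open>1 + \<nu> \<noteq> 0\<close> n u(3) unfolding \<open>1 + \<nu> = _\<close> by (simp add: \<nu>_def)
    moreover have "inverse (1 + \<nu>) *s ((1 + \<nu>) *s (a *v w (Suc k)) - \<nu> *s w (Suc k)) =
        a *v w (Suc k) - (\<nu> / (1 + \<nu>)) *s w (Suc k)"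
      using \<open>1 + \<nu> \<noteq> 0\<close>
      by (simp only: vec.scale_right_diff_distrib vec.scale_scale) (simp add: divide_inverse mult.commute)
    ultimately show ?case using n wU by simp
  qed
  obtain c where c: "\<exists>i\<le>CARD('n). c i \<noteq> 0" "(\<Sum>i\<le>CARD('n). c i *s w i) = 0"
    by (rule vectors_dependent)
  have "inj_on (\<lambda>k. \<mu> / (1 + of_nat k * \<mu>)) {..CARD('n)}"
  proof (rule inj_onI)
    fix i j assume ij: "i \<in> {..CARD('n)}" "j \<in> {..CARD('n)}"
      "\<mu> / (1 + of_nat i * \<mu>) = \<mu> / (1 + of_nat j * \<mu>)"
    then have "of_nat i = (of_nat j :: 'k)" using chain [of i] chain [of j] \<mu> by (simp add: field_simps)
    then show "i = j" using of_nat_inj_below_char [OF char] ij by simp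
  qed
  then have "c i = 0" if "i \<le> CARD('n)" for i
    using eigenvectors_modulo_independent [OF U(1,2), where K = "{..CARD('n)}" and v = w and c = c and k = i]
      chain c(2) that vec.subspace_0 [OF U(1)] by auto
  with c(1) show False by auto
qed

text \<open>
  There is an eigenvector of \<open>a\<close> modulo \<open>U\<close>, and by the previous lemma its eigenvalue is zero, so \<open>a\<close> has a
  nonzero kernel modulo \<open>U\<close>.  The relation shows that this kernel is
  stable under \<open>b'\<close>, so it contains an eigenvector of \<open>b'\<close> modulo \<open>U\<close>, which is one of \<open>b\<close> as well.
\<close>

lemma flag_step:
  fixes a b b' :: "'k::alg_closed_field^'n^'n"
  assumes char: "CHAR('k) = 0 \<or> CARD('n) < CHAR('k)"
    and rel: "b' ** a = a ** b' + a ** b' ** a" and inv: "b ** b' = mat 1"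
    and U: "vec.subspace U" "\<And>x. x \<in> U \<Longrightarrow> a *v x \<in> U" "\<And>x. x \<in> U \<Longrightarrow> b *v x \<in> U" "\<And>x. x \<in> U \<Longrightarrow> b' *v x \<in> U"
    and "U \<noteq> UNIV"
  obtains v \<mu> \<mu>' where "v \<notin> U" "a *v v \<in> U" "b *v v - \<mu> *s v \<in> U" "b' *v v - \<mu>' *s v \<in> U"
proof -
  have rel': "b' *v (a *v x) = a *v (b' *v x) + a *v (b' *v (a *v x))" for x
    using rel by (metis matrix_vector_mul_assoc matrix_vector_mult_add_rdistrib)
  have inv': "b *v (b' *v x) = x" for x
    using inv by (simp add: matrix_vector_mul_assoc)
  obtain w where "w \<notin> U" using \<open>U \<noteq> UNIV\<close> by blast
  then obtain v0 \<mu>0 where v0: "v0 \<notin> U" "a *v v0 - \<mu>0 *s v0 \<in> U"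
    using eigenvector_modulo [OF U(1) vec.subspace_UNIV, of a w] by auto
  then have "\<mu>0 = 0"
    using no_nonzero_eigenvalue_modulo [OF char rel inv U, of v0 \<mu>0] by blast
  with v0 have a0: "a *v v0 \<in> U" by simp
  define W where "W = {x. a *v x \<in> U}"
  have W: "vec.subspace W"
    unfolding W_def vec.subspace_def using U(1) by (auto simp: matrix_vector_linear intro: subspace_closed)
  have "b' *v x \<in> W" if "x \<in> W" for x
  proof -
    have "a *v (b' *v x) = b' *v (a *v x) - a *v (b' *v (a *v x))"
      using rel' [of x] by (metis add_diff_cancel_right')
    also have "\<dots> \<in> U" using that U by (intro subspace_closed) (auto simp: W_def)
    finally show ?thesis by (simp add: W_def)
  qed
  then obtain v \<mu> where v: "v \<in> W" "v \<notin> U" "b' *v v - \<mu> *s v \<in> U"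
    using eigenvector_modulo [OF U(1) W, of b' v0] v0 a0 by (auto simp: W_def)
  have \<mu>: "\<mu> \<noteq> 0"
  proof
    assume "\<mu> = 0"
    with v(3) U(3) [of "b' *v v"] inv' v(2) show False by simp
  qed
  have "(- inverse \<mu>) *s (b *v (b' *v v - \<mu> *s v)) \<in> U"
    by (intro subspace_closed U v)
  then have "b *v v - inverse \<mu> *s v \<in> U"
    using \<mu> by (simp add: matrix_vector_linear inv' vec.scale_right_diff_distrib)
  with v that show ?thesis by (auto simp: W_def)
qed

text \<open>
  Otherwise \<open>b - \<mu>\<close> would be injective, hence would map \<open>U\<close> onto itself by comparison of dimensions, and
  \<open>v\<close> would lie in \<open>U\<close>.
\<close>

lemma eigenvalue_modulo_is_eigenvalue:
  fixes b :: "'k::field^'n^'n"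
  assumes U: "vec.subspace U" "\<And>x. x \<in> U \<Longrightarrow> b *v x \<in> U" and v: "v \<notin> U" "b *v v - \<mu> *s v \<in> U"
  shows "\<exists>x. x \<noteq> 0 \<and> b *v x = \<mu> *s x"
proof (rule ccontr)
  assume no: "\<not> (\<exists>x. x \<noteq> 0 \<and> b *v x = \<mu> *s x)"
  let ?f = "(*v) (b - mat \<mu>)"
  have f: "?f x = b *v x - \<mu> *s x" for x
  proof -
    have "mat \<mu> *v x = \<mu> *s x"
      by (simp add: vec_eq_iff matrix_vector_mult_def mat_def if_distrib if_distribR cong: if_cong)
    then show ?thesis by (simp add: matrix_vector_mult_diff_rdistrib)
  qed
  have "x = y" if "?f x = ?f y" for x y
  proof -
    have "?f (x - y) = 0" using that by (simp add: matrix_vector_linear)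
    then have "b *v (x - y) = \<mu> *s (x - y)" using f by simp
    then show "x = y" using no by force
  qed
  then have inj: "inj ?f" by (auto simp: inj_on_def)
  have sub: "?f ` U \<subseteq> U" using U by (auto simp: f intro!: subspace_closed)
  have "vec.dim (?f ` U) = vec.dim U"
    using inj by (intro vec.dim_image_eq) (auto intro: inj_on_subset)
  then have "?f ` U = U"
    using sub U(1) by (intro vec.subspace_dim_equal) (auto intro: vec.linear_subspace_image)
  with v f have "?f v \<in> ?f ` U" by simp
  with inj v(1) show False by (auto dest: injD)
qed

lemma span_triangular_invariant:
  fixes f :: "'k::field^'n^'n" and v :: "nat \<Rightarrow> 'k^'n"
  assumes "\<And>i. i < k \<Longrightarrow> \<exists>\<mu>. f *v v i - \<mu> *s v i \<in> vec.span (v ` {..<i})"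
    and "x \<in> vec.span (v ` {..<k})"
  shows "f *v x \<in> vec.span (v ` {..<k})"
proof -
  have "vec.span (v ` {..<k}) \<subseteq> {x. f *v x \<in> vec.span (v ` {..<k})}"
  proof (rule vec.span_minimal)
    show "vec.subspace {x. f *v x \<in> vec.span (v ` {..<k})}"
      unfolding vec.subspace_def
      by (auto simp: matrix_vector_linear intro: vec.span_add vec.span_scale vec.span_zero)
    show "v ` {..<k} \<subseteq> {x. f *v x \<in> vec.span (v ` {..<k})}"
    proof (rule image_subsetI)
      fix i assume i: "i \<in> {..<k}"
      then obtain \<mu> where "f *v v i - \<mu> *s v i \<in> vec.span (v ` {..<i})" using assms(1) by auto
      moreover have "vec.span (v ` {..<i}) \<subseteq> vec.span (v ` {..<k})"
        using i by (intro vec.span_mono image_mono) auto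
      ultimately have "f *v v i - \<mu> *s v i \<in> vec.span (v ` {..<k})" by blast
      moreover have "\<mu> *s v i \<in> vec.span (v ` {..<k})"
        using i by (intro vec.span_scale vec.span_base) auto
      ultimately show "v i \<in> {x. f *v x \<in> vec.span (v ` {..<k})}"
        using vec.span_add [of "f *v v i - \<mu> *s v i" _ "\<mu> *s v i"] by simp
    qed
  qed
  with assms(2) show ?thesis by blast
qed

text \<open>
  Iterating the step yields a complete flag.  The eigenvalues modulo the members of the flag are the
  future diagonal entries of \<open>b\<close>.
\<close>

lemma flag_exists:
  fixes a b b' :: "'k::alg_closed_field^'n^'n"
  assumes char: "CHAR('k) = 0 \<or> CARD('n) < CHAR('k)"
    and rel: "b' ** a = a ** b' + a ** b' ** a" and inv: "b ** b' = mat 1"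
  shows "k \<le> CARD('n) \<Longrightarrow> \<exists>v. \<forall>i<k. v i \<notin> vec.span (v ` {..<i}) \<and> a *v v i \<in> vec.span (v ` {..<i}) \<and>
    (\<exists>\<mu>. b *v v i - \<mu> *s v i \<in> vec.span (v ` {..<i}) \<and> (\<exists>x. x \<noteq> 0 \<and> b *v x = \<mu> *s x)) \<and>
    (\<exists>\<mu>. b' *v v i - \<mu> *s v i \<in> vec.span (v ` {..<i}))"
proof (induction k)
  case (Suc k)
  then obtain v where v: "\<And>i. i < k \<Longrightarrow> v i \<notin> vec.span (v ` {..<i})"
    "\<And>i. i < k \<Longrightarrow> a *v v i \<in> vec.span (v ` {..<i})"
    "\<And>i. i < k \<Longrightarrow> \<exists>\<mu>. b *v v i - \<mu> *s v i \<in> vec.span (v ` {..<i}) \<and> (\<exists>x. x \<noteq> 0 \<and> b *v x = \<mu> *s x)"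
    "\<And>i. i < k \<Longrightarrow> \<exists>\<mu>. b' *v v i - \<mu> *s v i \<in> vec.span (v ` {..<i})"
    by (metis Suc_leD)
  let ?U = "vec.span (v ` {..<k})"
  have "vec.dim ?U \<le> k"
    using vec.dim_le_card [of ?U "v ` {..<k}"] card_image_le [of "{..<k}" v] by (auto intro: order_trans)
  then have ne: "?U \<noteq> UNIV" using Suc.prems vec_dim_card by (metis not_less_eq_eq)
  have a: "\<exists>\<mu>. a *v v i - \<mu> *s v i \<in> vec.span (v ` {..<i})" if "i < k" for i
    using v(2) [OF that] by (intro exI [of _ 0]) simp
  obtain w \<mu> \<mu>' where w: "w \<notin> ?U" "a *v w \<in> ?U" "b *v w - \<mu> *s w \<in> ?U" "b' *v w - \<mu>' *s w \<in> ?U"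
  proof (rule flag_step [OF char rel inv vec.subspace_span _ _ _ ne])
    show "a *v x \<in> ?U" if "x \<in> ?U" for x
      by (rule span_triangular_invariant [OF a that])
    show "b *v x \<in> ?U" if "x \<in> ?U" for x
      using v(3) by (intro span_triangular_invariant [OF _ that]) blast
    show "b' *v x \<in> ?U" if "x \<in> ?U" for x
      by (rule span_triangular_invariant [OF v(4) that])
  qed auto
  have ev: "\<exists>x. x \<noteq> 0 \<and> b *v x = \<mu> *s x"
  proof (rule eigenvalue_modulo_is_eigenvalue [OF vec.subspace_span _ w(1,3)])
    show "b *v x \<in> ?U" if "x \<in> ?U" for x
      using v(3) by (intro span_triangular_invariant [OF _ that]) blast
  qed
  let ?v = "v(k := w)"
  have im: "?v ` {..<i} = v ` {..<i}" if "i \<le> k" for i using that by (auto simp: image_iff)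
  show ?case
  proof (intro exI [of _ ?v] allI impI)
    fix i assume "i < Suc k"
    then consider "i < k" | "i = k" by linarith
    then show "?v i \<notin> vec.span (?v ` {..<i}) \<and> a *v ?v i \<in> vec.span (?v ` {..<i}) \<and>
      (\<exists>\<mu>. b *v ?v i - \<mu> *s ?v i \<in> vec.span (?v ` {..<i}) \<and> (\<exists>x. x \<noteq> 0 \<and> b *v x = \<mu> *s x)) \<and>
      (\<exists>\<mu>. b' *v ?v i - \<mu> *s ?v i \<in> vec.span (?v ` {..<i}))"
    proof cases
      case 1
      then show ?thesis unfolding im [OF less_imp_le [OF 1]] using v [OF 1] by auto
    next
      case 2
      then show ?thesis unfolding 2 im [OF order_refl] using w ev by auto
    qed
  qed
qed auto

text \<open>
  The index type carries no order; the injection \<open>ord\<close> gives the position of an index.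
\<close>

definition upper_triangular :: "('n \<Rightarrow> nat) \<Rightarrow> 'k::zero^'n^'n \<Rightarrow> bool" where
  "upper_triangular ord m \<longleftrightarrow> (\<forall>i j. m $ i $ j \<noteq> 0 \<longrightarrow> ord i \<le> ord j)"

definition strictly_upper_triangular :: "('n \<Rightarrow> nat) \<Rightarrow> 'k::zero^'n^'n \<Rightarrow> bool" where
  "strictly_upper_triangular ord m \<longleftrightarrow> (\<forall>i j. m $ i $ j \<noteq> 0 \<longrightarrow> ord i < ord j)"

text \<open>
  The columns of \<open>g\<close> are the vectors of a flag as in the previous lemma, in the order \<open>ord\<close>.
\<close>

lemma simultaneous_triangular:
  fixes a b b' :: "'k::alg_closed_field^'n^'n"
  assumes char: "CHAR('k) = 0 \<or> CARD('n) < CHAR('k)"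
    and rel: "b' ** a = a ** b' + a ** b' ** a" and inv: "b ** b' = mat 1"
  obtains g g' :: "'k^'n^'n" and ord
  where "inj ord" "g' ** g = mat 1" "g ** g' = mat 1"
    "strictly_upper_triangular ord (g' ** a ** g)"
    "upper_triangular ord (g' ** b ** g)" "upper_triangular ord (g' ** b' ** g)"
    "\<And>i. \<exists>x. x \<noteq> 0 \<and> b *v x = ((g' ** b ** g) $ i $ i) *s x"
proof -
  let ?n = "CARD('n)"
  obtain v where v: "\<And>i. i < ?n \<Longrightarrow> v i \<notin> vec.span (v ` {..<i})"
    "\<And>i. i < ?n \<Longrightarrow> a *v v i \<in> vec.span (v ` {..<i})"
    "\<And>i. i < ?n \<Longrightarrow> \<exists>\<mu>. b *v v i - \<mu> *s v i \<in> vec.span (v ` {..<i}) \<and> (\<exists>x. x \<noteq> 0 \<and> b *v x = \<mu> *s x)"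
    "\<And>i. i < ?n \<Longrightarrow> \<exists>\<mu>. b' *v v i - \<mu> *s v i \<in> vec.span (v ` {..<i})"
    using flag_exists [OF assms, of ?n] by auto
  obtain ord where "bij_betw ord (UNIV :: 'n set) {0..<?n}"
    using ex_bij_betw_finite_nat [of "UNIV :: 'n set"] by auto
  then have ord: "inj ord" "\<And>j. ord j < ?n" and ord_surj: "\<And>l. l < ?n \<Longrightarrow> \<exists>j. ord j = l"
    by (auto simp: bij_betw_def) (metis atLeastLessThan_iff imageE le0)
  define g where "g = (\<chi> i j. v (ord j) $ i)"
  have g: "g *v x = (\<Sum>j\<in>UNIV. x $ j *s v (ord j))" for x
    by (simp add: g_def vec_eq_iff matrix_vector_mult_def sum_component mult.commute)
  have "x = 0" if "g *v x = 0" for x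
  proof (rule ccontr)
    assume "x \<noteq> 0"
    let ?J = "{j. x $ j \<noteq> 0}"
    from \<open>x \<noteq> 0\<close> have "ord ` ?J \<noteq> {}" by (auto simp: vec_eq_iff)
    then have "Max (ord ` ?J) \<in> ord ` ?J" by (intro Max_in) auto
    then obtain j where j: "x $ j \<noteq> 0" "ord j = Max (ord ` ?J)" by auto
    then have j: "x $ j \<noteq> 0" "\<And>i. x $ i \<noteq> 0 \<Longrightarrow> ord i \<le> ord j" by auto
    have "(\<Sum>i\<in>UNIV - {j}. x $ i *s v (ord i)) \<in> vec.span (v ` {..<ord j})"
    proof (intro vec.span_sum)
      fix i assume "i \<in> UNIV - {j}"
      then show "x $ i *s v (ord i) \<in> vec.span (v ` {..<ord j})"
      proof (cases "x $ i = 0")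
        case False
        then have "ord i < ord j"
          using j(2) [of i] ord(1) \<open>i \<in> UNIV - {j}\<close> by (auto simp: inj_def order_le_less)
        then show ?thesis by (intro vec.span_scale vec.span_base) auto
      qed (simp add: vec.span_zero)
    qed
    moreover have "x $ j *s v (ord j) = - (\<Sum>i\<in>UNIV - {j}. x $ i *s v (ord i))"
      using that unfolding g by (simp add: sum.remove [of UNIV j] eq_neg_iff_add_eq_0)
    ultimately have "x $ j *s v (ord j) \<in> vec.span (v ` {..<ord j})"
      by (simp add: vec.span_neg)
    with j(1) v(1) [OF ord(2)] subspace_scale_iff [OF vec.subspace_span] show False by blast
  qed
  then have "inj ((*v) g)"
    by (metis (no_types, lifting) injI matrix_vector_linear(2) right_minus_eq)
  then obtain g' where g': "g' ** g = mat 1" using matrix_left_invertible_injective by blast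
  then have gg': "g ** g' = mat 1" by (simp add: matrix_left_right_inverse)
  have col: "g' *v v (ord j) = axis j 1" for j
  proof -
    have "v (ord j) = g *v axis j 1" by (simp add: g axis_def if_distrib if_distribR cong: if_cong)
    then show ?thesis using g' by (simp add: matrix_vector_mul_assoc)
  qed
  have span: "(g' *v x) $ i = 0" if "x \<in> vec.span (v ` {..<ord j})" "\<not> ord i < ord j" for x i j
  proof -
    have "vec.span (v ` {..<ord j}) \<subseteq> {x. (g' *v x) $ i = 0}"
    proof (rule vec.span_minimal)
      show "vec.subspace {x. (g' *v x) $ i = 0}"
        unfolding vec.subspace_def by (auto simp: matrix_vector_linear)
      show "v ` {..<ord j} \<subseteq> {x. (g' *v x) $ i = 0}"
      proof (rule image_subsetI)
        fix l assume "l \<in> {..<ord j}"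
        then obtain k where "l = ord k" "ord k < ord j"
          using ord_surj [of l] ord(2) [of j] by auto
        with that(2) show "v l \<in> {x. (g' *v x) $ i = 0}" by (auto simp: col axis_def)
      qed
    qed
    with that show ?thesis by blast
  qed
  have entry: "(g' ** m ** g) $ i $ j = (g' *v (m *v v (ord j))) $ i" for m i j
  proof -
    have "(g' ** m ** g) $ i $ j = ((g' ** m ** g) *v axis j 1) $ i"
      by (simp add: matrix_vector_mult_def axis_def if_distrib if_distribR cong: if_cong)
    also have "\<dots> = (g' *v (m *v (g *v axis j 1))) $ i"
      by (simp add: matrix_vector_mul_assoc matrix_mul_assoc)
    also have "g *v axis j 1 = v (ord j)" by (simp add: g axis_def if_distrib if_distribR cong: if_cong)
    finally show ?thesis .
  qed
  have tri: "(g' ** m ** g) $ i $ j = (if i = j then \<mu> else 0)"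
    if m: "m *v v (ord j) - \<mu> *s v (ord j) \<in> vec.span (v ` {..<ord j})" and "\<not> ord i < ord j" for m \<mu> i j
  proof -
    have "(g' *v (m *v v (ord j) - \<mu> *s v (ord j))) $ i = 0" by (rule span [OF that])
    then have "(g' *v (m *v v (ord j))) $ i = \<mu> * axis j 1 $ i"
      by (simp add: matrix_vector_linear col)
    then show ?thesis by (simp add: entry axis_def)
  qed
  have upper: "upper_triangular ord (g' ** m ** g)"
    if m: "\<And>i. i < ?n \<Longrightarrow> \<exists>\<mu>. m *v v i - \<mu> *s v i \<in> vec.span (v ` {..<i})" for m
    unfolding upper_triangular_def
  proof (intro allI impI)
    fix i j assume "(g' ** m ** g) $ i $ j \<noteq> 0"
    moreover obtain \<mu> where "m *v v (ord j) - \<mu> *s v (ord j) \<in> vec.span (v ` {..<ord j})"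
      using m [OF ord(2), of j] by blast
    ultimately show "ord i \<le> ord j"
      using tri [of m j \<mu> i] by (cases "i = j"; cases "ord i < ord j") auto
  qed
  show ?thesis
  proof (rule that [OF ord(1) g' gg'])
    show "strictly_upper_triangular ord (g' ** a ** g)"
      unfolding strictly_upper_triangular_def
      using tri [of a _ 0] v(2) [OF ord(2)] by (metis diff_zero vec.scale_zero_left)
    show "upper_triangular ord (g' ** b ** g)" using v(3) by (intro upper) blast
    show "upper_triangular ord (g' ** b' ** g)" using v(4) by (intro upper) blast
    show "\<exists>x. x \<noteq> 0 \<and> b *v x = ((g' ** b ** g) $ i $ i) *s x" for i
      using v(3) [OF ord(2), of i] tri [of b i _ i] by auto
  qed
qed

section \<open>Uniqueness in triangular coordinates\<close>

text \<open>
  Monomials are compared by degree first and then by the total weight of the variables.  The relation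
  is well-founded, compatible with products, and made such that a variable precedes all other monomials
  of its image under a triangular substitution.
\<close>

definition precedes :: "('v \<Rightarrow> nat) \<Rightarrow> 'v multiset \<Rightarrow> 'v multiset \<Rightarrow> bool" where
  "precedes wt M T \<longleftrightarrow> size M < size T \<or> size M = size T \<and> (\<Sum>v\<in>#M. wt v) < (\<Sum>v\<in>#T. wt v)"

lemma wf_precedes: "wfP (precedes wt)"
proof -
  have "{(M, T). precedes wt M T} =
      inv_image (less_than <*lex*> less_than) (\<lambda>M. (size M, \<Sum>v\<in>#M. wt v))"
    by (auto simp: precedes_def)
  then have "wf {(M, T). precedes wt M T}" by (simp add: wf_lex_prod)
  then show ?thesis by (simp add: wfp_def)
qed

lemma precedes_irrefl: "\<not> precedes wt M M"
  by (simp add: precedes_def)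

lemma precedes_add:
  assumes "A = M \<or> precedes wt M A" "B = N \<or> precedes wt N B"
  shows "A = M \<and> B = N \<or> precedes wt (M + N) (A + B)"
  using assms by (auto simp: precedes_def)

definition triangular_family :: "('v \<Rightarrow> nat) \<Rightarrow> ('v \<Rightarrow> 'k::comm_ring_1) \<Rightarrow> ('k, 'v, 'v) formal_map \<Rightarrow> bool" where
  "triangular_family wt \<kappa> \<Phi> \<longleftrightarrow> (\<forall>v. mcoeff (\<Phi> v) {#v#} = \<kappa> v \<and>
    (\<forall>T. mcoeff (\<Phi> v) T \<noteq> 0 \<longrightarrow> T = {#v#} \<or> precedes wt {#v#} T))"

lemma triangular_familyI:
  assumes "formal_mapping \<Phi>" "\<And>v. mcoeff (\<Phi> v) {#v#} = \<kappa> v"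
    and "\<And>v v'. mcoeff (\<Phi> v) {#v'#} \<noteq> 0 \<Longrightarrow> v' = v \<or> wt v < wt v'"
  shows "triangular_family wt \<kappa> \<Phi>"
  unfolding triangular_family_def
proof (intro allI conjI impI)
  fix v T assume T: "mcoeff (\<Phi> v) T \<noteq> 0"
  with assms(1) have "size T \<noteq> 0" by (auto simp: formal_mapping_def)
  then consider "size T = 1" | "size T > 1" by linarith
  then show "T = {#v#} \<or> precedes wt {#v#} T"
  proof cases
    case 1
    then obtain v' where "T = {#v'#}" by (metis size_1_singleton_mset)
    with assms(3) [of v v'] T show ?thesis by (auto simp: precedes_def)
  qed (simp add: precedes_def)
qed (rule assms)

text \<open>
  Leading monomials and leading coefficients multiply.
\<close>

lemma triangular_family_prod:
  assumes "triangular_family wt \<kappa> \<Phi>"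
  shows "mcoeff (\<Prod>v\<in>#M. \<Phi> v) M = (\<Prod>v\<in>#M. \<kappa> v) \<and>
    (\<forall>T. mcoeff (\<Prod>v\<in>#M. \<Phi> v) T \<noteq> 0 \<longrightarrow> T = M \<or> precedes wt M T)"
proof (induction M)
  case (add x M)
  let ?p = "\<Prod>v\<in>#M. \<Phi> v"
  have summand: "A = {#x#} \<and> B = M \<or> precedes wt ({#x#} + M) (A + B)"
    if "mcoeff (\<Phi> x) A * mcoeff ?p B \<noteq> 0" for A B
  proof (rule precedes_add)
    show "A = {#x#} \<or> precedes wt {#x#} A"
      using that assms unfolding triangular_family_def by (metis mult_zero_left)
    show "B = M \<or> precedes wt M B"
      using that add by (metis mult_zero_right)
  qed
  have "T = add_mset x M \<or> precedes wt (add_mset x M) T" if T: "mcoeff (\<Phi> x * ?p) T \<noteq> 0" for T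
  proof -
    obtain A B where AB: "A + B = T" "mcoeff (\<Phi> x) A * mcoeff ?p B \<noteq> 0"
      using T unfolding mcoeff_mult by (force elim: sum.not_neutral_contains_not_neutral)
    from summand [OF AB(2)] AB(1) show ?thesis by auto
  qed
  moreover have "mcoeff (\<Phi> x * ?p) (add_mset x M) =
      (\<Sum>(A, B)\<in>{({#x#}, M)}. mcoeff (\<Phi> x) A * mcoeff ?p B)"
    unfolding mcoeff_mult
  proof (rule sum.mono_neutral_right [OF finite_splittings])
    show "\<forall>q\<in>{(A, B). A + B = add_mset x M} - {({#x#}, M)}.
        (case q of (A, B) \<Rightarrow> mcoeff (\<Phi> x) A * mcoeff ?p B) = 0"
    proof
      fix q assume q: "q \<in> {(A, B). A + B = add_mset x M} - {({#x#}, M)}"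
      have "mcoeff (\<Phi> x) (fst q) * mcoeff ?p (snd q) = 0"
      proof (rule ccontr)
        assume "mcoeff (\<Phi> x) (fst q) * mcoeff ?p (snd q) \<noteq> 0"
        from summand [OF this] q show False by (auto simp: precedes_irrefl)
      qed
      then show "(case q of (A, B) \<Rightarrow> mcoeff (\<Phi> x) A * mcoeff ?p B) = 0"
        by (simp add: case_prod_beta)
    qed
  qed auto
  moreover have "mcoeff (\<Phi> x) {#x#} = \<kappa> x" using assms by (simp add: triangular_family_def)
  ultimately show ?case using add by simp
qed (auto simp: mcoeff_one)

text \<open>
  A triangular substitution only moves monomials up, so the first surviving coefficient is merely
  multiplied by the corresponding product of diagonal coefficients.
\<close>

lemma mcoeff_subst_triangular:
  assumes \<Phi>: "triangular_family wt \<kappa> \<Phi>" and f: "\<And>M. precedes wt M T \<Longrightarrow> mcoeff f M = 0"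
  shows "mcoeff (mfps_subst f \<Phi>) T = mcoeff f T * (\<Prod>v\<in>#T. \<kappa> v)"
proof -
  have "mcoeff (mfps_subst f \<Phi>) T = (\<Sum>M\<in>{T}. mcoeff f M * mcoeff (\<Prod>i\<in>#M. \<Phi> i) T)"
    unfolding mcoeff_subst
  proof (rule sum.mono_neutral_right)
    show "\<forall>M\<in>{M. size M \<le> size T} - {T}. mcoeff f M * mcoeff (\<Prod>i\<in>#M. \<Phi> i) T = 0"
    proof
      fix M assume M: "M \<in> {M. size M \<le> size T} - {T}"
      then have "mcoeff (\<Prod>i\<in>#M. \<Phi> i) T = 0 \<or> precedes wt M T"
        using triangular_family_prod [OF \<Phi>, of M] by auto
      then show "mcoeff f M * mcoeff (\<Prod>i\<in>#M. \<Phi> i) T = 0" using f by auto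
    qed
  qed auto
  then show ?thesis using triangular_family_prod [OF \<Phi>, of T] by simp
qed

abbreviation var_l :: "('k::comm_ring_1, 'n + 'm, 'n) formal_map" where "var_l \<equiv> \<lambda>i. mfps_var (Inl i)"
abbreviation var_r :: "('k::comm_ring_1, 'n + 'm, 'm) formal_map" where "var_r \<equiv> \<lambda>i. mfps_var (Inr i)"

text \<open>
  The equation is read at the first monomial \<open>T\<close> at which \<open>D\<close> might not vanish, and there for the last
  component \<open>i\<close> that might not.  The summands that contain \<open>h\<close> drop out: the substitution \<open>(h, y)\<close> has zero diagonal at the
  variables of the first group, one of which occurs in \<open>T\<close>, and \<open>e\<close> only involves components beyond
  \<open>i\<close>.  Writing \<open>D i T\<close> for the coefficient, what is left is \<open>(\<kappa> i - \<kappa> T) D i T = 0\<close>, where \<open>\<kappa> T\<close> is a product of at least two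
  eigenvalues; the factor is nonzero since there is no resonance.
\<close>

lemma triangular_uniqueness:
  fixes D u w h :: "('k::field, 'n::finite + 'n, 'n) formal_map" and b e :: "'k^'n^'n" and ord :: "'n \<Rightarrow> nat"
  defines "wt \<equiv> case_sum ord ord" and "\<kappa> \<equiv> \<lambda>i. b $ i $ i"
  assumes uw: "triangular_family wt (case_sum \<kappa> \<kappa>) (case_sum u w)"
    and hY: "triangular_family wt (case_sum (\<lambda>_. 0) (\<lambda>_. 1)) (case_sum h var_r)"
    and uh: "triangular_family wt (case_sum \<kappa> (\<lambda>_. 0)) (case_sum u h)"
    and ord: "inj ord" "upper_triangular ord b" "strictly_upper_triangular ord e"
    and nonres: "\<And>i M. size M \<ge> 2 \<Longrightarrow> \<kappa> i \<noteq> (\<Prod>v\<in>#M. case_sum \<kappa> \<kappa> v)"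
    and D: "\<And>i. order_ge 2 (D i)" "\<And>i T. mcoeff (D i) T \<noteq> 0 \<Longrightarrow> \<exists>j. Inl j \<in># T"
    and eq: "b \<cdot> D = (D \<circ>\<^sub>f case_sum u w) + b \<cdot> (D \<circ>\<^sub>f case_sum h var_r) - e \<cdot> (D \<circ>\<^sub>f case_sum u h)"
  shows "D = 0"
proof -
  have "\<forall>i. mcoeff (D i) T = 0" for T
  proof (induction T rule: wfp_induct_rule [OF wf_precedes [of wt]])
    case (1 T)
    show ?case
    proof (cases "size T \<ge> 2 \<and> (\<exists>j. Inl j \<in># T)")
      case False
      then show ?thesis using D by (metis order_geD not_le)
    next
      case True
      have sub: "mcoeff ((D \<circ>\<^sub>f \<Phi>) j) T = mcoeff (D j) T * (\<Prod>v\<in>#T. \<mu> v)"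
        if "triangular_family wt \<mu> \<Phi>" for \<mu> \<Phi> j
        unfolding fm_comp_def by (rule mcoeff_subst_triangular [OF that]) (use 1 in blast)
      define K where "K = Max (range ord)"
      have K: "ord i \<le> K" for i by (simp add: K_def)
      have "mcoeff (D i) T = 0" for i
      proof (induction i rule: measure_induct_rule [of "\<lambda>i. K - ord i"])
        case (less i)
        then have IH: "mcoeff (D j) T = 0" if "ord i < ord j" for j
          using that K [of j] K [of i] by (intro less) linarith
        have "mcoeff ((b \<cdot> D) i) T = (\<Sum>j\<in>UNIV. if j = i then \<kappa> i * mcoeff (D i) T else 0)"
          unfolding mcoeff_act
        proof (intro sum.cong refl)
          fix j
          show "b $ i $ j * mcoeff (D j) T = (if j = i then \<kappa> i * mcoeff (D i) T else 0)"
            using IH [of j] ord(1,2) unfolding upper_triangular_def \<kappa>_def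
            by (cases "b $ i $ j = 0") (auto simp: inj_def order_le_less)
        qed
        then have lhs: "mcoeff ((b \<cdot> D) i) T = \<kappa> i * mcoeff (D i) T" by simp
        have z: "(\<Prod>v\<in>#T. case_sum (\<lambda>_. 0) (\<lambda>_. 1) v) = (0 :: 'k)"
          using True by (auto simp: prod_mset_zero_iff image_iff intro!: bexI)
        have "mcoeff ((b \<cdot> (D \<circ>\<^sub>f case_sum h var_r)) i) T = 0"
          unfolding mcoeff_act by (simp add: sub [OF hY] z)
        moreover have "mcoeff ((e \<cdot> (D \<circ>\<^sub>f case_sum u h)) i) T = 0"
          unfolding mcoeff_act
        proof (intro sum.neutral ballI)
          fix j
          show "e $ i $ j * mcoeff ((D \<circ>\<^sub>f case_sum u h) j) T = 0"
            using IH [of j] ord(3) unfolding strictly_upper_triangular_def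
            by (cases "e $ i $ j = 0") (auto simp: sub [OF uh])
        qed
        ultimately have "\<kappa> i * mcoeff (D i) T = mcoeff (D i) T * (\<Prod>v\<in>#T. case_sum \<kappa> \<kappa> v)"
          unfolding lhs [symmetric] eq by (simp add: sub [OF uw])
        then have "mcoeff (D i) T * (\<kappa> i - (\<Prod>v\<in>#T. case_sum \<kappa> \<kappa> v)) = 0" by (simp add: algebra_simps)
        then show "mcoeff (D i) T = 0" using nonres [of T i] True by simp
      qed
      then show ?thesis by blast
    qed
  qed
  then show ?thesis by (auto intro!: mfps_eqI simp: fun_eq_iff)
qed

section \<open>Passage to the algebraic closure\<close>

definition extend_coeffs :: "('k::field, 'v) mfps \<Rightarrow> ('k alg_closure, 'v) mfps" where
  "extend_coeffs f = Abs_mfps (\<lambda>M. to_ac (mcoeff f M))"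

lemma mcoeff_extend [simp]: "mcoeff (extend_coeffs f) M = to_ac (mcoeff f M)"
  by (simp add: extend_coeffs_def)

lemma extend_mult: "extend_coeffs (f * g) = extend_coeffs f * extend_coeffs g"
  by (rule mfps_eqI) (simp add: mcoeff_mult to_ac_sum case_prod_beta)

lemma extend_prod_mset: "extend_coeffs (\<Prod>i\<in>#M. f i) = (\<Prod>i\<in>#M. extend_coeffs (f i))"
proof (induction M)
  case empty
  show ?case by (auto intro!: mfps_eqI simp: mcoeff_one)
qed (simp add: extend_mult)

lemma extend_subst: "extend_coeffs (mfps_subst f \<phi>) = mfps_subst (extend_coeffs f) (\<lambda>i. extend_coeffs (\<phi> i))"
  by (rule mfps_eqI) (simp add: mcoeff_subst to_ac_sum flip: extend_prod_mset)

definition mat_ac :: "'k::field^'n^'m \<Rightarrow> 'k alg_closure^'n^'m" where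
  "mat_ac m = (\<chi> i j. to_ac (m $ i $ j))"

lemma mat_ac_simps: "mat_ac (m ** m') = mat_ac m ** mat_ac m'" "mat_ac (m + p) = mat_ac m + mat_ac p"
  "mat_ac (m - p) = mat_ac m - mat_ac p" "mat_ac (mat 1) = mat 1" "mat_ac 0 = 0"
  by (simp_all add: mat_ac_def vec_eq_iff matrix_matrix_mult_def to_ac_sum mat_def)

text \<open>
  The map \<open>F\<close> over the algebraic closure, in the coordinates in which the linear maps are triangular:
  both arguments and the value are expressed in the basis formed by the columns of \<open>g\<close>.
\<close>

definition change_coords :: "'k alg_closure^'n^'n \<Rightarrow> 'k alg_closure^'n^'n \<Rightarrow>
    ('k::field, 'n::finite + 'n, 'n) formal_map \<Rightarrow> ('k alg_closure, 'n + 'n, 'n) formal_map" where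
  "change_coords g g' F =
    g' \<cdot> ((\<lambda>i. extend_coeffs (F i)) \<circ>\<^sub>f case_sum (g \<cdot> var_l) (g \<cdot> var_r))"

context
  fixes g g' :: "'k::field alg_closure^'n::finite^'n"
  assumes gg': "g ** g' = mat 1" and g'g: "g' ** g = mat 1"
begin

lemma formal_change_coords [simp]: "formal_mapping F \<Longrightarrow> formal_mapping (change_coords g g' F)"
  unfolding change_coords_def by (intro formal_mapping_act formal_mapping_comp) (simp add: formal_mapping_def)

lemma change_coords_comp:
  assumes "formal_mapping u" "formal_mapping w"
  shows "change_coords g g' (F \<circ>\<^sub>f case_sum u w) =
    change_coords g g' F \<circ>\<^sub>f case_sum (change_coords g g' u) (change_coords g g' w)"
proof -
  let ?x = "\<lambda>F i. extend_coeffs (F i)" and ?G = "case_sum (g \<cdot> var_l) (g \<cdot> var_r)"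
  have f: "formal_mapping (?x u)" "formal_mapping (?x w)" using assms by (auto simp: formal_mapping_def)
  have x: "?x (F \<circ>\<^sub>f case_sum u w) = ?x F \<circ>\<^sub>f case_sum (?x u) (?x w)"
    by (auto simp: fm_comp_def extend_subst fun_eq_iff intro!: arg_cong [where f = "mfps_subst _"] split: sum.splits)
  have c: "?G \<circ>\<^sub>f case_sum (change_coords g g' u) (change_coords g g' w) =
      case_sum (?x u) (?x w) \<circ>\<^sub>f ?G"
    using assms by (simp add: case_sum_comp act_comp) (simp add: change_coords_def act_act gg')
  show ?thesis
    unfolding change_coords_def [of g g' F] act_comp
    using assms f by (simp add: fm_comp_assoc c) (simp add: change_coords_def x fm_comp_assoc)
qed

lemma change_coords_act:
  "change_coords g g' (e \<cdot> F) = (g' ** mat_ac e ** g) \<cdot> change_coords g g' F"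
proof -
  have "(\<lambda>i. extend_coeffs ((e \<cdot> F) i)) = mat_ac e \<cdot> (\<lambda>i. extend_coeffs (F i))"
    by (auto intro!: mfps_eqI simp: fun_eq_iff mcoeff_act mat_ac_def to_ac_sum)
  moreover have "g' ** mat_ac e ** g ** g' = g' ** mat_ac e"
    by (metis gg' matrix_mul_assoc matrix_mul_rid)
  ultimately show ?thesis by (simp add: change_coords_def act_comp act_act)
qed

lemma change_coords_add: "change_coords g g' (F + H) = change_coords g g' F + change_coords g g' H"
proof -
  have "(\<lambda>i. extend_coeffs ((F + H) i)) = (\<lambda>i. extend_coeffs (F i)) + (\<lambda>i. extend_coeffs (H i))"
    by (auto intro!: mfps_eqI simp: fun_eq_iff)
  then show ?thesis by (simp add: change_coords_def fm_comp_add act_add)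
qed

lemma change_coords_diff: "change_coords g g' (F - H) = change_coords g g' F - change_coords g g' H"
  using change_coords_add [of "F - H" H] by (simp add: algebra_simps)

lemma change_coords_0: "change_coords g g' 0 = 0"
  using change_coords_diff [of 0 0] by simp

lemma change_coords_vars: "change_coords g g' var_l = var_l" "change_coords g g' var_r = var_r"
proof -
  have e: "extend_coeffs (mfps_var v) = mfps_var v" for v
    by (rule mfps_eqI) (simp add: mcoeff_var)
  show "change_coords g g' var_l = var_l" "change_coords g g' var_r = var_r"
    by (simp_all add: change_coords_def e act_act g'g)
qed

lemma order_ge_change_coords:
  assumes "\<And>i. order_ge m (F i)"
  shows "order_ge m (change_coords g g' F i)"
proof -
  have "order_ge m (((\<lambda>i. extend_coeffs (F i)) \<circ>\<^sub>f case_sum (g \<cdot> var_l) (g \<cdot> var_r)) i)" for i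
    unfolding fm_comp_def using assms by (intro order_ge_subst) (auto simp: order_ge_def)
  then show ?thesis by (simp add: change_coords_def order_ge_def mcoeff_act)
qed

text \<open>
  The change of coordinates is undone by the substitution of \<open>g'\<close>, and no coefficient is lost by
  extension of scalars.
\<close>

lemma change_coords_eq_0:
  assumes "change_coords g g' F = 0"
  shows "F = 0"
proof -
  let ?x = "\<lambda>i. extend_coeffs (F i)" and ?G = "case_sum (g \<cdot> var_l) (g \<cdot> var_r)"
  let ?G' = "case_sum (g' \<cdot> var_l) (g' \<cdot> var_r) :: ('k alg_closure, 'n + 'n, 'n + 'n) formal_map"
  have "g \<cdot> change_coords g g' F = 0" by (simp add: assms)
  then have "?x \<circ>\<^sub>f ?G = 0" by (simp add: change_coords_def act_act gg')
  then have "?x \<circ>\<^sub>f (?G \<circ>\<^sub>f ?G') = 0" by (simp flip: fm_comp_assoc)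
  moreover have "?G \<circ>\<^sub>f ?G' = fm_id"
    by (auto simp: case_sum_comp act_comp act_act gg' fm_id_def fun_eq_iff split: sum.splits)
  ultimately have "?x = 0" by simp
  then show ?thesis
    by (auto intro!: mfps_eqI simp: fun_eq_iff) (metis mcoeff_extend to_ac_eq_0_iff zero_mfps.rep_eq)
qed

end

text \<open>
  Setting the first group of variables to zero keeps exactly the monomials that do not contain them.
\<close>

lemma mcoeff_zero_left:
  fixes D :: "('k::comm_ring_1, 'm::finite + 'n::finite, 'w) formal_map"
  assumes "D \<circ>\<^sub>f case_sum 0 (var_r :: ('k, 'm + 'n, 'n) formal_map) = 0" "\<And>j. Inl j \<notin># T"
  shows "mcoeff (D i) T = 0"
proof -
  let ?\<Phi> = "case_sum 0 var_r :: ('k, 'm + 'n, 'm + 'n) formal_map"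
  have "(\<Prod>v\<in>#M. ?\<Phi> v) = (if \<exists>j. Inl j \<in># M then 0 else \<Prod>v\<in>#M. mfps_var v)" for M
  proof (cases "\<exists>j. Inl j \<in># M")
    case True
    then obtain j where "Inl j \<in># M" by blast
    then obtain M' where "M = add_mset (Inl j) M'" by (meson multi_member_split)
    then show ?thesis by auto
  next
    case False
    have "?\<Phi> v = mfps_var v" if "v \<in># M" for v using that False by (cases v) auto
    then have "image_mset ?\<Phi> M = image_mset mfps_var M" by (intro image_mset_cong) auto
    then show ?thesis using False by simp
  qed
  then have "mcoeff ((D \<circ>\<^sub>f ?\<Phi>) i) T = (\<Sum>M | size M \<le> size T. if M = T then mcoeff (D i) M else 0)"
    unfolding fm_comp_def mcoeff_subst using assms(2) by (intro sum.cong refl) (auto simp: prod_mset_vars)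
  then show ?thesis unfolding assms(1) by simp
qed

section \<open>Solving functional equations degree by degree\<close>

text \<open>
  The columns of the matrix are independent; together with a right-hand side outside their span there
  would be more independent vectors than there are unknowns.
\<close>

lemma injective_system_surjective:
  fixes c :: "'i \<Rightarrow> 'i \<Rightarrow> 'k::field"
  assumes "finite I"
    and inj: "\<And>x. (\<And>s. s \<in> I \<Longrightarrow> (\<Sum>t\<in>I. c s t * x t) = 0) \<Longrightarrow> \<forall>t\<in>I. x t = 0"
  obtains x where "\<And>s. s \<in> I \<Longrightarrow> (\<Sum>t\<in>I. c s t * x t) = r s"
proof -
  interpret V: vector_space "\<lambda>(k :: 'k) (f :: 'i \<Rightarrow> 'k) i. k * f i"
    by unfold_locales (auto simp: fun_eq_iff algebra_simps)
  have fsum: "(\<Sum>t\<in>A. f t) s = (\<Sum>t\<in>A. f t s)" for A and f :: "'b \<Rightarrow> 'i \<Rightarrow> 'k" and s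
    by (induction A rule: infinite_finite_induct) auto
  define col where "col t s = (if s \<in> I then c s t else 0)" for t s
  define e where "e t s = (if s = t then 1 else (0 :: 'k))" for t s :: 'i
  define r' where "r' s = (if s \<in> I then r s else 0)" for s
  have lin: "\<forall>t\<in>I. x t = 0" if "(\<Sum>t\<in>I. (\<lambda>s. x t * col t s)) = 0" for x
  proof (rule inj)
    fix s assume "s \<in> I"
    then show "(\<Sum>t\<in>I. c s t * x t) = 0"
      using fun_cong [OF that, of s] by (simp add: fsum col_def mult.commute)
  qed
  have injcol: "inj_on col I"
  proof (rule inj_onI, rule ccontr)
    fix s t assume st: "s \<in> I" "t \<in> I" "col s = col t" "s \<noteq> t"
    let ?x = "\<lambda>q. e s q - e t q"
    have "(\<Sum>q\<in>I. (\<lambda>p. ?x q * col q p)) = 0"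
    proof
      fix p
      have "(\<Sum>q\<in>I. ?x q * col q p) =
          (\<Sum>q\<in>I. if q = s then col q p else 0) - (\<Sum>q\<in>I. if q = t then col q p else 0)"
        unfolding sum_subtractf [symmetric] by (intro sum.cong) (auto simp: e_def)
      also have "\<dots> = 0" using st assms(1) by simp
      finally show "(\<Sum>q\<in>I. (\<lambda>p. ?x q * col q p)) p = 0 p" by (simp add: fsum)
    qed
    from lin [OF this] st show False by (auto simp: e_def)
  qed
  have indep: "V.independent (col ` I)"
  proof (rule V.independent_if_scalars_zero)
    fix f x assume f: "(\<Sum>x\<in>col ` I. (\<lambda>i. f x * x i)) = 0" and "x \<in> col ` I"
    then obtain t where "t \<in> I" "x = col t" by auto
    moreover have "(\<Sum>t\<in>I. (\<lambda>i. f (col t) * col t i)) = 0"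
      using f by (simp add: sum.reindex [OF injcol])
    ultimately show "f x = 0" using lin [of "f \<circ> col"] by auto
  qed (use assms(1) in auto)
  have supp: "f \<in> V.span (e ` I)" if "\<And>s. s \<notin> I \<Longrightarrow> f s = 0" for f
  proof -
    have "f = (\<Sum>t\<in>I. (\<lambda>i. f t * e t i))"
    proof
      fix i
      have "(\<Sum>t\<in>I. f t * e t i) = (\<Sum>t\<in>I. if t = i then f t else 0)"
        by (intro sum.cong) (auto simp: e_def)
      then show "f i = (\<Sum>t\<in>I. (\<lambda>i. f t * e t i)) i" using that assms(1) by (simp add: fsum)
    qed
    moreover have "\<dots> \<in> V.span (e ` I)"
      by (intro V.span_sum V.span_scale V.span_base) auto
    ultimately show ?thesis by simp
  qed
  have "r' \<in> V.span (col ` I)"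
  proof (rule ccontr)
    assume r': "r' \<notin> V.span (col ` I)"
    then have "r' \<notin> col ` I" using V.span_base by blast
    have "V.independent (insert r' (col ` I))" using r' indep by (simp add: V.independent_insert)
    moreover have "insert r' (col ` I) \<subseteq> V.span (e ` I)"
      using supp by (auto simp: r'_def col_def)
    ultimately have "card (insert r' (col ` I)) \<le> card (e ` I)"
      using V.independent_span_bound [of "e ` I"] assms(1) by blast
    also have "\<dots> \<le> card I" using assms(1) by (rule card_image_le)
    finally show False
      using \<open>r' \<notin> col ` I\<close> assms(1) card_image [OF injcol] by simp
  qed
  then obtain u where "r' = (\<Sum>v\<in>col ` I. (\<lambda>i. u v * v i))"
    using V.span_finite [of "col ` I"] assms(1) by auto
  then have r': "r' = (\<Sum>t\<in>I. (\<lambda>i. u (col t) * col t i))" by (simp add: sum.reindex [OF injcol])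
  show ?thesis
  proof (rule that [of "u \<circ> col"])
    fix s assume s: "s \<in> I"
    then have "r s = r' s" by (simp add: r'_def)
    also have "\<dots> = (\<Sum>t\<in>I. u (col t) * col t s)" by (subst r') (simp add: fsum)
    finally show "(\<Sum>t\<in>I. c s t * (u \<circ> col) t) = r s" using s by (simp add: col_def mult.commute)
  qed
qed

definition homogeneous_linear :: "('k::comm_ring_1, 'v, 'w) formal_map \<Rightarrow> bool" where
  "homogeneous_linear L \<longleftrightarrow> (\<forall>v T. mcoeff (L v) T \<noteq> 0 \<longrightarrow> size T = 1)"

lemma homogeneous_linear_prod:
  assumes "homogeneous_linear L" "mcoeff (\<Prod>v\<in>#M. L v) T \<noteq> 0"
  shows "size T = size M"
  using assms(2)
proof (induction M arbitrary: T)
  case empty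
  then show ?case by (simp add: mcoeff_one split: if_splits)
next
  case (add x M)
  have "\<exists>A B. A + B = T \<and> mcoeff (L x) A * mcoeff (\<Prod>v\<in>#M. L v) B \<noteq> 0"
  proof (rule ccontr)
    assume "\<not> ?thesis"
    then have "mcoeff (L x * (\<Prod>v\<in>#M. L v)) T = 0"
      unfolding mcoeff_mult by (intro sum.neutral) auto
    with add.prems show False by simp
  qed
  then obtain A B where AB: "A + B = T" "mcoeff (L x) A \<noteq> 0" "mcoeff (\<Prod>v\<in>#M. L v) B \<noteq> 0"
    by (metis mult_zero_left mult_zero_right)
  then show ?case using add.IH [of B] assms(1) by (auto simp: homogeneous_linear_def)
qed

text \<open>
  The terms of degree \<open>m\<close> of \<open>P \<circ> \<Phi>\<close> involve those of \<open>P\<close> of degree \<open>m\<close> through the linear part \<open>L\<close>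
  of \<open>\<Phi>\<close>, and otherwise only terms of \<open>P\<close> of lower degree.  So the equation is a sequence of finite
  linear systems, one for each degree; they are injective by assumption and hence solvable over the
  field itself.
\<close>

lemma solve_degree_by_degree:
  fixes \<Phi> L :: "('k::field, 'v::finite, 'v) formal_map" and e :: "'k^'n::finite^'n"
    and R :: "('k, 'v, 'n) formal_map"
  assumes \<Phi>: "formal_mapping \<Phi>" and L: "homogeneous_linear L" and agree: "\<And>v. agree_upto 1 (\<Phi> v) (L v)"
    and inj: "\<And>P :: ('k, 'v, 'n) formal_map. (\<And>i. order_ge 2 (P i)) \<Longrightarrow> P \<circ>\<^sub>f L = e \<cdot> P \<Longrightarrow> P = 0"
    and R: "\<And>i. order_ge 2 (R i)"
  obtains P where "\<And>i. order_ge 2 (P i)" "(P \<circ>\<^sub>f \<Phi>) - e \<cdot> P = R"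
proof -
  let ?L = "\<lambda>M. \<Prod>v\<in>#M. L v" and ?F = "\<lambda>M. \<Prod>v\<in>#M. \<Phi> v"
  have leading: "mcoeff (?F M) T = mcoeff (?L M) T" if "size T = size M" for M T
    using agree_prod_mset [of 0 \<Phi> L M] agree \<Phi> that by (simp add: agree_upto_def)
  \<comment> \<open>The degree \<open>m\<close> part of the equation, with the unknowns of degree \<open>m\<close> on the left.\<close>
  have system: "\<exists>x. \<forall>T i. size T = m \<longrightarrow>
      (\<Sum>M | size M = m. mcoeff (?L M) T * x (M, i)) - (\<Sum>j\<in>UNIV. e $ i $ j * x (T, j)) = r (T, i)"
    if m: "m \<ge> 2" for m and r :: "'v multiset \<times> 'n \<Rightarrow> 'k"
  proof -
    let ?I = "{M :: 'v multiset. size M = m} \<times> (UNIV :: 'n set)"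
    define c where "c = (\<lambda>(T, i) (M, j). (if i = j then mcoeff (?L M) T else 0) -
      (if M = T then e $ i $ j else 0) :: 'k)"
    have c: "(\<Sum>q\<in>?I. c (T, i) q * x q) =
        (\<Sum>M | size M = m. mcoeff (?L M) T * x (M, i)) - (\<Sum>j\<in>UNIV. e $ i $ j * x (T, j))"
      if "size T = m" for T i x
    proof -
      have "(\<Sum>q\<in>?I. c (T, i) q * x q) = (\<Sum>M | size M = m. \<Sum>j\<in>UNIV. c (T, i) (M, j) * x (M, j))"
        by (simp add: sum.cartesian_product)
      also have "\<dots> = (\<Sum>M | size M = m. \<Sum>j\<in>UNIV. if i = j then mcoeff (?L M) T * x (M, j) else 0) -
          (\<Sum>M | size M = m. \<Sum>j\<in>UNIV. if M = T then e $ i $ j * x (M, j) else 0)"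
        unfolding sum_subtractf [symmetric]
        by (intro sum.cong refl) (simp add: c_def left_diff_distrib)
      also have "(\<Sum>M | size M = m. \<Sum>j\<in>UNIV. if M = T then e $ i $ j * x (M, j) else 0) =
          (\<Sum>M | size M = m. if M = T then \<Sum>j\<in>UNIV. e $ i $ j * x (M, j) else 0)"
        by (intro sum.cong refl) simp
      also have "\<dots> = (\<Sum>j\<in>UNIV. e $ i $ j * x (T, j))" using that by simp
      finally show ?thesis by simp
    qed
    obtain x where "\<And>s. s \<in> ?I \<Longrightarrow> (\<Sum>q\<in>?I. c s q * x q) = r s"
    proof (rule injective_system_surjective [of ?I c r])
      fix x assume x: "\<And>s. s \<in> ?I \<Longrightarrow> (\<Sum>q\<in>?I. c s q * x q) = 0"
      define P where "P j = Abs_mfps (\<lambda>M. if size M = m then x (M, j) else 0)" for j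
      have P: "mcoeff (P j) M = (if size M = m then x (M, j) else 0)" for j M by (simp add: P_def)
      have "P \<circ>\<^sub>f L = e \<cdot> P"
      proof (rule ext, rule mfps_eqI)
        fix i T
        show "mcoeff ((P \<circ>\<^sub>f L) i) T = mcoeff ((e \<cdot> P) i) T"
        proof (cases "size T = m")
          case True
          have "mcoeff ((P \<circ>\<^sub>f L) i) T = (\<Sum>M | size M = m. mcoeff (?L M) T * x (M, i))"
            unfolding fm_comp_def mcoeff_subst
            by (rule sum.mono_neutral_cong_right) (auto simp: P True)
          moreover have "(\<Sum>M | size M = m. mcoeff (?L M) T * x (M, i)) = (\<Sum>j\<in>UNIV. e $ i $ j * x (T, j))"
            using x [of "(T, i)"] c [OF True, of i x] True by simp
          ultimately show ?thesis by (simp add: mcoeff_act P True)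
        next
          case False
          then have "mcoeff ((P \<circ>\<^sub>f L) i) T = 0"
            unfolding fm_comp_def mcoeff_subst
            using homogeneous_linear_prod [OF L] by (intro sum.neutral) (fastforce simp: P)
          then show ?thesis using False by (simp add: mcoeff_act P)
        qed
      qed
      moreover have "order_ge 2 (P i)" for i using m by (auto simp: order_ge_def P)
      ultimately have "P = 0" by (intro inj)
      then show "\<forall>q\<in>?I. x q = 0"
        by (auto simp: fun_eq_iff) (metis P zero_mfps.rep_eq)
    qed auto
    then show ?thesis using c by (intro exI [of _ x]) auto
  qed
  let ?Q = "\<lambda>(f :: nat \<Rightarrow> 'v multiset \<times> 'n \<Rightarrow> 'k) m x. m \<ge> 2 \<longrightarrow> (\<forall>T i. size T = m \<longrightarrow>
      (\<Sum>M | size M = m. mcoeff (?L M) T * x (M, i)) - (\<Sum>j\<in>UNIV. e $ i $ j * x (T, j)) =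
      mcoeff (R i) T - (\<Sum>M | 2 \<le> size M \<and> size M < m. f (size M) (M, i) * mcoeff (?F M) T))"
  have "\<exists>f. \<forall>m. ?Q f m (f m)"
  proof (rule dependent_wf_choice [of less_than])
    fix f g :: "nat \<Rightarrow> 'v multiset \<times> 'n \<Rightarrow> 'k" and m x
    assume "\<And>k. (k, m) \<in> less_than \<Longrightarrow> f k = g k"
    then have "(\<Sum>M | 2 \<le> size M \<and> size M < m. f (size M) (M, i) * mcoeff (?F M) T) =
        (\<Sum>M | 2 \<le> size M \<and> size M < m. g (size M) (M, i) * mcoeff (?F M) T)" for i T
      by (intro sum.cong) auto
    then show "?Q f m x = ?Q g m x" by simp
  next
    fix m and f :: "nat \<Rightarrow> 'v multiset \<times> 'n \<Rightarrow> 'k"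
    show "\<exists>x. ?Q f m x"
      using system [of m "\<lambda>(T, i). mcoeff (R i) T -
        (\<Sum>M | 2 \<le> size M \<and> size M < m. f (size M) (M, i) * mcoeff (?F M) T)"] by auto
  qed simp
  then obtain f where f: "\<And>m. ?Q f m (f m)" by blast
  define P where "P j = Abs_mfps (\<lambda>M. if size M \<ge> 2 then f (size M) (M, j) else 0)" for j
  have P: "mcoeff (P j) M = (if size M \<ge> 2 then f (size M) (M, j) else 0)" for j M by (simp add: P_def)
  have oP: "order_ge 2 (P i)" for i by (simp add: order_ge_def P)
  show ?thesis
  proof (rule that [OF oP])
    show "(P \<circ>\<^sub>f \<Phi>) - e \<cdot> P = R"
    proof (rule ext, rule mfps_eqI)
      fix i T
      show "mcoeff (((P \<circ>\<^sub>f \<Phi>) - e \<cdot> P) i) T = mcoeff (R i) T"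
      proof (cases "size T \<ge> 2")
        case True
        let ?m = "size T"
        have "mcoeff ((P \<circ>\<^sub>f \<Phi>) i) T = (\<Sum>M | 2 \<le> size M \<and> size M \<le> ?m. f (size M) (M, i) * mcoeff (?F M) T)"
          unfolding fm_comp_def mcoeff_subst by (rule sum.mono_neutral_cong_right) (auto simp: P)
        also have "{M :: 'v multiset. 2 \<le> size M \<and> size M \<le> ?m} =
            {M. 2 \<le> size M \<and> size M < ?m} \<union> {M. size M = ?m}"
          using True by auto
        also have "(\<Sum>M\<in>\<dots>. f (size M) (M, i) * mcoeff (?F M) T) =
            (\<Sum>M | 2 \<le> size M \<and> size M < ?m. f (size M) (M, i) * mcoeff (?F M) T) +
            (\<Sum>M | size M = ?m. f (size M) (M, i) * mcoeff (?F M) T)"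
          by (rule sum.union_disjoint) (auto intro: finite_subset [OF _ finite_size_less [of ?m]])
        also have "(\<Sum>M | size M = ?m. f (size M) (M, i) * mcoeff (?F M) T) =
            (\<Sum>M | size M = ?m. mcoeff (?L M) T * f ?m (M, i))"
          by (intro sum.cong refl) (auto simp: leading)
        moreover have "mcoeff ((e \<cdot> P) i) T = (\<Sum>j\<in>UNIV. e $ i $ j * f ?m (T, j))"
          using True by (simp add: mcoeff_act P)
        ultimately show ?thesis using f [of ?m] True by (simp add: algebra_simps)
      next
        case False
        moreover have "order_ge 2 ((P \<circ>\<^sub>f \<Phi>) i)"
          unfolding fm_comp_def by (rule order_ge_subst [OF oP])
        ultimately show ?thesis
          using R [of i] oP by (simp add: order_ge_def mcoeff_act)
      qed
    qed
  qed
qed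

lemma formal_mapping_of_order: "(\<And>i. order_ge 2 (P i)) \<Longrightarrow> formal_mapping P"
  by (auto simp: formal_mapping_def order_ge_def)

lemma homogeneous_linear_vars: "homogeneous_linear fm_id"
  by (auto simp: homogeneous_linear_def fm_id_def mcoeff_var split: if_splits)

lemma homogeneous_linear_act:
  assumes "homogeneous_linear L"
  shows "homogeneous_linear (e \<cdot> L)"
  unfolding homogeneous_linear_def mcoeff_act
proof (intro allI impI)
  fix i T assume "(\<Sum>j\<in>UNIV. e $ i $ j * mcoeff (L j) T) \<noteq> 0"
  then obtain j where "e $ i $ j * mcoeff (L j) T \<noteq> 0" by (meson sum.neutral)
  then have "mcoeff (L j) T \<noteq> 0" by (metis mult_zero_right)
  then show "size T = 1" using assms by (auto simp: homogeneous_linear_def)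
qed

text \<open>
  A left inverse \<open>\<theta>\<close> of \<open>\<psi>\<close> is again tangent to the identity, so it has a left inverse as well, which
  must be \<open>\<psi>\<close>.
\<close>

lemma tangent_to_identity_inverse:
  fixes \<psi> :: "('k::field, 'n::finite, 'n) formal_map"
  assumes "formal_mapping \<psi>" "\<And>i. order_ge 2 ((\<psi> - fm_id) i)"
  obtains \<theta> where "formal_mapping \<theta>" "\<psi> \<circ>\<^sub>f \<theta> = fm_id" "\<theta> \<circ>\<^sub>f \<psi> = fm_id"
proof -
  have left: "\<exists>\<theta>. formal_mapping \<theta> \<and> (\<forall>i. order_ge 2 ((\<theta> - fm_id) i)) \<and> \<theta> \<circ>\<^sub>f \<psi> = fm_id"
    if \<psi>: "formal_mapping \<psi>" "\<And>i. order_ge 2 ((\<psi> - fm_id) i)" for \<psi> :: "('k, 'n, 'n) formal_map"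
  proof -
    obtain P where P: "\<And>i. order_ge 2 (P i)" "(P \<circ>\<^sub>f \<psi>) - (0 :: 'k^'n^'n) \<cdot> P = fm_id - \<psi>"
    proof (rule solve_degree_by_degree [where e = "0 :: 'k^'n^'n" and R = "fm_id - \<psi>",
          OF \<psi>(1) homogeneous_linear_vars])
      show "agree_upto 1 (\<psi> v) (fm_id v)" for v
        using \<psi>(2) [of v] by (auto simp: agree_upto_def order_ge_def)
      show "order_ge 2 ((fm_id - \<psi>) i)" for i
        using \<psi>(2) [of i] by (auto simp: order_ge_def)
    qed auto
    have "formal_mapping (fm_id + P)"
      using formal_mapping_of_order [of P, OF P(1)] by simp
    moreover have "(fm_id + P) \<circ>\<^sub>f \<psi> = fm_id"
      using P(2) \<psi>(1) by (simp add: fm_comp_add)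
    ultimately show ?thesis using P(1) by (intro exI [of _ "fm_id + P"]) simp
  qed
  obtain \<theta> where \<theta>: "formal_mapping \<theta>" "\<And>i. order_ge 2 ((\<theta> - fm_id) i)" "\<theta> \<circ>\<^sub>f \<psi> = fm_id"
    using left [OF assms] by blast
  obtain \<omega> where \<omega>: "formal_mapping \<omega>" "\<omega> \<circ>\<^sub>f \<theta> = fm_id" using left [OF \<theta>(1,2)] by blast
  have "\<omega> = \<omega> \<circ>\<^sub>f (\<theta> \<circ>\<^sub>f \<psi>)" by (simp add: \<theta>)
  also have "\<dots> = \<omega> \<circ>\<^sub>f \<theta> \<circ>\<^sub>f \<psi>"
    using \<theta>(1) assms(1) by (simp only: fm_comp_assoc)
  also have "\<dots> = \<psi>" using \<omega> assms(1) by simp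
  finally have "\<omega> = \<psi>" .
  with \<theta> \<omega> that show ?thesis by blast
qed

section \<open>Uniqueness in the absence of resonances\<close>

lemma mcoeff_act_var_l [simp]:
  "mcoeff ((m \<cdot> var_l) i) {#Inl j#} = m $ i $ j" "mcoeff ((m \<cdot> var_l) i) {#Inr j#} = 0"
  by (simp_all add: mcoeff_act mcoeff_var if_distrib cong: if_cong)

lemma mcoeff_act_var_r [simp]:
  "mcoeff ((m \<cdot> var_r) i) {#Inr j#} = m $ i $ j" "mcoeff ((m \<cdot> var_r) i) {#Inl j#} = 0"
  by (simp_all add: mcoeff_act mcoeff_var if_distrib cong: if_cong)

lemma strictly_upper_mult:
  fixes m p :: "'k::semiring_1^'n^'n"
  shows "strictly_upper_triangular ord m \<Longrightarrow> upper_triangular ord p \<Longrightarrow> strictly_upper_triangular ord (m ** p)"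
    "upper_triangular ord p \<Longrightarrow> strictly_upper_triangular ord m \<Longrightarrow> strictly_upper_triangular ord (p ** m)"
proof -
  have "\<exists>k. m $ i $ k \<noteq> 0 \<and> p $ k $ j \<noteq> 0" if "(m ** p) $ i $ j \<noteq> 0" for m p :: "'k^'n^'n" and i j
  proof (rule ccontr)
    assume "\<not> ?thesis"
    then have "m $ i $ k * p $ k $ j = 0" for k by (metis mult_zero_left mult_zero_right)
    with that show False by (simp add: matrix_matrix_mult_def)
  qed
  then show "strictly_upper_triangular ord m \<Longrightarrow> upper_triangular ord p \<Longrightarrow> strictly_upper_triangular ord (m ** p)"
    "upper_triangular ord p \<Longrightarrow> strictly_upper_triangular ord m \<Longrightarrow> strictly_upper_triangular ord (p ** m)"
    unfolding strictly_upper_triangular_def upper_triangular_def by (meson le_less_trans less_le_trans)+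
qed

lemma strictly_upper_imp_upper: "strictly_upper_triangular ord m \<Longrightarrow> upper_triangular ord m"
  unfolding strictly_upper_triangular_def upper_triangular_def by (meson less_imp_le)

lemma not_resonant:
  assumes "resonance_free E" "\<And>v. \<kappa> v \<in> E" "l \<in> E" "size M \<ge> 2"
  shows "l \<noteq> (\<Prod>v\<in>#M. \<kappa> v)"
proof
  assume eq: "l = (\<Prod>v\<in>#M. \<kappa> v)"
  obtain vs where vs: "mset vs = M" using ex_mset by blast
  have "l = prod_list (map \<kappa> vs)" by (simp add: eq flip: vs prod_mset_prod_list)
  moreover have "length (map \<kappa> vs) \<ge> 2" using assms(4) by (simp flip: vs)
  ultimately show False
    using assms(1-3) unfolding resonance_free_def by (metis (no_types, lifting) imageE set_map subsetI)
qed

text \<open>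
  The diagonal is required to consist of eigenvalues in the sense of \<^const>\<open>eigenvalues\<close>, as this is how
  the absence of resonances enters.
\<close>

definition triangularising_coords ::
  "'k::field^'n^'n \<Rightarrow> ('n \<Rightarrow> nat) \<Rightarrow> 'k alg_closure^'n^'n \<Rightarrow> 'k alg_closure^'n^'n \<Rightarrow> bool" where
  "triangularising_coords b ord g g' \<longleftrightarrow> inj ord \<and> g ** g' = mat 1 \<and> g' ** g = mat 1 \<and>
    upper_triangular ord (g' ** mat_ac b ** g) \<and> (\<forall>i. (g' ** mat_ac b ** g) $ i $ i \<in> eigenvalues b)"

lemma triangular_family_case_sum:
  fixes p q :: "('k::comm_ring_1, 'n::finite + 'n, 'n) formal_map" and m1 m2 m3 m4 :: "'k^'n^'n"
  assumes ord: "inj ord" and formal: "formal_mapping p" "formal_mapping q"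
    and p: "\<And>i v. mcoeff (p i) {#v#} = mcoeff ((m1 \<cdot> var_l) i) {#v#} + mcoeff ((m2 \<cdot> var_r) i) {#v#}"
    and q: "\<And>i v. mcoeff (q i) {#v#} = mcoeff ((m3 \<cdot> var_l) i) {#v#} + mcoeff ((m4 \<cdot> var_r) i) {#v#}"
    and tri: "upper_triangular ord m1" "strictly_upper_triangular ord m2"
      "strictly_upper_triangular ord m3" "upper_triangular ord m4"
    and diag: "\<And>i. \<kappa> i = m1 $ i $ i" "\<And>i. \<mu> i = m4 $ i $ i"
  shows "triangular_family (case_sum ord ord) (case_sum \<kappa> \<mu>) (case_sum p q)"
proof (rule triangular_familyI)
  have o: "j = i \<or> ord i < ord j" if "ord i \<le> ord j" for i j
    using that ord by (auto simp: inj_def order_le_less)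
  fix v v' assume nz: "mcoeff (case_sum p q v) {#v'#} \<noteq> 0"
  show "v' = v \<or> case_sum ord ord v < case_sum ord ord v'"
  proof (cases v; cases v')
    fix i j assume v: "v = Inl i" "v' = Inl j"
    with nz p tri(1) have "ord i \<le> ord j" by (simp add: upper_triangular_def)
    with o [of i j] v show ?thesis by auto
  next
    fix i j assume v: "v = Inl i" "v' = Inr j"
    with nz p tri(2) show ?thesis by (simp add: strictly_upper_triangular_def)
  next
    fix i j assume v: "v = Inr i" "v' = Inl j"
    with nz q tri(3) show ?thesis by (simp add: strictly_upper_triangular_def)
  next
    fix i j assume v: "v = Inr i" "v' = Inr j"
    with nz q tri(4) have "ord i \<le> ord j" by (simp add: upper_triangular_def)
    with o [of i j] v show ?thesis by auto
  qed
next
  fix v show "mcoeff (case_sum p q v) {#v#} = case_sum \<kappa> \<mu> v"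
    by (cases v) (simp_all add: p q diag)
qed (use formal in simp)

text \<open>
  The equation is the one that the braid relation imposes on the deviation \<open>D\<close> of a solution from a
  linear one.  Over the algebraic closure and in suitable coordinates all of its data are triangular.
\<close>

lemma no_resonance_uniqueness:
  fixes D u w h :: "('k::field, 'n::finite + 'n, 'n) formal_map" and b d e f :: "'k^'n^'n"
  assumes flag: "triangularising_coords b ord g g'" and res: "resonance_free (eigenvalues b)"
    and strict: "strictly_upper_triangular ord (g' ** mat_ac d ** g)"
      "strictly_upper_triangular ord (g' ** mat_ac e ** g)" "strictly_upper_triangular ord (g' ** mat_ac f ** g)"
    and formal: "formal_mapping u" "formal_mapping w" "formal_mapping h"
    and u: "\<And>i. order_ge 2 ((u - b \<cdot> var_l) i)"
    and w: "\<And>i. order_ge 2 ((w - (f \<cdot> var_l + b \<cdot> var_r)) i)"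
    and h: "\<And>i. order_ge 2 ((h - d \<cdot> var_l) i)"
    and D: "\<And>i. order_ge 2 (D i)" "D \<circ>\<^sub>f case_sum 0 (var_r :: ('k, 'n + 'n, 'n) formal_map) = 0"
    and eq: "b \<cdot> D = (D \<circ>\<^sub>f case_sum u w) + b \<cdot> (D \<circ>\<^sub>f case_sum h var_r) - e \<cdot> (D \<circ>\<^sub>f case_sum u h)"
  shows "D = 0"
proof -
  have ord: "inj ord" and gg': "g ** g' = mat 1" "g' ** g = mat 1"
    and b: "upper_triangular ord (g' ** mat_ac b ** g)"
    and ev: "\<And>i. (g' ** mat_ac b ** g) $ i $ i \<in> eigenvalues b"
    using flag by (auto simp: triangularising_coords_def)
  let ?t = "change_coords g g'" and ?c = "\<lambda>m. g' ** mat_ac m ** g"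
  note cc = change_coords_comp [OF gg'] change_coords_act [OF gg'] change_coords_add [OF gg']
    change_coords_diff [OF gg'] change_coords_0 [OF gg'] change_coords_vars [OF gg']
    formal_change_coords [OF gg']
  have lin: "mcoeff (?t F i) {#v#} = mcoeff (?t F' i) {#v#}" if "\<And>i. order_ge 2 ((F - F') i)" for F F' i v
    using order_ge_change_coords [OF gg', where F = "F - F'" and i = i, OF that] by (simp add: cc order_ge_def)
  have tu: "mcoeff (?t u i) {#v#} = mcoeff ((?c b \<cdot> var_l) i) {#v#}" for i v
    using lin [OF u] by (simp add: cc)
  have th: "mcoeff (?t h i) {#v#} = mcoeff ((?c d \<cdot> var_l) i) {#v#}" for i v
    using lin [OF h] by (simp add: cc)
  have tw: "mcoeff (?t w i) {#v#} = mcoeff ((?c f \<cdot> var_l) i) {#v#} + mcoeff ((?c b \<cdot> var_r) i) {#v#}" for i v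
    using lin [OF w] by (simp add: cc)
  have "?t D = 0"
  proof (rule triangular_uniqueness [of ord "?c b" "?t u" "?t w" "?t h" "?c e"])
    have diag0: "m $ i $ i = 0" if "strictly_upper_triangular ord m" for m :: "'k alg_closure^'n^'n" and i
      using that by (auto simp: strictly_upper_triangular_def)
    have zero: "strictly_upper_triangular ord (0 :: 'k alg_closure^'n^'n)"
      by (simp add: strictly_upper_triangular_def)
    have one: "upper_triangular ord (mat 1 :: 'k alg_closure^'n^'n)"
      by (simp add: upper_triangular_def mat_def)
    note zero' = strictly_upper_imp_upper [OF zero]
    show "triangular_family (case_sum ord ord) (case_sum (\<lambda>i. ?c b $ i $ i) (\<lambda>i. ?c b $ i $ i)) (case_sum (?t u) (?t w))"
      by (rule triangular_family_case_sum [OF ord _ _ _ _ b zero strict(3) b])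
        (simp_all add: cc formal tu tw)
    show "triangular_family (case_sum ord ord) (case_sum (\<lambda>_. 0) (\<lambda>_. 1)) (case_sum (?t h) var_r)"
      by (rule triangular_family_case_sum [OF ord _ _ _ _ strictly_upper_imp_upper [OF strict(1)] zero zero one])
        (simp_all add: cc formal th diag0 strict, simp add: mat_def)
    show "triangular_family (case_sum ord ord) (case_sum (\<lambda>i. ?c b $ i $ i) (\<lambda>_. 0)) (case_sum (?t u) (?t h))"
      by (rule triangular_family_case_sum [OF ord _ _ _ _ b zero strict(1) zero'])
        (simp_all add: cc formal tu th)
    show "?c b $ i $ i \<noteq> (\<Prod>v\<in>#M. case_sum (\<lambda>i. ?c b $ i $ i) (\<lambda>i. ?c b $ i $ i) v)" if "size M \<ge> 2" for i and M :: "('n + 'n) multiset"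
      by (rule not_resonant [OF res _ ev that]) (auto simp: ev split: sum.splits)
    show "order_ge 2 (?t D i)" for i by (rule order_ge_change_coords [OF gg' D(1)])
    have zD: "?t D \<circ>\<^sub>f case_sum 0 (var_r :: ('k alg_closure, 'n + 'n, 'n) formal_map) = 0"
      using arg_cong [OF D(2), of ?t] by (simp add: cc)
    show "\<exists>j. Inl j \<in># T" if "mcoeff (?t D i) T \<noteq> 0" for i T
      using mcoeff_zero_left [OF zD, of T i] that by auto
    show "?c b \<cdot> ?t D = (?t D \<circ>\<^sub>f case_sum (?t u) (?t w)) + ?c b \<cdot> (?t D \<circ>\<^sub>f case_sum (?t h) var_r) -
        ?c e \<cdot> (?t D \<circ>\<^sub>f case_sum (?t u) (?t h))"
      using arg_cong [OF eq, of ?t] formal by (simp add: cc)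
  qed (use ord b strict in auto)
  then show ?thesis by (rule change_coords_eq_0 [OF gg'])
qed

section \<open>Linearisation of a single map\<close>

lemma vars_comp_case_sum:
  assumes "formal_mapping u" "formal_mapping w"
  shows "var_l \<circ>\<^sub>f case_sum u w = u" "var_r \<circ>\<^sub>f case_sum u w = w"
  using assms by simp_all

text \<open>
  Poincare's theorem on normal forms.  With \<open>\<psi> = id + P\<close> the equation becomes linear in \<open>P\<close>, and by
  the previous section the homogeneous equation \<open>P \<circ> b = b P\<close> has no nonzero solution of
  order at least two: a series
  \<open>P(x)\<close> is regarded as a series in \<open>x\<close> and \<open>y\<close>, and \<open>d\<close>, \<open>e\<close>, \<open>f\<close> are taken to be zero.
\<close>

lemma poincare_linearisation:
  fixes \<Phi> :: "('k::field, 'n::finite, 'n) formal_map" and b :: "'k^'n^'n"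
  assumes flag: "triangularising_coords b ord g g'" and res: "resonance_free (eigenvalues b)"
    and \<Phi>: "formal_mapping \<Phi>" "\<And>i. order_ge 2 ((\<Phi> - b \<cdot> fm_id) i)"
  obtains \<psi> where "formal_mapping \<psi>" "\<And>i. order_ge 2 ((\<psi> - fm_id) i)" "\<psi> \<circ>\<^sub>f \<Phi> = b \<cdot> \<psi>"
proof -
  obtain P where P: "\<And>i. order_ge 2 (P i)" "(P \<circ>\<^sub>f \<Phi>) - b \<cdot> P = b \<cdot> fm_id - \<Phi>"
  proof (rule solve_degree_by_degree [where e = b and R = "b \<cdot> fm_id - \<Phi>",
        OF \<Phi>(1) homogeneous_linear_act [OF homogeneous_linear_vars]])
    show "agree_upto 1 (\<Phi> v) ((b \<cdot> fm_id) v)" for v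
      using \<Phi>(2) [of v] by (auto simp: agree_upto_def order_ge_def)
    show "order_ge 2 ((b \<cdot> fm_id - \<Phi>) i)" for i
      using \<Phi>(2) [of i] by (auto simp: order_ge_def)
  next
    fix P :: "('k, 'n, 'n) formal_map"
    assume P: "\<And>i. order_ge 2 (P i)" "P \<circ>\<^sub>f b \<cdot> fm_id = b \<cdot> P"
    have fP: "formal_mapping P" using P(1) by (auto simp: formal_mapping_def order_ge_def)
    let ?X = "var_l :: ('k, 'n + 'n, 'n) formal_map" and ?Y = "var_r :: ('k, 'n + 'n, 'n) formal_map"
    have "P \<circ>\<^sub>f ?X = 0"
    proof (rule no_resonance_uniqueness [OF flag res, where d = 0 and e = 0 and f = 0 and h = 0
          and u = "b \<cdot> ?X" and w = "b \<cdot> ?Y"])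
      show "order_ge 2 ((P \<circ>\<^sub>f ?X) i)" for i
        unfolding fm_comp_def by (rule order_ge_subst) (rule P)
      have "b \<cdot> (P \<circ>\<^sub>f ?X) = P \<circ>\<^sub>f b \<cdot> ?X"
        using arg_cong [OF P(2), of "\<lambda>F. F \<circ>\<^sub>f ?X"] by (simp add: fm_comp_assoc act_comp del: vars_comp)
      then show "b \<cdot> (P \<circ>\<^sub>f ?X) = (P \<circ>\<^sub>f ?X \<circ>\<^sub>f case_sum (b \<cdot> ?X) (b \<cdot> ?Y)) +
          b \<cdot> (P \<circ>\<^sub>f ?X \<circ>\<^sub>f case_sum 0 ?Y) - 0 \<cdot> (P \<circ>\<^sub>f ?X \<circ>\<^sub>f case_sum (b \<cdot> ?X) 0)"
        using fP by (simp add: fm_comp_assoc vars_comp_case_sum del: vars_comp)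
      show "P \<circ>\<^sub>f ?X \<circ>\<^sub>f case_sum 0 ?Y = 0"
        using fP by (simp add: fm_comp_assoc vars_comp_case_sum del: vars_comp)
    qed (auto simp: mat_ac_simps strictly_upper_triangular_def order_ge_def)
    then have "P \<circ>\<^sub>f ?X \<circ>\<^sub>f case_sum fm_id (0 :: ('k, 'n, 'n) formal_map) = 0" by simp
    then show "P = 0" by (simp add: fm_comp_assoc vars_comp_case_sum del: vars_comp)
  qed auto
  show ?thesis
  proof (rule that [of "fm_id + P"])
    show "formal_mapping (fm_id + P)"
      using formal_mapping_of_order [of P, OF P(1)] by simp
    show "(fm_id + P) \<circ>\<^sub>f \<Phi> = b \<cdot> (fm_id + P)"
      using P(2) \<Phi>(1) by (simp add: fm_comp_add act_add algebra_simps)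
    show "order_ge 2 ((fm_id + P - fm_id) i)" for i using P(1) by simp
  qed
qed

section \<open>Linearisation of a solution\<close>

lemma linear_R_eq:
  "linear_R a b c d = case_sum (c \<cdot> var_l + d \<cdot> var_r) (a \<cdot> var_l + b \<cdot> var_r)"
  by (simp add: linear_R_def matrix_act_def plus_fun_def)

lemma triangularising_coords_exist:
  fixes a b b' :: "'k::field^'n^'n"
  assumes char: "CHAR('k) = 0 \<or> CARD('n) < CHAR('k)"
    and rel: "b' ** a = a ** b' + a ** b' ** a" and inv: "b ** b' = mat 1"
  obtains ord g g' where "triangularising_coords b ord g g'"
    "strictly_upper_triangular ord (g' ** mat_ac a ** g)" "upper_triangular ord (g' ** mat_ac b' ** g)"
proof -
  obtain g g' :: "'k alg_closure^'n^'n" and ord where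
    *: "inj ord" "g' ** g = mat 1" "g ** g' = mat 1"
    "strictly_upper_triangular ord (g' ** mat_ac a ** g)"
    "upper_triangular ord (g' ** mat_ac b ** g)" "upper_triangular ord (g' ** mat_ac b' ** g)"
    "\<And>i. \<exists>x. x \<noteq> 0 \<and> mat_ac b *v x = ((g' ** mat_ac b ** g) $ i $ i) *s x"
  proof (rule simultaneous_triangular [of "mat_ac b'" "mat_ac a" "mat_ac b"])
    show "CHAR('k alg_closure) = 0 \<or> CARD('n) < CHAR('k alg_closure)" using char by simp
    show "mat_ac b' ** mat_ac a = mat_ac a ** mat_ac b' + mat_ac a ** mat_ac b' ** mat_ac a"
      using arg_cong [OF rel, of mat_ac] by (simp add: mat_ac_simps)
    show "mat_ac b ** mat_ac b' = mat 1"
      using arg_cong [OF inv, of mat_ac] by (simp add: mat_ac_simps)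
  qed blast
  have "(g' ** mat_ac b ** g) $ i $ i \<in> eigenvalues b" for i
    using *(7) [of i] by (auto simp: eigenvalues_def mat_ac_def)
  with * show ?thesis by (intro that [of ord g g']) (auto simp: triangularising_coords_def)
qed

lemma order_ge_2I:
  assumes "formal_mapping F" "formal_mapping F'" "\<And>i T. size T = 1 \<Longrightarrow> mcoeff (F i) T = mcoeff (F' i) T"
  shows "order_ge 2 ((F - F') i)"
  unfolding order_ge_def
proof (intro allI impI)
  fix T :: "'c multiset" assume "size T < 2"
  then have "T = {#} \<or> size T = 1" by (cases "T = {#}") (auto simp: less_2_cases_iff)
  then show "mcoeff ((F - F') i) T = 0" using assms by (auto simp: formal_mapping_def)
qed

locale symmetric_solution =
  fixes G H :: "('k::field, 'n::finite + 'n, 'n) formal_map" and a b c d :: "'k^'n^'n"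
  assumes sol: "universal_solution (case_sum G H)"
    and G_coeffs: "\<And>i j. mcoeff (G i) {#Inl j#} = a $ i $ j" "\<And>i j. mcoeff (G i) {#Inr j#} = b $ i $ j"
    and H_coeffs: "\<And>i j. mcoeff (H i) {#Inl j#} = c $ i $ j" "\<And>i j. mcoeff (H i) {#Inr j#} = d $ i $ j"
begin

lemma formal [simp]: "formal_mapping G" "formal_mapping H"
  using sol by (auto simp: universal_solution_def)

lemmas involutive = universal_involutive [OF sol]
lemmas braided = universal_braided [OF sol]
lemmas G_linear = mcoeff_comp_linear [OF formal(1) G_coeffs]
lemmas H_linear = mcoeff_comp_linear [OF formal(2) H_coeffs]

abbreviation x_var :: "('k, 'n + 'n, 'n) formal_map" where "x_var \<equiv> var_l"
abbreviation y_var :: "('k, 'n + 'n, 'n) formal_map" where "y_var \<equiv> var_r"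

text \<open>The arguments that occur in the braid relation at \<open>(0, x, y)\<close> and in involutivity at \<open>(0, x)\<close>.\<close>

definition u where "u = G \<circ>\<^sub>f case_sum 0 x_var"
definition h where "h = H \<circ>\<^sub>f case_sum 0 x_var"
definition w where "w = G \<circ>\<^sub>f case_sum h y_var"

lemma formal_uhw [simp]: "formal_mapping u" "formal_mapping h" "formal_mapping w"
  by (simp_all add: u_def h_def w_def)

lemma var_comp [simp]: "G \<circ>\<^sub>f case_sum x_var y_var = G" "H \<circ>\<^sub>f case_sum x_var y_var = H"
proof -
  have "case_sum x_var y_var = fm_id" by (auto simp: fm_id_def fun_eq_iff split: sum.splits)
  then show "G \<circ>\<^sub>f case_sum x_var y_var = G" "H \<circ>\<^sub>f case_sum x_var y_var = H" by simp_all
qed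

text \<open>
  The first component of the braid relation at the point \<open>(0, x, y)\<close>.
\<close>

lemma braided_uhw: "G \<circ>\<^sub>f case_sum u w = G \<circ>\<^sub>f case_sum 0 G"
  using braided [of 0 x_var y_var] by (simp add: u_def h_def w_def)

lemma involutive_uh: "G \<circ>\<^sub>f case_sum u h = 0"
  using involutive [of 0 x_var] by (simp add: u_def h_def)

lemma act_cong_linear:
  "(\<And>j. mcoeff (F j) T = mcoeff (F' j) T) \<Longrightarrow> mcoeff ((e \<cdot> F) i) T = mcoeff ((e \<cdot> F') i) T"
  by (simp add: mcoeff_act)

lemma linear_parts:
  assumes "size T = 1"
  shows "mcoeff (G i) T = mcoeff ((a \<cdot> x_var + b \<cdot> y_var) i) T" "mcoeff (H i) T = mcoeff ((c \<cdot> x_var + d \<cdot> y_var) i) T"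
    "mcoeff (u i) T = mcoeff ((b \<cdot> x_var) i) T" "mcoeff (h i) T = mcoeff ((d \<cdot> x_var) i) T"
    "mcoeff (w i) T = mcoeff (((a ** d) \<cdot> x_var + b \<cdot> y_var) i) T"
proof -
  show "mcoeff (G i) T = mcoeff ((a \<cdot> x_var + b \<cdot> y_var) i) T" using G_linear [OF assms, of x_var y_var i] by simp
  show "mcoeff (H i) T = mcoeff ((c \<cdot> x_var + d \<cdot> y_var) i) T" using H_linear [OF assms, of x_var y_var i] by simp
  show "mcoeff (u i) T = mcoeff ((b \<cdot> x_var) i) T" using G_linear [OF assms, of 0 x_var i] by (simp add: u_def)
  have h: "mcoeff (h i) T = mcoeff ((d \<cdot> x_var) i) T" for i
    using H_linear [OF assms, of 0 x_var i] by (simp add: h_def)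
  show "mcoeff (h i) T = mcoeff ((d \<cdot> x_var) i) T" by (rule h)
  have "mcoeff ((a \<cdot> h) i) T = mcoeff (((a ** d) \<cdot> x_var) i) T"
    unfolding act_act [symmetric] by (rule act_cong_linear) (rule h)
  then show "mcoeff (w i) T = mcoeff (((a ** d) \<cdot> x_var + b \<cdot> y_var) i) T"
    using G_linear [OF assms, of h y_var i] by (simp add: w_def)
qed

text \<open>
  These are the linear terms of the braid relation at \<open>(0, x, y)\<close>, of involutivity at \<open>(0, x)\<close> and of
  involutivity at \<open>(x, y)\<close>.
\<close>

lemma linear_relations:
  shows "b ** a = a ** b + b ** a ** d" "a ** b + b ** d = 0" "a ** a + b ** c = mat 1"
proof -
  have "(a ** b + b ** (a ** d)) $ i $ j = (b ** a) $ i $ j" for i j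
  proof -
    let ?T = "{#Inl j#} :: ('n + 'n) multiset"
    have T: "size ?T = 1" by simp
    have "mcoeff ((a \<cdot> u + b \<cdot> w) i) ?T = mcoeff ((a \<cdot> 0 + b \<cdot> G) i) ?T"
      using G_linear [OF T, of u w i] G_linear [OF T, of 0 G i] unfolding braided_uhw by simp
    moreover have "mcoeff ((a \<cdot> u) i) ?T = mcoeff ((a \<cdot> b \<cdot> x_var) i) ?T"
      by (rule act_cong_linear) (rule linear_parts [OF T])
    moreover have "mcoeff ((b \<cdot> w) i) ?T = mcoeff ((b \<cdot> ((a ** d) \<cdot> x_var + b \<cdot> y_var)) i) ?T"
      by (rule act_cong_linear) (rule linear_parts [OF T])
    moreover have "mcoeff ((b \<cdot> G) i) ?T = mcoeff ((b \<cdot> (a \<cdot> x_var + b \<cdot> y_var)) i) ?T"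
      by (rule act_cong_linear) (rule linear_parts [OF T])
    ultimately show ?thesis by (simp add: act_add act_act)
  qed
  then show "b ** a = a ** b + b ** a ** d" by (simp add: vec_eq_iff matrix_mul_assoc)
  have "(a ** b + b ** d) $ i $ j = 0" for i j
  proof -
    let ?T = "{#Inl j#} :: ('n + 'n) multiset"
    have T: "size ?T = 1" by simp
    have "mcoeff ((a \<cdot> u + b \<cdot> h) i) ?T = 0"
      using G_linear [OF T, of u h i] unfolding involutive_uh by simp
    moreover have "mcoeff ((a \<cdot> u) i) ?T = mcoeff ((a \<cdot> b \<cdot> x_var) i) ?T"
      by (rule act_cong_linear) (rule linear_parts [OF T])
    moreover have "mcoeff ((b \<cdot> h) i) ?T = mcoeff ((b \<cdot> d \<cdot> x_var) i) ?T"
      by (rule act_cong_linear) (rule linear_parts [OF T])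
    ultimately show ?thesis by (simp add: act_act)
  qed
  then show "a ** b + b ** d = 0" by (simp add: vec_eq_iff)
  have "(a ** a + b ** c) $ i $ j = (mat 1 :: 'k^'n^'n) $ i $ j" for i j
  proof -
    let ?T = "{#Inl j#} :: ('n + 'n) multiset"
    have T: "size ?T = 1" by simp
    have "mcoeff ((a \<cdot> G + b \<cdot> H) i) ?T = mcoeff ((mat 1 \<cdot> x_var) i) ?T"
      using G_linear [OF T, of G H i] involutive [of x_var y_var] by simp
    moreover have "mcoeff ((a \<cdot> G) i) ?T = mcoeff ((a \<cdot> (a \<cdot> x_var + b \<cdot> y_var)) i) ?T"
      by (rule act_cong_linear) (rule linear_parts [OF T])
    moreover have "mcoeff ((b \<cdot> H) i) ?T = mcoeff ((b \<cdot> (c \<cdot> x_var + d \<cdot> y_var)) i) ?T"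
      by (rule act_cong_linear) (rule linear_parts [OF T])
    ultimately show ?thesis by (simp add: act_add act_act del: one_act)
  qed
  then show "a ** a + b ** c = mat 1" by (simp add: vec_eq_iff)
qed

text \<open>
  The map \<open>\<psi>\<close> is chosen to linearise \<open>x \<mapsto> G(0, x)\<close> only.  The deviation \<open>D\<close> of \<open>\<psi> G\<close> from
  \<open>a \<psi>(x) + b \<psi>(y)\<close> then vanishes for \<open>x = 0\<close>, and the braid relation at \<open>(0, x, y)\<close> becomes a functional
  equation that is linear in \<open>D\<close>, to which the uniqueness lemma applies.  Once \<open>G\<close> is linear, involutivity
  determines \<open>H\<close>.
\<close>

lemma linearisation_exists:
  assumes char: "CHAR('k) = 0 \<or> CARD('n) < CHAR('k)" and res: "resonance_free (eigenvalues b)"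
  obtains \<psi> where "formal_mapping \<psi>" "\<And>i. order_ge 2 ((\<psi> - fm_id) i)"
    "\<psi> \<circ>\<^sub>f G = a \<cdot> (\<psi> \<circ>\<^sub>f x_var) + b \<cdot> (\<psi> \<circ>\<^sub>f y_var)" "\<psi> \<circ>\<^sub>f H = c \<cdot> (\<psi> \<circ>\<^sub>f x_var) + d \<cdot> (\<psi> \<circ>\<^sub>f y_var)"
proof -
  obtain b' where b': "b ** b' = mat 1" "b' ** b = mat 1"
    using universal_invertible [OF sol G_coeffs(2)] by blast
  have cancel: "m ** b ** b' = m" "m ** b' ** b = m" for m :: "'k^'n^'n"
    using b' by (metis matrix_mul_assoc matrix_mul_rid)+
  have bd: "b ** d = - (a ** b)" using linear_relations(2) by (simp add: eq_neg_iff_add_eq_0 add.commute)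
  have neg: "m ** - p = - (m ** p)" for m p :: "'k^'n^'n"
    by (simp add: vec_eq_iff matrix_matrix_mult_def sum_negf)
  have "d = b' ** (b ** d)" using b' by (simp add: matrix_mul_assoc)
  then have d: "d = - (b' ** a ** b)" by (simp add: bd neg matrix_mul_assoc)
  have rel1: "b ** a = a ** b - b ** a ** b' ** a ** b"
    using linear_relations(1) by (simp add: d neg matrix_mul_assoc)
  have rel1': "b ** a + b ** a ** b' ** a ** b = a ** b"
    using rel1 by (metis diff_add_cancel)
  have rdistrib: "(m + p) ** q = m ** q + p ** q" for m p q :: "'k^'n^'n"
    by (simp add: vec_eq_iff matrix_matrix_mult_def distrib_right sum.distrib)
  have rel: "b' ** a = a ** b' + a ** b' ** a"
  proof -
    have "b' ** (b ** a + b ** a ** b' ** a ** b) ** b' = b' ** (a ** b) ** b'"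
      unfolding rel1' ..
    then show ?thesis
      by (simp add: matrix_add_ldistrib rdistrib matrix_mul_assoc b' cancel)
  qed
  obtain ord g g' where flag: "triangularising_coords b ord g g'"
    and sa: "strictly_upper_triangular ord (g' ** mat_ac a ** g)"
    and ub': "upper_triangular ord (g' ** mat_ac b' ** g)"
    by (rule triangularising_coords_exist [OF char rel b'(1)])
  have ub: "upper_triangular ord (g' ** mat_ac b ** g)" and gg': "g ** g' = mat 1"
    using flag by (auto simp: triangularising_coords_def)
  have conj: "g' ** mat_ac (m ** p) ** g = (g' ** mat_ac m ** g) ** (g' ** mat_ac p ** g)" for m p
    using gg' by (metis mat_ac_simps(1) matrix_mul_assoc matrix_mul_rid)
  have "strictly_upper_triangular ord (g' ** mat_ac (b' ** a ** b) ** g)"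
    unfolding conj by (intro strictly_upper_mult ub ub' sa)
  moreover have "g' ** mat_ac d ** g = - (g' ** mat_ac (b' ** a ** b) ** g)"
    by (simp add: d vec_eq_iff matrix_matrix_mult_def mat_ac_def sum_negf)
  ultimately have sd: "strictly_upper_triangular ord (g' ** mat_ac d ** g)"
    by (simp add: strictly_upper_triangular_def)
  have se: "strictly_upper_triangular ord (g' ** mat_ac (b ** a ** b') ** g)"
    unfolding conj by (intro strictly_upper_mult ub ub' sa)
  have sf: "strictly_upper_triangular ord (g' ** mat_ac (a ** d) ** g)"
    unfolding conj by (intro strictly_upper_mult(1) sa strictly_upper_imp_upper sd)

  let ?\<Phi> = "G \<circ>\<^sub>f case_sum 0 (fm_id :: ('k, 'n, 'n) formal_map)"
  obtain \<psi> where \<psi>: "formal_mapping \<psi>" "\<And>i. order_ge 2 ((\<psi> - fm_id) i)" "\<psi> \<circ>\<^sub>f ?\<Phi> = b \<cdot> \<psi>"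
  proof (rule poincare_linearisation [OF flag res])
    show "order_ge 2 ((?\<Phi> - b \<cdot> fm_id) i)" for i
      by (rule order_ge_2I) (simp_all add: G_linear)
  qed auto
  have \<psi>0: "\<psi> \<circ>\<^sub>f (G \<circ>\<^sub>f case_sum 0 x) = b \<cdot> (\<psi> \<circ>\<^sub>f x)" if x: "formal_mapping x" for x :: "('k, 'n + 'n, 'n) formal_map"
  proof -
    have "\<psi> \<circ>\<^sub>f (G \<circ>\<^sub>f case_sum 0 x) = \<psi> \<circ>\<^sub>f ?\<Phi> \<circ>\<^sub>f x"
      using x \<psi>(1) by (simp add: fm_comp_assoc case_sum_comp)
    then show ?thesis by (simp add: \<psi>(3) act_comp)
  qed
  define D where "D = (\<psi> \<circ>\<^sub>f G) - (a \<cdot> (\<psi> \<circ>\<^sub>f x_var) + b \<cdot> (\<psi> \<circ>\<^sub>f y_var))"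
  have D_at: "D \<circ>\<^sub>f case_sum x y = (\<psi> \<circ>\<^sub>f (G \<circ>\<^sub>f case_sum x y)) - (a \<cdot> (\<psi> \<circ>\<^sub>f x) + b \<cdot> (\<psi> \<circ>\<^sub>f y))"
    if "formal_mapping x" "formal_mapping y" for x y :: "('k, 'n + 'n, 'n) formal_map"
    using that unfolding D_def
    by (simp add: fm_comp_diff fm_comp_add act_comp fm_comp_assoc vars_comp_case_sum del: vars_comp)
  have "D = 0"
  proof (rule no_resonance_uniqueness [OF flag res sd se sf formal_uhw(1,3,2)])
    show "order_ge 2 ((u - b \<cdot> x_var) i)" "order_ge 2 ((h - d \<cdot> x_var) i)"
      "order_ge 2 ((w - ((a ** d) \<cdot> x_var + b \<cdot> y_var)) i)" for i
      by (rule order_ge_2I; simp add: linear_parts)+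
    show "order_ge 2 (D i)" for i
    proof -
      let ?P = "\<psi> - fm_id"
      have P: "order_ge 2 ((?P \<circ>\<^sub>f x) i)" for x :: "('k, 'n + 'n, 'n) formal_map" and i
        unfolding fm_comp_def by (rule order_ge_subst) (rule \<psi>)
      have PG: "\<psi> \<circ>\<^sub>f x = x + (?P \<circ>\<^sub>f x)" if "formal_mapping x" for x :: "('k, 'n + 'n, 'n) formal_map"
        using that by (simp add: fm_comp_diff)
      have "D = (G - (a \<cdot> x_var + b \<cdot> y_var)) + ((?P \<circ>\<^sub>f G) - (a \<cdot> (?P \<circ>\<^sub>f x_var) + b \<cdot> (?P \<circ>\<^sub>f y_var)))"
        unfolding D_def by (subst (1 2 3) PG) (simp_all add: act_add algebra_simps)
      moreover have "order_ge 2 ((G - (a \<cdot> x_var + b \<cdot> y_var)) i)"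
        by (rule order_ge_2I) (simp_all add: linear_parts)
      ultimately show ?thesis using P by (simp add: order_ge_def mcoeff_act)
    qed
    show "D \<circ>\<^sub>f case_sum 0 y_var = 0"
      using \<psi>(1) by (simp add: D_at \<psi>0)
    have Duw: "(D \<circ>\<^sub>f case_sum u w) + (a \<cdot> (\<psi> \<circ>\<^sub>f u) + b \<cdot> (\<psi> \<circ>\<^sub>f w)) = b \<cdot> (\<psi> \<circ>\<^sub>f G)"
      by (simp add: D_at braided_uhw \<psi>0)
    have Dhy: "(D \<circ>\<^sub>f case_sum h y_var) + (a \<cdot> (\<psi> \<circ>\<^sub>f h) + b \<cdot> (\<psi> \<circ>\<^sub>f y_var)) = \<psi> \<circ>\<^sub>f w"
      by (simp add: D_at w_def)
    have Duh: "(D \<circ>\<^sub>f case_sum u h) + (a \<cdot> (\<psi> \<circ>\<^sub>f u) + b \<cdot> (\<psi> \<circ>\<^sub>f h)) = 0"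
      using \<psi>(1) by (simp add: D_at involutive_uh)
    have \<psi>u: "\<psi> \<circ>\<^sub>f u = b \<cdot> (\<psi> \<circ>\<^sub>f x_var)" by (simp add: u_def \<psi>0)
    have DG: "\<psi> \<circ>\<^sub>f G = D + (a \<cdot> (\<psi> \<circ>\<^sub>f x_var) + b \<cdot> (\<psi> \<circ>\<^sub>f y_var))" by (simp add: D_def)
    \<comment> \<open>The unknown \<open>\<psi> h\<close> is eliminated by means of involutivity.\<close>
    have "(b ** a ** b') \<cdot> ((D \<circ>\<^sub>f case_sum u h) + (a \<cdot> (\<psi> \<circ>\<^sub>f u) + b \<cdot> (\<psi> \<circ>\<^sub>f h))) = 0"
      by (simp add: Duh)
    then have e1: "(b ** a) \<cdot> (\<psi> \<circ>\<^sub>f h) =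
        - ((b ** a ** b') \<cdot> (D \<circ>\<^sub>f case_sum u h)) - (b ** a ** b' ** a ** b) \<cdot> (\<psi> \<circ>\<^sub>f x_var)"
      by (simp add: act_add act_act \<psi>u cancel matrix_mul_assoc) (simp add: algebra_simps eq_neg_iff_add_eq_0)
    have rel2: "(b ** a) \<cdot> (\<psi> \<circ>\<^sub>f x_var) + (b ** a ** b' ** a ** b) \<cdot> (\<psi> \<circ>\<^sub>f x_var) = (a ** b) \<cdot> (\<psi> \<circ>\<^sub>f x_var)"
      unfolding add_act [symmetric] rel1' ..
    have "b \<cdot> D + ((b ** a) \<cdot> (\<psi> \<circ>\<^sub>f x_var) + (b ** b) \<cdot> (\<psi> \<circ>\<^sub>f y_var)) =
        (D \<circ>\<^sub>f case_sum u w) + ((a ** b) \<cdot> (\<psi> \<circ>\<^sub>f x_var) + (b \<cdot> (D \<circ>\<^sub>f case_sum h y_var) +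
          ((b ** a) \<cdot> (\<psi> \<circ>\<^sub>f h) + (b ** b) \<cdot> (\<psi> \<circ>\<^sub>f y_var))))"
      using Duw unfolding Dhy [symmetric] DG \<psi>u act_add act_act by simp
    then show "b \<cdot> D = (D \<circ>\<^sub>f case_sum u w) + b \<cdot> (D \<circ>\<^sub>f case_sum h y_var) -
        (b ** a ** b') \<cdot> (D \<circ>\<^sub>f case_sum u h)"
      unfolding e1 rel2 [symmetric] by (simp add: algebra_simps)
  qed
  then have \<psi>G: "\<psi> \<circ>\<^sub>f G = a \<cdot> (\<psi> \<circ>\<^sub>f x_var) + b \<cdot> (\<psi> \<circ>\<^sub>f y_var)" by (simp add: D_def)
  have "\<psi> \<circ>\<^sub>f (G \<circ>\<^sub>f case_sum G H) = a \<cdot> (\<psi> \<circ>\<^sub>f G) + b \<cdot> (\<psi> \<circ>\<^sub>f H)"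
    using D_at [of G H] \<open>D = 0\<close> by simp
  moreover have "G \<circ>\<^sub>f case_sum G H = x_var" using involutive [of x_var y_var] by simp
  ultimately have e: "\<psi> \<circ>\<^sub>f x_var = a \<cdot> (a \<cdot> (\<psi> \<circ>\<^sub>f x_var) + b \<cdot> (\<psi> \<circ>\<^sub>f y_var)) + b \<cdot> (\<psi> \<circ>\<^sub>f H)"
    by (simp only: \<psi>G)
  have "b \<cdot> (\<psi> \<circ>\<^sub>f H) = b \<cdot> (c \<cdot> (\<psi> \<circ>\<^sub>f x_var) + d \<cdot> (\<psi> \<circ>\<^sub>f y_var))"
  proof -
    have 1: "(a ** a) \<cdot> (\<psi> \<circ>\<^sub>f x_var) + (b ** c) \<cdot> (\<psi> \<circ>\<^sub>f x_var) = \<psi> \<circ>\<^sub>f x_var"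
      unfolding add_act [symmetric] linear_relations by simp
    have 2: "(a ** b) \<cdot> (\<psi> \<circ>\<^sub>f y_var) + (b ** d) \<cdot> (\<psi> \<circ>\<^sub>f y_var) = 0"
      unfolding add_act [symmetric] linear_relations by simp
    from e have "(a ** a) \<cdot> (\<psi> \<circ>\<^sub>f x_var) + (a ** b) \<cdot> (\<psi> \<circ>\<^sub>f y_var) + b \<cdot> (\<psi> \<circ>\<^sub>f H) =
        ((a ** a) \<cdot> (\<psi> \<circ>\<^sub>f x_var) + (b ** c) \<cdot> (\<psi> \<circ>\<^sub>f x_var)) + ((a ** b) \<cdot> (\<psi> \<circ>\<^sub>f y_var) + (b ** d) \<cdot> (\<psi> \<circ>\<^sub>f y_var))"
      unfolding 1 2 by (simp add: act_add act_act)
    then show ?thesis by (simp add: act_add act_act algebra_simps)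
  qed
  then have "b' \<cdot> b \<cdot> (\<psi> \<circ>\<^sub>f H) = b' \<cdot> b \<cdot> (c \<cdot> (\<psi> \<circ>\<^sub>f x_var) + d \<cdot> (\<psi> \<circ>\<^sub>f y_var))" by simp
  then have "\<psi> \<circ>\<^sub>f H = c \<cdot> (\<psi> \<circ>\<^sub>f x_var) + d \<cdot> (\<psi> \<circ>\<^sub>f y_var)"
    unfolding act_act [of b' b] b' by simp
  with \<psi> \<psi>G show ?thesis by (intro that)
qed

end

theorem proposition4p6:
  fixes S R :: "('k::field, 'n::finite + 'n, 'n + 'n) formal_map"
    and a b c d :: "'k^'n^'n"
  assumes "CHAR('k) = 0 \<or> CARD('n) < CHAR('k)"
    and "universal_solution S"
    and "R = R_matrix S"
    and "linear_part R = linear_R a b c d"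
    and "resonance_free (eigenvalues b)"
  shows "isomorphic_solutions R (linear_part R)"
proof -
  define G where "G = (\<lambda>i. S (Inl i))"
  define H where "H = (\<lambda>i. S (Inr i))"
  have S: "S = case_sum G H" by (auto simp: G_def H_def fun_eq_iff split: sum.splits)
  have formal: "formal_mapping G" "formal_mapping H"
    using assms(2) by (auto simp: S universal_solution_def)
  have R: "R = case_sum H G"
    unfolding assms(3) R_matrix_def fm_flip_def S
    using formal by (simp add: case_sum_comp vars_comp_case_sum del: vars_comp)
  have lin: "mcoeff (linear_part R k) {#v#} = mcoeff (R k) {#v#}" for k v
    by (simp add: linear_part_def)
  interpret symmetric_solution G H a b c d
  proof
    show "universal_solution (case_sum G H)" using assms(2) S by simp
    show "mcoeff (G i) {#Inl j#} = a $ i $ j" "mcoeff (G i) {#Inr j#} = b $ i $ j"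
      "mcoeff (H i) {#Inl j#} = c $ i $ j" "mcoeff (H i) {#Inr j#} = d $ i $ j" for i j
      using lin [of "Inr i" "Inl j"] lin [of "Inr i" "Inr j"] lin [of "Inl i" "Inl j"] lin [of "Inl i" "Inr j"]
      unfolding assms(4) linear_R_eq by (simp_all add: R)
  qed
  obtain \<psi> where \<psi>: "formal_mapping \<psi>" "\<And>i. order_ge 2 ((\<psi> - fm_id) i)"
    "\<psi> \<circ>\<^sub>f G = a \<cdot> (\<psi> \<circ>\<^sub>f x_var) + b \<cdot> (\<psi> \<circ>\<^sub>f y_var)" "\<psi> \<circ>\<^sub>f H = c \<cdot> (\<psi> \<circ>\<^sub>f x_var) + d \<cdot> (\<psi> \<circ>\<^sub>f y_var)"
    by (rule linearisation_exists [OF assms(1,5)]) (rule that)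
  obtain \<theta> where \<theta>: "formal_mapping \<theta>" "\<psi> \<circ>\<^sub>f \<theta> = fm_id" "\<theta> \<circ>\<^sub>f \<psi> = fm_id"
    by (rule tangent_to_identity_inverse [OF \<psi>(1,2)])
  have prod: "fm_prod f f = case_sum (f \<circ>\<^sub>f x_var) (f \<circ>\<^sub>f y_var)" for f :: "('k, 'n, 'n) formal_map"
    by (simp add: fm_prod_def fm_comp_def)
  have \<psi>\<theta>: "\<psi> \<circ>\<^sub>f (\<theta> \<circ>\<^sub>f x) = x" if "formal_mapping x" for x :: "('k, 'n + 'n, 'n) formal_map"
    using that \<theta> by (simp flip: fm_comp_assoc)
  have 1: "fm_prod \<psi> \<psi> \<circ>\<^sub>f R = case_sum (\<psi> \<circ>\<^sub>f H) (\<psi> \<circ>\<^sub>f G)"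
    unfolding prod R using \<psi>(1) formal
    by (simp add: case_sum_comp fm_comp_assoc vars_comp_case_sum del: vars_comp)
  have 2: "case_sum (\<psi> \<circ>\<^sub>f H) (\<psi> \<circ>\<^sub>f G) \<circ>\<^sub>f fm_prod \<theta> \<theta> = case_sum (c \<cdot> x_var + d \<cdot> y_var) (a \<cdot> x_var + b \<cdot> y_var)"
    unfolding prod \<psi>(3,4) using \<theta>(1)
    by (simp add: case_sum_comp fm_comp_add act_comp fm_comp_assoc vars_comp_case_sum \<psi>\<theta> del: vars_comp)
  have "linear_part R = fm_prod \<psi> \<psi> \<circ>\<^sub>f R \<circ>\<^sub>f fm_prod \<theta> \<theta>"
    unfolding 1 2 assms(4) linear_R_eq ..
  with \<psi>(1) \<theta> show ?thesis unfolding isomorphic_solutions_def by blast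
qed

end
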